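(* Let $V(u)=1-u$ and let $\eta:\mathbb{R}\to\mathbb{R}$ be such that either $\eta=\mathbb{1}_{[-1,0]}$, or $\eta$ satisfies all of the following: $\eta(x)\ge0$ for every $x\in\mathbb{R}$, $\eta(x)=0$ for every $x>0$, $\int_{\mathbb{R}}\eta(x)\,dx=1$, $\eta$ is Lipschitz continuous on $]-\infty,0]$, and $\eta'(x)\ge0$ for a.e. $x\in\,]-\infty,0]$. For $\varepsilon>0$ set $\eta_\varepsilon(x):=\eta(x/\varepsilon)/\varepsilon$. Then there is $u_0\in L^\infty(\mathbb{R})$ such that $0\le u_0(x)\le1$ for a.e. $x\in\mathbb{R}$, $\mathrm{TotVar}\,u_0<+\infty$, $\mathrm{Lip}^-u_0<+\infty$, and such that the solutions $u_\varepsilon$ of the Cauchy problems $$\partial_tu_\varepsilon+\partial_x\big[u_\varepsilon V(u_\varepsilon*\eta_\varepsilon)\big]=0\ \text{ on }\mathbb{R}_+\times\mathbb{R},\qquad u_\varepsilon(0,\cdot)=u_0,$$ satisfy $$\sup_{\varepsilon>0}\mathrm{TotVar}\,u_\varepsilon(\tau,\cdot)=+\infty\qquad\text{for every }\tau>0 .$$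
   Context: For $f:\mathbb{R}\to\mathbb{R}$, $\mathrm{Lip}^-f:=-\inf_{x<y}\frac{f(y)-f(x)}{y-x}$; for an element of $L^\infty(\mathbb{R})$ this is understood for a suitable representative. $\mathrm{TotVar}$ denotes the total variation over $\mathbb{R}$ (essential total variation, for elements of $L^\infty$). The symbol $*$ denotes convolution in the space variable only: $(u*\eta_\varepsilon)(t,x)=\int_{\mathbb{R}}u(t,x-y)\eta_\varepsilon(y)\,dy$. For fixed $\varepsilon>0$, the solution $u_\varepsilon$ of the Cauchy problem is the unique bounded distributional solution, continuous in time with values in $L^1_{\mathrm{loc}}(\mathbb{R})$ and with values in $[0,1]$. It is obtained by a fixed point argument: $u_\varepsilon$ solves the continuity equation $\partial_tu_\varepsilon+\partial_x[u_\varepsilon(1-w_\varepsilon)]=0$ with $w_\varepsilon=u_\varepsilon*\eta_\varepsilon$, the velocity field $1-w_\varepsilon$ being Lipschitz in $x$ and continuous in $t$, and $u_\varepsilon$ being given by the method of characteristics for this field. *)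

theory Defs
  imports "HOL-Analysis.Analysis"
begin

definition total_variation :: "(real \<Rightarrow> real) \<Rightarrow> ennreal" where
  "total_variation f =
     (SUP (n, x) \<in> {(n :: nat, x :: nat \<Rightarrow> real). \<forall>i<n. x i \<le> x (Suc i)}.
        \<Sum>i<n. ennreal \<bar>f (x (Suc i)) - f (x i)\<bar>)"

definition ess_total_variation :: "(real \<Rightarrow> real) \<Rightarrow> ennreal" where
  "ess_total_variation f =
     (INF g \<in> {g. AE x in lborel. g x = f x}. total_variation g)"

definition Lip_minus :: "(real \<Rightarrow> real) \<Rightarrow> ereal" where
  "Lip_minus f = - (INF (x, y) \<in> {(x, y). x < y}. ereal ((f y - f x) / (y - x)))"

definition rescaled_kernel :: "(real \<Rightarrow> real) \<Rightarrow> real \<Rightarrow> real \<Rightarrow> real" where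
  "rescaled_kernel \<eta> \<epsilon> x = \<eta> (x / \<epsilon>) / \<epsilon>"

definition space_convolution ::
    "(real \<Rightarrow> real \<Rightarrow> real) \<Rightarrow> (real \<Rightarrow> real) \<Rightarrow> real \<Rightarrow> real \<Rightarrow> real" where
  "space_convolution u k t x = (LBINT y. u t (x - y) * k y)"

(* C-infinity functions of two real variables: f is totally differentiable everywhere and
   its partial derivatives are again such functions. The greatest fixed point is intended. *)
coinductive smooth_plane :: "(real \<times> real \<Rightarrow> real) \<Rightarrow> bool" where
  "\<lbrakk>\<And>p. (f has_derivative (\<lambda>h. fst h * f1 p + snd h * f2 p)) (at p);
    smooth_plane f1; smooth_plane f2\<rbrakk> \<Longrightarrow> smooth_plane f"

(* Test functions on the open half-plane of all (t, x) with t > 0, extended by zero. *)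
definition test_function :: "(real \<times> real \<Rightarrow> real) \<Rightarrow> bool" where
  "test_function \<phi> \<longleftrightarrow>
     smooth_plane \<phi> \<and> compact (closure {p. \<phi> p \<noteq> 0}) \<and>
     closure {p. \<phi> p \<noteq> 0} \<subseteq> {0<..} \<times> UNIV"

(* The integrand vanishes for t \<le> 0, because the test function does. *)
definition distributional_solution ::
    "(real \<Rightarrow> real) \<Rightarrow> (real \<Rightarrow> real) \<Rightarrow> (real \<Rightarrow> real \<Rightarrow> real) \<Rightarrow> bool" where
  "distributional_solution V k u \<longleftrightarrow>
     (\<forall>\<phi>. test_function \<phi> \<longrightarrow>
        (\<integral>(t, x). u t x * deriv (\<lambda>s. \<phi> (s, x)) t
             + u t x * V (space_convolution u k t x) * deriv (\<lambda>y. \<phi> (t, y)) x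
         \<partial>(lborel :: (real \<times> real) measure)) = 0)"

definition continuous_in_L1_loc :: "(real \<Rightarrow> real \<Rightarrow> real) \<Rightarrow> bool" where
  "continuous_in_L1_loc u \<longleftrightarrow>
     (\<forall>t\<ge>0. \<forall>R>0.
        ((\<lambda>s. LINT x:{-R..R}|lborel. \<bar>u s x - u t x\<bar>) \<longlongrightarrow> 0) (at t within {0..}))"

(* Only the values u t x with t \<ge> 0 matter. Taking u Borel rather than Lebesgue measurable is
   no restriction: a continuous curve in L1_loc has a Borel representative on the half-plane
   that agrees almost everywhere with u t for every t. *)
definition cauchy_solution ::
    "(real \<Rightarrow> real) \<Rightarrow> (real \<Rightarrow> real) \<Rightarrow> (real \<Rightarrow> real) \<Rightarrow> (real \<Rightarrow> real \<Rightarrow> real) \<Rightarrow> bool" where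
  "cauchy_solution V k u0 u \<longleftrightarrow>
     set_borel_measurable borel ({0..} \<times> UNIV) (\<lambda>(t, x). u t x) \<and>
     (\<forall>t\<ge>0. AE x in lborel. 0 \<le> u t x \<and> u t x \<le> 1) \<and>
     continuous_in_L1_loc u \<and>
     distributional_solution V k u \<and>
     (AE x in lborel. u 0 x = u0 x)"

end

theory Submission
  imports Defs
begin

text \<open>
  Read $u$ as the density of cars on a road. A car at $x$ looks ahead and drives with speed
  $1 - w$, where $w$ is the average of $u$ to the right of $x$ with weights that decrease with the
  distance. The datum has a full jam, $u = 1$, on $x \ge 0$, and behind it small platoons of cars
  that accumulate at the jam, at geometric scales, and are separated by empty gaps. The datum is
  1-Lipschitz on $x < 0$ and vanishes for $x \le -1$, so its total variation is at most $2$.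

  Two things happen. The gaps are never filled, because characteristics of a Lipschitz velocity
  field do not meet. And when $\varepsilon$ is small, a given platoon that starts close enough to the
  jam has reached it before the time $\tau$ and is compressed there to an average density of at least
  $1/2$. So at time $\tau$ the density oscillates between $0$ and $1/2$ once for each such platoon. There are
  infinitely many of them, and for each finite number of them a small enough $\varepsilon$ does the job.

  The compression is a comparison with a uniform platoon. The jam never moves (\<open>v_jam\<close>), and the label of
  a car, the mass between it and the jam, is constant in time (\<open>characteristic_label\<close>). Take a platoon
  of constant density $\rho < 1$ that drives with a speed $q < 1 - \rho$ and arrives at the jam at time
  $\tau$. If the real cars fell behind it, then at the first car that does so the mass ahead within distance $r$
  would be at most $\rho r$, so that this car would be faster than $q$, up to an error that vanishes with $\varepsilon$.
  Hence at time $\tau$ the car with label $m$ has at most $m (1/\rho - 1) + \beta$ of empty road ahead of it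
  (\<open>platoon_comparison\<close>). As the scales are geometric, for $\rho$ close to $1$ this is less than the mass
  of the platoon in which the car drives, and so at most half of that platoon is empty road.

  All properties of the kernel come from its monotonicity on the negative half-line, through the layer cake
  formula $w(x) = \int_0^{k(0)} (M(x + \ell(s)) - M(x))\,ds$ with a primitive $M$ of $u$ and the length
  $\ell(s)$ of the set where $k > s$ (\<open>convolution_eq_lookahead\<close>). It makes sense for all
  monotone 1-Lipschitz $M$ and is stable in the supremum norm.

  A solution exists because the flow of the cars is a fixed point. Flows that keep the
  density at most $1$ form a convex set, and the explicit Euler step of length $1/k(0)$ maps it
  into itself: this is the maximum principle. Hence Duhamel's formula, which averages such steps, is a contraction
  of that set in a weighted norm (\<open>flow_exists\<close>). The density of the transported mass is the
  solution (\<open>u_solution\<close>). The blow-up is proved for an arbitrary weak solution: testing with products of smooth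
  steps shows that the mass in an interval changes by the flux through its end points (\<open>flux_identity\<close>),
  and the proof uses only this balance.
\<close>

section \<open>Monotone kernels\<close>

text \<open>These are the primitives of the densities with values in $[0,1]$. The nonlocal term makes sense for them without any
  density, and it is stable in their supremum norm (\<open>lookahead_stable\<close>).\<close>

definition potential :: "(real \<Rightarrow> real) \<Rightarrow> bool" where
  "potential M \<longleftrightarrow> (\<forall>x y. x \<le> y \<longrightarrow> M x \<le> M y \<and> M y - M x \<le> y - x)"

lemma potential_mono: "potential M \<Longrightarrow> x \<le> y \<Longrightarrow> M x \<le> M y"
  by (auto simp: potential_def)

lemma potential_lip: "potential M \<Longrightarrow> x \<le> y \<Longrightarrow> M y - M x \<le> y - x"
  by (auto simp: potential_def)

lemma potential_abs: "potential M \<Longrightarrow> \<bar>M x - M y\<bar> \<le> \<bar>x - y\<bar>"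
  unfolding potential_def by (cases "x \<le> y") (smt (verit))+

lemma potential_continuous: "potential M \<Longrightarrow> continuous_on S M"
proof -
  assume "potential M"
  then have "1-lipschitz_on S M"
    by (auto intro!: lipschitz_onI simp: dist_real_def potential_abs)
  then show ?thesis by (rule lipschitz_on_continuous_on)
qed

lemma potential_measurable[measurable_dest]: "potential M \<Longrightarrow> M \<in> borel_measurable borel"
  by (intro borel_measurable_continuous_onI potential_continuous)

definition density_fn :: "(real \<Rightarrow> real) \<Rightarrow> bool" where
  "density_fn f \<longleftrightarrow> f \<in> borel_measurable borel \<and> (\<forall>x. 0 \<le> f x \<and> f x \<le> 1)"

lemma density_fnD[simp]: assumes "density_fn f" 
  shows "0 \<le> f x" "f x \<le> 1" "f \<in> borel_measurable borel" "f \<in> borel_measurable lborel"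
  using assms by (auto simp: density_fn_def)

lemma density_fn_integrable:
  assumes "density_fn f" "S \<in> sets borel" "emeasure lborel S < \<infinity>"
  shows "set_integrable lborel S f"
proof -
  have [measurable]: "f \<in> borel_measurable borel" "S \<in> sets borel" using assms by auto
  show ?thesis
    unfolding set_integrable_def
    by (rule integrableI_bounded_set[where A=S and B=1]) (use assms in \<open>auto simp: indicator_def\<close>)
qed

lemma indicator_Icc_integrable[simp]: 
  fixes a b :: real
  shows "integrable lborel (indicat_real {a..b})"
  by (rule integrable_real_indicator) (auto simp: emeasure_lborel_Icc_eq)

lemma indicator_Ioo_integrable[simp]: 
  fixes a b :: real
  shows "integrable lborel (indicat_real {a<..<b})"
  by (rule Bochner_Integration.integrable_bound[OF indicator_Icc_integrable[of a b]])
    (auto simp: indicator_def)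

definition primitive :: "(real \<Rightarrow> real) \<Rightarrow> real \<Rightarrow> real" where
  "primitive f x = (LBINT z:{0..x}. f z) - (LBINT z:{x..0}. f z)"

lemma primitive_diff:
  assumes f: "density_fn f" and ab: "a \<le> b"
  shows "primitive f b - primitive f a = (LBINT z:{a..b}. f z)"
proof -
  have i: "set_integrable lborel {x..y} f" for x y 
    by (rule density_fn_integrable[OF f]) (auto simp: emeasure_lborel_Icc_eq)
  have e: "(LBINT z:{x..y}. f z) = integral {x..y} f" for x y
    using set_borel_integral_eq_integral(2)[OF i] by simp
  have io: "f integrable_on {x..y}" for x y
    using set_borel_integral_eq_integral(1)[OF i] by simp
  have z: "integral {x..y} f = 0" if "y \<le> x" for x y
    using that by (cases "x = y") auto
  have p: "primitive f x = (if x \<ge> 0 then integral {0..x} f else - integral {x..0} f)" for x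
    by (auto simp: primitive_def e z)
  show ?thesis
    unfolding p e using ab Henstock_Kurzweil_Integration.integral_combine[OF _ _ io, of 0 a b]
      Henstock_Kurzweil_Integration.integral_combine[OF _ _ io, of a 0 b]
      Henstock_Kurzweil_Integration.integral_combine[OF _ _ io, of a b 0]
    by auto
qed

lemma primitive_potential:
  assumes f: "density_fn f" shows "potential (primitive f)"
  unfolding potential_def
proof (intro allI impI)
  fix x y :: real assume "x \<le> y"
  have i: "set_integrable lborel {x..y} f"
    by (rule density_fn_integrable[OF f]) (auto simp: emeasure_lborel_Icc_eq)
  have "0 \<le> (LBINT z:{x..y}. f z)"
    unfolding set_lebesgue_integral_def using f by (intro integral_nonneg_AE) auto
  moreover have "(LBINT z:{x..y}. f z) \<le> (LBINT z:{x..y}. 1)"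
    using f by (intro set_integral_mono i) (auto simp: set_integrable_def)
  moreover have "(LBINT z:{x..y}. (1::real)) = y - x"
    using \<open>x \<le> y\<close> by (simp add: set_lebesgue_integral_def)
  ultimately show "primitive f x \<le> primitive f y \<and> primitive f y - primitive f x \<le> y - x"
    using primitive_diff[OF f \<open>x \<le> y\<close>] by auto
qed

lemma primitive_diff_nn:
  assumes f: "density_fn f" and ab: "a \<le> b"
  shows "(\<integral>\<^sup>+z. ennreal (f z) * indicator {a..b} z \<partial>lborel) = ennreal (primitive f b - primitive f a)"
proof -
  have i: "set_integrable lborel {a..b} f"
    by (rule density_fn_integrable[OF f]) (auto simp: emeasure_lborel_Icc_eq)
  have "(\<integral>\<^sup>+z. ennreal (f z) * indicator {a..b} z \<partial>lborel) = (\<integral>\<^sup>+z. ennreal (indicator {a..b} z * f z) \<partial>lborel)"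
    by (intro nn_integral_cong) (auto simp: indicator_def)
  also have "\<dots> = ennreal (LBINT z. indicator {a..b} z * f z)"
    using i f by (intro nn_integral_eq_integral) (auto simp: set_integrable_def)
  finally show ?thesis 
    unfolding primitive_diff[OF f ab] by (simp add: set_lebesgue_integral_def)
qed

definition monotone_kernel :: "(real \<Rightarrow> real) \<Rightarrow> bool" where
  "monotone_kernel k \<longleftrightarrow> (\<forall>x. 0 \<le> k x) \<and> (\<forall>x>0. k x = 0) \<and> mono_on {..0} k \<and>
     integrable lborel k \<and> (LBINT x. k x) = 1"

lemma monotone_kernelD:
  assumes "monotone_kernel k"
  shows "0 \<le> k x" "x > 0 \<Longrightarrow> k x = 0" "x \<le> y \<Longrightarrow> y \<le> 0 \<Longrightarrow> k x \<le> k y"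
    "integrable lborel k" "(LBINT x. k x) = 1" "k \<in> borel_measurable borel"
  using assms unfolding monotone_kernel_def by (auto simp: mono_on_def dest: borel_measurable_integrable)

lemma monotone_kernel_decay:
  assumes k: "monotone_kernel k" and r: "0 \<le> r"
  shows "r * k (-r) \<le> 1"
proof -
  note kD = monotone_kernelD[OF k]
  have "r * k (-r) = (LBINT x. indicator {-r..0} x * k (-r))"
    using r by simp
  also have "\<dots> \<le> (LBINT x. k x)"
    by (intro integral_mono integrable_mult_left indicator_Icc_integrable kD)
      (use kD r in \<open>auto simp: indicator_def\<close>)
  finally show ?thesis using kD by simp
qed

lemma monotone_kernel_pos:
  assumes k: "monotone_kernel k" shows "0 < k 0"
proof (rule ccontr)
  assume "\<not> 0 < k 0"
  then have "k x = 0" for x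
    using monotone_kernelD(1,2)[OF k, of x] monotone_kernelD(3)[OF k, of x 0] by force
  then have "(LBINT x. k x) = 0" by simp
  then show False using monotone_kernelD(5)[OF k] by simp
qed

text \<open>As the kernel is monotone, the set of the $r \ge 0$ with \<open>s < k (-r)\<close> is an interval that starts at $0$. This is its length.\<close>

definition level :: "(real \<Rightarrow> real) \<Rightarrow> real \<Rightarrow> real" where
  "level k s = Sup {r. 0 \<le> r \<and> s < k (-r)}"

lemma level_bdd:
  assumes k: "monotone_kernel k" and s: "0 < s"
  shows "bdd_above {r. 0 \<le> r \<and> s < k (-r)}"
proof (rule bdd_aboveI[of _ "1/s"], clarify)
  fix r assume r: "0 \<le> r" "s < k (-r)"
  have "r * s \<le> r * k (-r)" using r by (intro mult_left_mono) auto
  also have "\<dots> \<le> 1" by (rule monotone_kernel_decay[OF k r(1)])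
  finally show "r \<le> 1 / s" using s by (simp add: field_simps)
qed

lemma level_upper:
  assumes k: "monotone_kernel k" and "0 < s" "0 \<le> r" "s < k (-r)"
  shows "r \<le> level k s"
  unfolding level_def using assms by (intro cSup_upper level_bdd[OF k]) auto

lemma level_nonneg:
  assumes k: "monotone_kernel k" and "0 < s" "s < k 0"
  shows "0 \<le> level k s"
  using level_upper[OF k, of s 0] assms by simp

lemma level_below:
  assumes k: "monotone_kernel k" and s: "0 < s" "s < k 0" and r: "0 \<le> r" "r < level k s"
  shows "s < k (-r)"
proof -
  have "{r. 0 \<le> r \<and> s < k (-r)} \<noteq> {}" using s by (auto intro!: exI[of _ 0])
  then obtain r' where r': "0 \<le> r'" "s < k (-r')" "r < r'"
    using less_cSup_iff[OF _ level_bdd[OF k s(1)]] r(2) unfolding level_def by auto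
  then show ?thesis using monotone_kernelD(3)[OF k, of "-r'" "-r"] r by auto
qed

lemma level_antimono:
  assumes k: "monotone_kernel k" and s: "0 < s" "s \<le> s'" "s' < k 0"
  shows "level k s' \<le> level k s"
  unfolding level_def 
  by (rule cSup_subset_mono[OF _ level_bdd[OF k s(1)]]) (use s in \<open>auto intro!: exI[of _ 0]\<close>)

lemma level_measurable:
  fixes g :: "real \<Rightarrow> real"
  assumes k: "monotone_kernel k" and g: "g \<in> borel_measurable borel"
  shows "set_borel_measurable lborel {0<..<k 0} (\<lambda>s. g (level k s))"
proof -
  have "(\<lambda>s. - level k s) \<in> borel_measurable (restrict_space borel {0<..<k 0})"
    by (rule borel_measurable_mono_on_fnc) (auto intro!: mono_onI level_antimono[OF k])
  then have "(\<lambda>s. g (- (- level k s))) \<in> borel_measurable (restrict_space borel {0<..<k 0})"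
    using g by measurable
  then show ?thesis
    using borel_measurable_restrict_space_iff[of "{0<..<k 0}" borel "\<lambda>s. g (level k s)"] 
    by (simp add: set_borel_measurable_def)
qed

text \<open>The nonlocal density ahead of $x$, as a function of the potential \<open>M\<close>: see \<open>convolution_eq_lookahead\<close>.\<close>

definition lookahead :: "(real \<Rightarrow> real) \<Rightarrow> (real \<Rightarrow> real) \<Rightarrow> real \<Rightarrow> real" where
  "lookahead k M x = (LBINT s:{0<..<k 0}. M (x + level k s) - M x)"

text \<open>Layer cake: \<open>k (-r)\<close> is the length of the set of levels below it. After swapping the integrals, each level contributes
  the mass in the interval on which the kernel exceeds it.\<close>

lemma convolution_nn:
  assumes k: "monotone_kernel k" and f: "density_fn f"
  shows "(\<integral>\<^sup>+y. ennreal (f (x - y) * k y) \<partial>lborel) =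
     (\<integral>\<^sup>+s. ennreal (indicator {0<..<k 0} s * (primitive f (x + level k s) - primitive f x)) \<partial>lborel)"
proof -
  note kD = monotone_kernelD[OF k]
  have [measurable]: "k \<in> borel_measurable borel" "f \<in> borel_measurable borel"
    using kD f by auto
  have "(\<integral>\<^sup>+y. ennreal (f (x - y) * k y) \<partial>lborel) = (\<integral>\<^sup>+r. ennreal (f (x + r) * k (-r)) \<partial>lborel)"
    by (subst nn_integral_real_affine[where c="-1" and t=0]) auto
  also have "\<dots> = (\<integral>\<^sup>+r. (\<integral>\<^sup>+s. ennreal (f (x + r)) * indicator {(r, s). 0 \<le> r \<and> 0 < s \<and> s < k (-r)} (r, s) \<partial>lborel) \<partial>lborel)"
  proof (rule nn_integral_cong)
    fix r
    have "(\<integral>\<^sup>+s. ennreal (f (x + r)) * indicator {(r, s). 0 \<le> r \<and> 0 < s \<and> s < k (-r)} (r, s) \<partial>lborel)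
      = (\<integral>\<^sup>+s. ennreal (f (x + r)) * indicator {0<..<k(-r)} s \<partial>lborel)"
      using kD by (intro nn_integral_cong) (auto simp: indicator_def not_le intro!: kD(2))
    also have "\<dots> = ennreal (f (x + r)) * ennreal (k (-r))"
      using kD by (subst nn_integral_cmult) auto
    finally show "ennreal (f (x + r) * k (-r)) = (\<integral>\<^sup>+s. ennreal (f (x + r)) * indicator {(r, s). 0 \<le> r \<and> 0 < s \<and> s < k (-r)} (r, s) \<partial>lborel)"
      using f kD by (simp add: ennreal_mult)
  qed
  also have "\<dots> = (\<integral>\<^sup>+s. (\<integral>\<^sup>+r. ennreal (f (x + r)) * indicator {(r, s). 0 \<le> r \<and> 0 < s \<and> s < k (-r)} (r, s) \<partial>lborel) \<partial>lborel)"
    by (rule lborel_pair.Fubini'[symmetric]) measurable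
  also have "\<dots> = (\<integral>\<^sup>+s. ennreal (indicator {0<..<k 0} s * (primitive f (x + level k s) - primitive f x)) \<partial>lborel)"
  proof (rule nn_integral_cong)
    fix s
    show "(\<integral>\<^sup>+r. ennreal (f (x + r)) * indicator {(r, s). 0 \<le> r \<and> 0 < s \<and> s < k (-r)} (r, s) \<partial>lborel) =
      ennreal (indicator {0<..<k 0} s * (primitive f (x + level k s) - primitive f x))"
    proof (cases "0 < s \<and> s < k 0")
      case True
      have "(\<integral>\<^sup>+r. ennreal (f (x + r)) * indicator {(r, s). 0 \<le> r \<and> 0 < s \<and> s < k (-r)} (r, s) \<partial>lborel) =
        (\<integral>\<^sup>+r. ennreal (f (x + r)) * indicator {x..x+level k s} (x + r) \<partial>lborel)"
      proof (rule nn_integral_cong_AE, rule AE_mp[OF AE_lborel_singleton[of "level k s"]], rule AE_I2, rule impI)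
        fix r assume "r \<noteq> level k s"
        then show "ennreal (f (x + r)) * indicator {(r, s). 0 \<le> r \<and> 0 < s \<and> s < k (-r)} (r, s) =
          ennreal (f (x + r)) * indicator {x..x+level k s} (x + r)"
          using level_upper[OF k, of s r] level_below[OF k, of s r] True
          by (auto simp: indicator_def)
      qed
      also have "\<dots> = (\<integral>\<^sup>+z. ennreal (f z) * indicator {x..x+level k s} z \<partial>lborel)"
        by (subst (2) nn_integral_real_affine[where c=1 and t=x]) auto
      also have "\<dots> = ennreal (primitive f (x + level k s) - primitive f x)"
        using True level_nonneg[OF k, of s] by (intro primitive_diff_nn[OF f]) auto
      finally show ?thesis using True by simp
    next
      case False
      have "\<not> (0 \<le> r \<and> 0 < s \<and> s < k (-r))" for r
        using False kD(3)[of "-r" 0] by auto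
      then have 1: "indicator {(r, s). 0 \<le> r \<and> 0 < s \<and> s < k (-r)} (r, s) = (0::ennreal)" for r
        by (simp add: indicator_def)
      have 2: "indicator {0<..<k 0} s = (0::real)" using False by (auto simp: indicator_def)
      show ?thesis unfolding 1 2 by simp
    qed
  qed
  finally show ?thesis .
qed

lemma level_integral:
  assumes k: "monotone_kernel k"
  shows "set_integrable lborel {0<..<k 0} (level k)" "(LBINT s:{0<..<k 0}. level k s) = 1"
proof -
  note kD = monotone_kernelD[OF k]
  have f: "density_fn (\<lambda>_. 1)" by (simp add: density_fn_def)
  have p: "primitive (\<lambda>_. 1) (x + level k s) - primitive (\<lambda>_. 1) x = level k s" if "0 < s" "s < k 0" for x s
    using level_nonneg[OF k that] by (subst primitive_diff[OF f]) (auto simp: set_lebesgue_integral_def)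
  have "(\<integral>\<^sup>+s. ennreal (indicator {0<..<k 0} s * level k s) \<partial>lborel) =
     (\<integral>\<^sup>+s. ennreal (indicator {0<..<k 0} s * (primitive (\<lambda>_. 1) (0 + level k s) - primitive (\<lambda>_. 1) 0)) \<partial>lborel)"
    by (intro nn_integral_cong) (auto simp: indicator_def p simp del: add_0)
  also have "\<dots> = (\<integral>\<^sup>+y. ennreal (k y) \<partial>lborel)"
    using convolution_nn[OF k f, of 0] by simp
  also have "\<dots> = ennreal 1"
    using kD by (subst nn_integral_eq_integral) auto
  finally have *: "(\<integral>\<^sup>+s. ennreal (indicator {0<..<k 0} s * level k s) \<partial>lborel) = ennreal 1" .
  have [measurable]: "(\<lambda>s. indicator {0<..<k 0} s * level k s) \<in> borel_measurable lborel"
    using level_measurable[OF k, of "\<lambda>x. x"] by (simp add: set_borel_measurable_def)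
  have nn: "0 \<le> indicator {0<..<k 0} s * level k s" for s
    using level_nonneg[OF k, of s] by (auto simp: indicator_def)
  show "set_integrable lborel {0<..<k 0} (level k)"
    unfolding set_integrable_def
    by (rule integrableI_nn_integral_finite[where x=1]) (use * nn in auto)
  show "(LBINT s:{0<..<k 0}. level k s) = 1"
    unfolding set_lebesgue_integral_def
    by (subst integral_eq_nn_integral) (use * nn in auto)
qed

lemma lookahead_integrable:
  assumes k: "monotone_kernel k" and M: "potential M"
  shows "set_integrable lborel {0<..<k 0} (\<lambda>s. M (x + level k s) - M x)"
proof (rule set_integrable_bound[OF level_integral(1)[OF k]])
  have [measurable]: "M \<in> borel_measurable borel" using M by (rule potential_measurable)
  show "set_borel_measurable lborel {0<..<k 0} (\<lambda>s. M (x + level k s) - M x)"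
    by (rule level_measurable[OF k]) measurable
  show "AE s in lborel. s \<in> {0<..<k 0} \<longrightarrow> norm (M (x + level k s) - M x) \<le> norm (level k s)"
    using potential_abs[OF M, of "x + level k _" x] by auto
qed

lemma convolution_eq_lookahead:
  assumes k: "monotone_kernel k" and f: "density_fn f"
  shows "(LBINT y. f (x - y) * k y) = lookahead k (primitive f) x"
proof -
  have [measurable]: "k \<in> borel_measurable borel" "f \<in> borel_measurable borel"
    using monotone_kernelD[OF k] f by auto
  have "(LBINT y. f (x - y) * k y) = enn2real (\<integral>\<^sup>+y. ennreal (f (x - y) * k y) \<partial>lborel)"
    using f monotone_kernelD[OF k] by (intro integral_eq_nn_integral) auto
  also have "\<dots> = lookahead k (primitive f) x"
    unfolding convolution_nn[OF k f] lookahead_def set_lebesgue_integral_def real_scaleR_def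
  proof (rule integral_eq_nn_integral[symmetric])
    show "(\<lambda>s. indicator {0<..<k 0} s * (primitive f (x + level k s) - primitive f x)) \<in> borel_measurable lborel"
      using lookahead_integrable[OF k primitive_potential[OF f], of x]
      by (auto simp: set_integrable_def)
    show "AE s in lborel. 0 \<le> indicator {0<..<k 0} s * (primitive f (x + level k s) - primitive f x)"
      using potential_mono[OF primitive_potential[OF f], of x "x + level k _"] level_nonneg[OF k]
      by (auto simp: indicator_def)
  qed
  finally show ?thesis .
qed

lemma lookahead_nonneg:
  assumes k: "monotone_kernel k" and M: "potential M"
  shows "0 \<le> lookahead k M x"
  unfolding lookahead_def set_lebesgue_integral_def
  by (intro integral_nonneg_AE AE_I2) 
    (use level_nonneg[OF k] potential_mono[OF M] in \<open>auto simp: indicator_def\<close>)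

lemma lookahead_diff_le:
  assumes k: "monotone_kernel k" and M: "potential M" and M': "potential M'"
    and le: "\<And>r. 0 \<le> r \<Longrightarrow> (M (x + r) - M x) - (M' (x' + r) - M' x') \<le> c"
  shows "lookahead k M x - lookahead k M' x' \<le> k 0 * c"
proof -
  have k0: "0 < k 0" by (rule monotone_kernel_pos[OF k])
  have "lookahead k M x - lookahead k M' x' =
    (LBINT s:{0<..<k 0}. (M (x + level k s) - M x) - (M' (x' + level k s) - M' x'))"
    unfolding lookahead_def
    by (rule set_integral_diff(2)[symmetric]) (rule lookahead_integrable[OF k] M M')+
  also have "\<dots> \<le> (LBINT s:{0<..<k 0}. c)"
  proof (rule set_integral_mono)
    show "set_integrable lborel {0<..<k 0} (\<lambda>s. M (x + level k s) - M x - (M' (x' + level k s) - M' x'))"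
      by (rule set_integral_diff(1)) (rule lookahead_integrable[OF k] M M')+
    show "set_integrable lborel {0<..<k 0} (\<lambda>s. c)"
      by (simp add: set_integrable_def)
  qed (use le level_nonneg[OF k] in auto)
  also have "\<dots> = k 0 * c"
    using k0 by (simp add: set_lebesgue_integral_def)
  finally show ?thesis .
qed

lemma lookahead_le_1:
  assumes k: "monotone_kernel k" and M: "potential M"
  shows "lookahead k M x \<le> 1"
proof -
  have "lookahead k M x \<le> (LBINT s:{0<..<k 0}. level k s)"
    unfolding lookahead_def
    by (intro set_integral_mono lookahead_integrable[OF k] M level_integral[OF k])
      (use level_nonneg[OF k] potential_lip[OF M, of x "x + level k _"] in auto)
  then show ?thesis using level_integral[OF k] by simp
qed

text \<open>The source of the maximum principle. When the observer moves from $x$ to $x'$, the view at each level gains a mass of at most $x' - x$ at its far end and loses the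
  mass between $x$ and $x'$ at its near end. The balance is at most the empty road between the two points.\<close>

lemma lookahead_one_sided:
  assumes k: "monotone_kernel k" and M: "potential M" and "x \<le> x'"
  shows "lookahead k M x' - lookahead k M x \<le> k 0 * ((x' - x) - (M x' - M x))"
proof (rule lookahead_diff_le[OF k M M])
  fix r :: real assume "0 \<le> r"
  then show "M (x' + r) - M x' - (M (x + r) - M x) \<le> x' - x - (M x' - M x)"
    using potential_lip[OF M, of "x + r" "x' + r"] assms by auto
qed

lemma lookahead_lipschitz:
  assumes k: "monotone_kernel k" and M: "potential M"
  shows "\<bar>lookahead k M x - lookahead k M y\<bar> \<le> k 0 * \<bar>x - y\<bar>"
proof -
  have *: "lookahead k M x - lookahead k M y \<le> k 0 * \<bar>x - y\<bar>" for x y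
  proof (rule lookahead_diff_le[OF k M M])
    fix r :: real assume r: "0 \<le> r"
    show "M (x + r) - M x - (M (y + r) - M y) \<le> \<bar>x - y\<bar>"
    proof (cases "x \<le> y")
      case True
      then show ?thesis using potential_lip[OF M True] potential_mono[OF M, of "x + r" "y + r"] by auto
    next
      case False
      then show ?thesis using potential_lip[OF M, of "y + r" "x + r"] potential_mono[OF M, of y x] by auto
    qed
  qed
  show ?thesis using *[of x y] *[of y x] by (auto simp: abs_minus_commute)
qed

lemma lookahead_stable:
  assumes k: "monotone_kernel k" and M: "potential M" and M': "potential M'" 
    and d: "\<And>z. \<bar>M z - M' z\<bar> \<le> d"
  shows "\<bar>lookahead k M x - lookahead k M' x\<bar> \<le> k 0 * (2 * d)"
proof -
  have "lookahead k M x - lookahead k M' x \<le> k 0 * (2 * d)"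
    by (rule lookahead_diff_le[OF k M M']) (use d[of x] d[of "x + _"] in \<open>smt (verit)\<close>)
  moreover have "lookahead k M' x - lookahead k M x \<le> k 0 * (2 * d)"
    by (rule lookahead_diff_le[OF k M' M]) (use d[of x] d[of "x + _"] in \<open>smt (verit)\<close>)
  ultimately show ?thesis by auto
qed

lemma lookahead_tendsto:
  fixes M :: "real \<Rightarrow> real" and Mn :: "nat \<Rightarrow> real \<Rightarrow> real"
  assumes k: "monotone_kernel k" and M: "potential M" and Mn: "\<And>n. potential (Mn n)"
    and lim: "\<And>z. (\<lambda>n::nat. Mn n z) \<longlonglongrightarrow> M z"
  shows "(\<lambda>n. lookahead k (Mn n) x) \<longlonglongrightarrow> lookahead k M x"
  unfolding lookahead_def set_lebesgue_integral_def
proof (rule integral_dominated_convergence[where w="\<lambda>s. indicator {0<..<k 0} s *\<^sub>R level k s"])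
  show "(\<lambda>s. indicator {0<..<k 0} s *\<^sub>R (M (x + level k s) - M x)) \<in> borel_measurable lborel"
    using lookahead_integrable[OF k M, of x] unfolding set_integrable_def by auto
  show "(\<lambda>s. indicator {0<..<k 0} s *\<^sub>R (Mn n (x + level k s) - Mn n x)) \<in> borel_measurable lborel" for n
    using lookahead_integrable[OF k Mn, of n x] unfolding set_integrable_def by auto
  show "integrable lborel (\<lambda>s. indicator {0<..<k 0} s *\<^sub>R level k s)"
    using level_integral(1)[OF k] by (simp add: set_integrable_def)
  show "AE s in lborel. (\<lambda>n. indicator {0<..<k 0} s *\<^sub>R (Mn n (x + level k s) - Mn n x)) 
      \<longlonglongrightarrow> indicator {0<..<k 0} s *\<^sub>R (M (x + level k s) - M x)"
    by (intro AE_I2 tendsto_intros lim)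
  show "AE s in lborel. norm (indicator {0<..<k 0} s *\<^sub>R (Mn n (x + level k s) - Mn n x))
      \<le> indicator {0<..<k 0} s *\<^sub>R level k s" for n
  proof (rule AE_I2)
    fix s
    have "\<bar>Mn n (x + level k s) - Mn n x\<bar> \<le> \<bar>level k s\<bar>"
      using potential_abs[where M="Mn n" and x="x + level k s" and y=x] Mn by simp
    then show "norm (indicator {0<..<k 0} s *\<^sub>R (Mn n (x + level k s) - Mn n x))
      \<le> indicator {0<..<k 0} s *\<^sub>R level k s"
      using level_nonneg[OF k, of s] by (auto simp: indicator_def)
  qed
qed

text \<open>The part of the kernel that sees farther than \<open>b\<close>. Beyond that distance the density is only known to be at most $1$, and this is the price.\<close>

definition level_tail :: "(real \<Rightarrow> real) \<Rightarrow> real \<Rightarrow> real" where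
  "level_tail k b = (LBINT s:{0<..<k 0}. (if b \<le> level k s then level k s else 0))"

lemma level_tail_integrable:
  assumes k: "monotone_kernel k"
  shows "set_integrable lborel {0<..<k 0} (\<lambda>s. if b \<le> level k s then level k s else 0)"
  by (rule set_integrable_bound[OF level_integral(1)[OF k]])
    (auto intro!: level_measurable[OF k])

text \<open>Sparse traffic within the distance \<open>b\<close> makes a car fast, whatever the density is beyond.\<close>

lemma lookahead_sparse:
  assumes k: "monotone_kernel k" and M: "potential M" and "0 \<le> \<rho>" "0 \<le> d"
    and le: "\<And>r. 0 \<le> r \<Longrightarrow> r < b \<Longrightarrow> M (x + r) - M x \<le> \<rho> * r + d"
  shows "lookahead k M x \<le> \<rho> + k 0 * d + level_tail k b"
proof -
  have k0: "0 < k 0" by (rule monotone_kernel_pos[OF k])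
  have c: "set_integrable lborel {0<..<k 0} (\<lambda>s. d)" by (simp add: set_integrable_def)
  have "lookahead k M x \<le> (LBINT s:{0<..<k 0}. (\<rho> * level k s + d) + (if b \<le> level k s then level k s else 0))"
    unfolding lookahead_def
  proof (intro set_integral_mono lookahead_integrable[OF k] M set_integral_add c set_integrable_mult_right
      level_tail_integrable[OF k] level_integral(1)[OF k])
    fix s assume s: "s \<in> {0<..<k 0}"
    then have "0 \<le> level k s" using level_nonneg[OF k] by auto
    then show "M (x + level k s) - M x \<le> \<rho> * level k s + d + (if b \<le> level k s then level k s else 0)"
      using le[of "level k s"] potential_lip[OF M, of x "x + level k s"] assms(3,4) by (auto intro: add_increasing)
  qed
  also have "\<dots> = \<rho> * (LBINT s:{0<..<k 0}. level k s) + (LBINT s:{0<..<k 0}. d) + level_tail k b"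
    unfolding level_tail_def
    by (simp add: set_integral_add level_tail_integrable[OF k] level_integral(1)[OF k] c)
  also have "\<dots> = \<rho> + k 0 * d + level_tail k b"
    using k0 level_integral(2)[OF k] by (simp add: set_lebesgue_integral_def)
  finally show ?thesis .
qed

lemma rescaled_monotone:
  assumes k: "monotone_kernel \<eta>" and e: "0 < \<epsilon>"
  shows "monotone_kernel (rescaled_kernel \<eta> \<epsilon>)"
proof -
  note kD = monotone_kernelD[OF k]
  have [simp]: "rescaled_kernel \<eta> \<epsilon> = (\<lambda>x. \<eta> (0 + (1/\<epsilon>) * x) / \<epsilon>)"
    by (auto simp: rescaled_kernel_def fun_eq_iff)
  have "(LBINT x. \<eta> x) = \<bar>1/\<epsilon>\<bar> *\<^sub>R (LBINT x. \<eta> (0 + (1/\<epsilon>) * x))"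
    using e by (intro lborel_integral_real_affine) auto
  then have 1: "(LBINT x. rescaled_kernel \<eta> \<epsilon> x) = 1" using kD(5) e by simp
  have 2: "integrable lborel (rescaled_kernel \<eta> \<epsilon>)"
    using lborel_integrable_real_affine[OF kD(4), of "1/\<epsilon>" 0] e by auto
  have "mono_on {..0} (rescaled_kernel \<eta> \<epsilon>)"
    using e by (auto intro!: mono_onI divide_right_mono kD(3) simp: divide_nonpos_pos)
  with 1 2 show ?thesis unfolding monotone_kernel_def
    using kD(1,2) e by auto
qed

lemma level_rescaled:
  assumes k: "monotone_kernel \<eta>" and e: "0 < \<epsilon>" and s: "0 < s" "s < \<eta> 0"
  shows "level (rescaled_kernel \<eta> \<epsilon>) (s / \<epsilon>) = \<epsilon> * level \<eta> s"
proof -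
  note k' = rescaled_monotone[OF k e]
  have s': "0 < s / \<epsilon>" "s / \<epsilon> < rescaled_kernel \<eta> \<epsilon> 0"
    using s e by (auto simp: rescaled_kernel_def divide_strict_right_mono)
  show ?thesis
  proof (rule antisym)
    show "level (rescaled_kernel \<eta> \<epsilon>) (s / \<epsilon>) \<le> \<epsilon> * level \<eta> s"
      unfolding level_def[of "rescaled_kernel \<eta> \<epsilon>"]
    proof (rule cSup_least)
      show "{r. 0 \<le> r \<and> s / \<epsilon> < rescaled_kernel \<eta> \<epsilon> (- r)} \<noteq> {}" using s' by (auto intro!: exI[of _ 0])
      fix r assume "r \<in> {r. 0 \<le> r \<and> s / \<epsilon> < rescaled_kernel \<eta> \<epsilon> (- r)}"
      then have "r / \<epsilon> \<le> level \<eta> s" using e s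
        by (intro level_upper[OF k]) (auto simp: rescaled_kernel_def divide_less_cancel)
      then show "r \<le> \<epsilon> * level \<eta> s" using e by (simp add: field_simps)
    qed
    have "level \<eta> s \<le> level (rescaled_kernel \<eta> \<epsilon>) (s / \<epsilon>) / \<epsilon>"
      unfolding level_def[of \<eta>]
    proof (rule cSup_least)
      show "{r. 0 \<le> r \<and> s < \<eta> (- r)} \<noteq> {}" using s by (auto intro!: exI[of _ 0])
      fix r assume "r \<in> {r. 0 \<le> r \<and> s < \<eta> (- r)}"
      then have "\<epsilon> * r \<le> level (rescaled_kernel \<eta> \<epsilon>) (s / \<epsilon>)" using e s'
        by (intro level_upper[OF k']) (auto simp: rescaled_kernel_def divide_less_cancel)
      then show "r \<le> level (rescaled_kernel \<eta> \<epsilon>) (s / \<epsilon>) / \<epsilon>" using e by (simp add: field_simps)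
    qed
    then show "\<epsilon> * level \<eta> s \<le> level (rescaled_kernel \<eta> \<epsilon>) (s / \<epsilon>)" using e by (simp add: field_simps)
  qed
qed

lemma level_tail_rescaled:
  assumes k: "monotone_kernel \<eta>" and e: "0 < \<epsilon>"
  shows "level_tail (rescaled_kernel \<eta> \<epsilon>) b = level_tail \<eta> (b / \<epsilon>)"
proof -
  let ?k = "rescaled_kernel \<eta> \<epsilon>"
  let ?G = "\<lambda>s. indicator {0<..<?k 0} s *\<^sub>R (if b \<le> level ?k s then level ?k s else 0)"
  have "level_tail ?k b = \<bar>1/\<epsilon>\<bar> *\<^sub>R (LBINT s. ?G (0 + (1/\<epsilon>) * s))"
    unfolding level_tail_def set_lebesgue_integral_def
    using e by (intro lborel_integral_real_affine) auto
  also have "(LBINT s. ?G (0 + (1/\<epsilon>) * s)) = 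
     (LBINT s. \<epsilon> * (indicator {0<..<\<eta> 0} s *\<^sub>R (if b / \<epsilon> \<le> level \<eta> s then level \<eta> s else 0)))"
  proof (rule Bochner_Integration.integral_cong)
    fix s
    show "?G (0 + (1/\<epsilon>) * s) = \<epsilon> * (indicator {0<..<\<eta> 0} s *\<^sub>R (if b / \<epsilon> \<le> level \<eta> s then level \<eta> s else 0))"
    proof (cases "0 < s \<and> s < \<eta> 0")
      case True
      then have "0 < s / \<epsilon>" "s / \<epsilon> < ?k 0" using e by (auto simp: rescaled_kernel_def divide_strict_right_mono)
      then show ?thesis using True level_rescaled[OF k e, of s] e
        by (auto simp: field_simps)
    next
      case False
      then have "\<not> (0 < s / \<epsilon> \<and> s / \<epsilon> < ?k 0)" using e 
        by (auto simp: rescaled_kernel_def zero_less_divide_iff divide_less_cancel)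
      then show ?thesis using False by (auto simp: indicator_def)
    qed
  qed simp
  finally show ?thesis using e by (simp add: level_tail_def set_lebesgue_integral_def)
qed

text \<open>The limit of small $\varepsilon$ enters the proof only here: rescaling shrinks all lengths of levels, and the tail beyond a fixed distance vanishes.\<close>

lemma level_tail_small:
  assumes k: "monotone_kernel \<eta>" and b: "0 < b" and \<kappa>: "0 < \<kappa>"
  shows "\<exists>\<epsilon>>0. level_tail (rescaled_kernel \<eta> \<epsilon>) b < \<kappa>"
proof -
  have "(\<lambda>n. LBINT s. indicat_real {0<..<\<eta> 0} s *\<^sub>R (if b * real (Suc n) \<le> level \<eta> s then level \<eta> s else 0))
     \<longlonglongrightarrow> (LBINT s::real. (0::real))"
  proof (rule integral_dominated_convergence[where w="\<lambda>s. indicator {0<..<\<eta> 0} s *\<^sub>R level \<eta> s"])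
    show "(\<lambda>s. indicator {0<..<\<eta> 0} s *\<^sub>R (if b * real (Suc n) \<le> level \<eta> s then level \<eta> s else 0)) \<in> borel_measurable lborel" for n
      using level_tail_integrable[OF k, of "b * real (Suc n)"] unfolding set_integrable_def by auto
    show "integrable lborel (\<lambda>s. indicator {0<..<\<eta> 0} s *\<^sub>R level \<eta> s)"
      using level_integral(1)[OF k] by (simp add: set_integrable_def)
    show "AE s in lborel. norm (indicator {0<..<\<eta> 0} s *\<^sub>R (if b * real (Suc n) \<le> level \<eta> s then level \<eta> s else 0))
      \<le> indicator {0<..<\<eta> 0} s *\<^sub>R level \<eta> s" for n
      using level_nonneg[OF k] by (auto simp: indicator_def)
    show "AE s in lborel. (\<lambda>n. indicator {0<..<\<eta> 0} s *\<^sub>R (if b * real (Suc n) \<le> level \<eta> s then level \<eta> s else 0)) \<longlonglongrightarrow> 0"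
    proof (rule AE_I2)
      fix s
      obtain m :: nat where m: "level \<eta> s / b < real m" using reals_Archimedean2 by blast
      have "\<forall>\<^sub>F n in sequentially. indicator {0<..<\<eta> 0} s *\<^sub>R (if b * real (Suc n) \<le> level \<eta> s then level \<eta> s else 0) = 0"
        using eventually_ge_at_top[of m]
      proof eventually_elim
        case (elim n)
        then have "level \<eta> s / b < real (Suc n)" using m by simp
        then have "level \<eta> s < b * real (Suc n)" using b by (simp add: field_simps)
        then show ?case by auto
      qed
      then show "(\<lambda>n. indicator {0<..<\<eta> 0} s *\<^sub>R (if b * real (Suc n) \<le> level \<eta> s then level \<eta> s else 0)) \<longlonglongrightarrow> 0"
        by (rule tendsto_eventually)
    qed
  qed simp
  then have "\<forall>\<^sub>F n in sequentially. (LBINT s. indicator {0<..<\<eta> 0} s *\<^sub>R (if b * real (Suc n) \<le> level \<eta> s then level \<eta> s else 0)) < \<kappa>"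
    using \<kappa> by (auto dest: order_tendstoD)
  then obtain n where "(LBINT s. indicator {0<..<\<eta> 0} s *\<^sub>R (if b * real (Suc n) \<le> level \<eta> s then level \<eta> s else 0)) < \<kappa>"
    by (auto simp: eventually_sequentially)
  then have "level_tail \<eta> (b / (1 / real (Suc n))) < \<kappa>"
    by (simp add: level_tail_def set_lebesgue_integral_def)
  then have "level_tail (rescaled_kernel \<eta> (1 / real (Suc n))) b < \<kappa>"
    using level_tail_rescaled[OF k, of "1 / real (Suc n)" b] by simp
  then show ?thesis by (intro exI[of _ "1 / real (Suc n)"]) auto
qed

text \<open>The derivative may fail to exist, or to be nonnegative, on a null set $N$. Add a small slope to $f$. If the function still decreased
  from $a$ to $b$, then a level $c$ in between could be chosen outside the image of $N$, which is a null set. At the last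
  point where the level $c$ is attained the derivative is positive, a contradiction.\<close>

lemma lipschitz_monotone:
  fixes f :: "real \<Rightarrow> real"
  assumes L: "L-lipschitz_on {..0} f"
    and AE: "AE x in lborel. x \<le> 0 \<longrightarrow> (\<exists>d\<ge>0. (f has_real_derivative d) (at x))"
  shows "mono_on {..0} f"
proof (rule mono_onI)
  fix a b :: real assume ab: "a \<in> {..0}" "b \<in> {..0}" "a \<le> b"
  obtain N where N: "\<And>x. x \<notin> N \<Longrightarrow> x \<le> 0 \<longrightarrow> (\<exists>d\<ge>0. (f has_real_derivative d) (at x))" "N \<in> null_sets lborel"
    using AE_E3[OF AE] by auto
  then have neg: "negligible (N \<inter> {..0})"
    by (meson inf_le1 negligible_iff_null_sets negligible_subset null_sets_completionI)
  have f_lip: "\<bar>f x - f y\<bar> \<le> L * \<bar>x - y\<bar>" if "x \<le> 0" "y \<le> 0" for x y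
    using lipschitz_onD[OF L, of x y] that by (auto simp: dist_real_def)
  have "f a \<le> f b + e" if e: "e > 0" for e
  proof (rule ccontr)
    assume "\<not> f a \<le> f b + e"
    then have lt: "f b + e < f a" by simp
    \<comment> \<open>The slope is so small that adding it keeps \<open>f\<close> decreasing from \<open>a\<close> to \<open>b\<close>.\<close>
    define d where "d = e / (b - a + 1)"
    have d: "d > 0" and "d * (b - a) < e" using e ab by (auto simp: d_def field_simps)
    define g where "g x = f x + d * x" for x
    have gab: "g b < g a" using lt \<open>d * (b - a) < e\<close> by (auto simp: g_def algebra_simps)
    have contg: "continuous_on {a..b} g"
      unfolding g_def using ab
      by (intro continuous_intros continuous_on_subset[OF lipschitz_on_continuous_on[OF L]]) auto
    have "negligible (g ` (N \<inter> {..0}))"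
    proof (rule negligible_locally_Lipschitz_image[OF _ neg])
      fix x assume x: "x \<in> N \<inter> {..0}"
      show "\<exists>T B. open T \<and> x \<in> T \<and> (\<forall>y\<in>N \<inter> {..0} \<inter> T. norm (g y - g x) \<le> B * norm (y - x))"
      proof (intro exI[of _ UNIV] exI[of _ "L + d"] conjI ballI)
        fix y assume y: "y \<in> N \<inter> {..0} \<inter> UNIV"
        have "\<bar>g y - g x\<bar> \<le> \<bar>f y - f x\<bar> + d * \<bar>y - x\<bar>"
        proof -
          have "g y - g x = (f y - f x) + d * (y - x)" by (simp add: g_def algebra_simps)
          moreover have "\<bar>d * (y - x)\<bar> = d * \<bar>y - x\<bar>" using d by (simp add: abs_mult)
          ultimately show ?thesis by linarith
        qed
        also have "\<dots> \<le> (L + d) * \<bar>y - x\<bar>"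
          using f_lip[of y x] x y by (auto simp: algebra_simps)
        finally show "norm (g y - g x) \<le> (L + d) * norm (y - x)" by simp
      qed auto
    qed simp
    then have "\<not> {g b<..<g a} \<subseteq> g ` (N \<inter> {..0})"
      using gab negligible_subset open_not_negligible[of "{g b<..<g a}"] by auto
    then have "\<exists>c\<in>{g b<..<g a}. c \<notin> g ` (N \<inter> {..0})" by blast
    then obtain c where c: "g b < c" "c < g a" "c \<notin> g ` (N \<inter> {..0})" by (auto simp only: greaterThanLessThan_iff)
    define S where "S = {x \<in> {a..b}. c \<le> g x}"
    have "closed S" unfolding S_def 
      using continuous_closed_preimage[OF contg closed_atLeastAtMost, of "{c..}"]
      by (simp add: vimage_def Int_def conj_commute)
    moreover have "bounded S" unfolding S_def by (rule bounded_subset[of "{a..b}"]) auto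
    ultimately have "compact S" by (simp add: compact_eq_bounded_closed)
    moreover have "a \<in> S" using c ab by (auto simp: S_def)
    ultimately obtain s where s: "s \<in> S" "\<And>x. x \<in> S \<Longrightarrow> x \<le> s"
      using compact_attains_sup[of S] by blast
    have sb: "a \<le> s" "s < b" "c \<le> g s" using s c unfolding S_def by (auto simp: less_le)
    have gt: "g x < c" if "s < x" "x \<le> b" for x
      using s(2)[of x] that sb unfolding S_def by force
    have "g s = c"
    proof (rule ccontr)
      assume "g s \<noteq> c"
      then have "g b \<le> c" "c \<le> g s" "s \<le> b" "continuous_on {s..b} g" using sb c
        by (auto intro: continuous_on_subset[OF contg])
      then obtain x where "s \<le> x" "x \<le> b" "g x = c" using IVT2'[of g b c s] by auto
      then show False using gt[of x] \<open>g s \<noteq> c\<close> by (cases "x = s") auto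
    qed
    then have "s \<notin> N" using c sb ab by auto
    then obtain D where "D \<ge> 0" "(f has_real_derivative D) (at s)" using N(1)[of s] sb ab by auto
    then have "(g has_real_derivative (D + d)) (at s)"
      unfolding g_def by (auto intro!: derivative_eq_intros)
    then obtain r where r: "r > 0" "\<And>h. 0 < h \<Longrightarrow> h < r \<Longrightarrow> g s < g (s + h)"
      using DERIV_pos_inc_right[of g "D + d" s] \<open>D \<ge> 0\<close> d by auto
    define h where "h = min (r/2) (b - s)"
    have "0 < h" "h < r" "s + h \<le> b" using r sb by (auto simp: h_def)
    then show False using r(2)[of h] gt[of "s + h"] \<open>g s = c\<close> by auto
  qed
  then show "f a \<le> f b" by (rule field_le_epsilon)
qed

lemma admissible_kernel_monotone:
  assumes \<eta>: "\<eta> = indicat_real {-1..0} \<or>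
      ((\<forall>x. 0 \<le> \<eta> x) \<and> (\<forall>x>0. \<eta> x = 0) \<and>
       integrable lborel \<eta> \<and> (LBINT x. \<eta> x) = 1 \<and>
       (\<exists>L. L-lipschitz_on {..0} \<eta>) \<and>
       (AE x in lborel. x \<le> 0 \<longrightarrow> (\<exists>d\<ge>0. (\<eta> has_real_derivative d) (at x))))"
  shows "monotone_kernel \<eta>"
  using \<eta>
proof
  assume \<eta>: "\<eta> = indicat_real {-1..0}"
  have "mono_on {..0} \<eta>" unfolding \<eta> by (auto simp: indicator_def mono_on_def)
  moreover have "integrable lborel \<eta>" "(LBINT x. \<eta> x) = 1" unfolding \<eta> by auto
  ultimately show ?thesis unfolding monotone_kernel_def
    using \<eta> by auto
qed (auto simp: monotone_kernel_def intro: lipschitz_monotone)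

section \<open>Densities and changes of variable on the line\<close>

lemma borel_measure_eqI_Ioc:
  fixes M N :: "real measure"
  assumes M: "sets M = sets borel" and N: "sets N = sets borel"
    and eq: "\<And>a b. a \<le> b \<Longrightarrow> emeasure M {a<..b} = emeasure N {a<..b}"
    and fin: "\<And>a b. a \<le> b \<Longrightarrow> emeasure M {a<..b} < \<infinity>"
  shows "M = N"
proof (rule measure_eqI_generator_eq[where E="range (\<lambda>(a, b). {a <.. b::real})" and \<Omega>=UNIV
      and A="\<lambda>n. {- real n <.. real n}"])
  show "Int_stable (range (\<lambda>(a, b). {a <.. b::real}))"
  proof (rule Int_stableI, clarify)
    fix a b c d :: real
    have "{a<..b} \<inter> {c<..d} = (\<lambda>(a, b). {a<..b}) (max a c, min b d)" by auto
    then show "{a<..b} \<inter> {c<..d} \<in> range (\<lambda>(a, b). {a <.. b::real})" by blast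
  qed
  have *: "sets borel = sigma_sets UNIV (range (\<lambda>(a, b). {a <.. b::real}))"
    by (subst borel_sigma_sets_Ioc) simp
  show "sets M = sigma_sets UNIV (range (\<lambda>(a, b). {a <.. b::real}))" 
    "sets N = sigma_sets UNIV (range (\<lambda>(a, b). {a <.. b::real}))"
    using M N * by auto
  show "emeasure M X = emeasure N X" if X: "X \<in> range (\<lambda>(a, b). {a <.. b::real})" for X
  proof -
    obtain a b where X: "X = {a<..b}" using X by auto
    show ?thesis by (cases "a \<le> b") (auto simp: X eq)
  qed
  show "(\<Union>n. {- real n <.. real n}) = UNIV"
  proof (intro equalityI subsetI, simp)
    fix x :: real
    obtain n :: nat where "\<bar>x\<bar> < real n" using reals_Archimedean2 by blast
    then show "x \<in> (\<Union>n. {- real n <.. real n})" by (intro UN_I[of n]) auto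
  qed
  show "emeasure M {- real n <.. real n} \<noteq> \<infinity>" for n using fin[of "- real n" "real n"] by auto
qed auto

text \<open>As $x - F(x)$ is monotone as well, it defines a second measure, and the sum of both is the Lebesgue measure.\<close>

lemma measure_dominated_by_lborel:
  assumes sets: "sets \<nu> = sets borel" and F: "potential F"
    and nu: "\<And>a b. a \<le> b \<Longrightarrow> emeasure \<nu> {a<..b} = ennreal (F b - F a)"
    and A: "A \<in> sets borel"
  shows "emeasure \<nu> A \<le> emeasure lborel A"
proof -
  define \<mu> where "\<mu> = interval_measure (\<lambda>x. x - F x)"
  define S where "S = measure_of UNIV (sets borel) (\<lambda>A. emeasure \<nu> A + emeasure \<mu> A)"
  have \<mu>: "emeasure \<mu> {a<..b} = ennreal ((b - F b) - (a - F a))" if "a \<le> b" for a b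
    unfolding \<mu>_def
  proof (rule emeasure_interval_measure_Ioc[OF that])
    show "x - F x \<le> y - F y" if "x \<le> y" for x y
      using potential_lip[OF F that] by simp
    show "continuous (at_right a) (\<lambda>x. x - F x)" for a
      using potential_continuous[OF F, of UNIV]
      by (intro continuous_intros) (auto simp: continuous_on_eq_continuous_within intro: continuous_within_subset)
  qed
  have setsS: "sets S = sets borel" unfolding S_def 
    by (metis sets.sets_measure_of_eq space_borel)
  have S: "emeasure S A = emeasure \<nu> A + emeasure \<mu> A" if "A \<in> sets borel" for A
    unfolding S_def
  proof (rule emeasure_measure_of_sigma)
    show "sigma_algebra UNIV (sets (borel::real measure))"
      using sets.sigma_algebra_axioms[of borel] by simp
    show "positive (sets borel) (\<lambda>A. emeasure \<nu> A + emeasure \<mu> A)" by (simp add: positive_def)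
    show "countably_additive (sets borel) (\<lambda>A. emeasure \<nu> A + emeasure \<mu> A)"
    proof (rule countably_additiveI)
      fix A :: "nat \<Rightarrow> real set" assume A: "range A \<subseteq> sets borel" "disjoint_family A" 
      have "(\<Sum>i. emeasure \<nu> (A i) + emeasure \<mu> (A i)) = (\<Sum>i. emeasure \<nu> (A i)) + (\<Sum>i. emeasure \<mu> (A i))"
        by (rule suminf_add[symmetric]) auto
      also have "\<dots> = emeasure \<nu> (\<Union>i. A i) + emeasure \<mu> (\<Union>i. A i)"
        using A sets by (subst (1 2) suminf_emeasure) (auto simp: \<mu>_def)
      finally show "(\<Sum>i. emeasure \<nu> (A i) + emeasure \<mu> (A i)) = emeasure \<nu> (\<Union>i. A i) + emeasure \<mu> (\<Union>i. A i)" .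
    qed
  qed fact
  have "lborel = S"
  proof (rule borel_measure_eqI_Ioc)
    fix a b :: real assume ab: "a \<le> b"
    have "emeasure S {a<..b} = ennreal ((F b - F a) + ((b - F b) - (a - F a)))"
      using potential_mono[OF F ab] potential_lip[OF F ab]
      by (subst S, simp, subst nu[OF ab], subst \<mu>[OF ab], subst ennreal_plus) auto
    then show "emeasure lborel {a<..b} = emeasure S {a<..b}" using ab by simp
  qed (auto simp: setsS)
  then show ?thesis using S[OF A] by simp
qed

lemma density_of_potential:
  assumes sets: "sets \<nu> = sets borel" and F: "potential F"
    and nu: "\<And>a b. a \<le> b \<Longrightarrow> emeasure \<nu> {a<..b} = ennreal (F b - F a)"
  obtains f where "density_fn f" "density lborel (\<lambda>x. ennreal (f x)) = \<nu>"
    "\<And>a b. a \<le> b \<Longrightarrow> primitive f b - primitive f a = F b - F a"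
proof -
  have dom: "emeasure \<nu> A \<le> emeasure lborel A" if "A \<in> sets borel" for A
    by (rule measure_dominated_by_lborel[OF sets F nu that])
  have "absolutely_continuous lborel \<nu>"
    unfolding absolutely_continuous_def null_sets_def
    using dom sets by (auto intro: order_trans simp: le_zero_eq[symmetric] simp del: le_zero_eq)
  then obtain g where g[measurable]: "g \<in> borel_measurable lborel" and dg: "density lborel g = \<nu>"
    using sigma_finite_measure.Radon_Nikodym[OF sigma_finite_lborel, of \<nu>] sets by auto
  have "AE x in lborel. x \<in> {- real n..real n} \<longrightarrow> g x \<le> 1" for n
  proof -
    define A where "A = {x \<in> {- real n..real n}. 1 < g x}"
    have A[measurable]: "A \<in> sets borel" unfolding A_def using g by measurable
    have finA: "emeasure lborel A < \<infinity>"
    proof -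
      have "emeasure lborel A \<le> emeasure lborel {- real n..real n}"
        by (rule emeasure_mono) (auto simp: A_def)
      also have "\<dots> < \<infinity>" by (simp add: emeasure_lborel_Icc_eq)
      finally show ?thesis .
    qed
    have "emeasure lborel A + (\<integral>\<^sup>+x. (g x - 1) * indicator A x \<partial>lborel) = 
      (\<integral>\<^sup>+x. indicator A x \<partial>lborel) + (\<integral>\<^sup>+x. (g x - 1) * indicator A x \<partial>lborel)" by simp
    also have "\<dots> = (\<integral>\<^sup>+x. indicator A x + (g x - 1) * indicator A x \<partial>lborel)"
      by (rule nn_integral_add[symmetric]) auto
    also have "\<dots> = (\<integral>\<^sup>+x. g x * indicator A x \<partial>lborel)"
      by (rule nn_integral_cong) (auto simp: indicator_def A_def intro!: add_diff_inverse_ennreal less_imp_le)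
    also have "\<dots> = emeasure \<nu> A" unfolding dg[symmetric] by (subst emeasure_density) auto
    also have "\<dots> \<le> emeasure lborel A" by (rule dom[OF A])
    finally have "emeasure lborel A + (\<integral>\<^sup>+x. (g x - 1) * indicator A x \<partial>lborel) \<le> emeasure lborel A + 0" by simp
    then have "(\<integral>\<^sup>+x. (g x - 1) * indicator A x \<partial>lborel) = 0"
      using finA by (subst (asm) ennreal_add_left_cancel_le) auto
    then have "AE x in lborel. (g x - 1) * indicator A x = 0"
      by (subst (asm) nn_integral_0_iff_AE) auto
    then show ?thesis
    proof eventually_elim
      case (elim x)
      show ?case
      proof (rule impI, rule ccontr)
        assume "x \<in> {- real n..real n}" "\<not> g x \<le> 1"
        then have "x \<in> A" "1 < g x" by (auto simp: A_def)
        then have "g x - 1 = 0" using elim by simp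
        then show False using \<open>1 < g x\<close> by (metis diff_gt_0_iff_gt_ennreal less_irrefl)
      qed
    qed
  qed
  then have "AE x in lborel. \<forall>n. x \<in> {- real n..real n} \<longrightarrow> g x \<le> 1"
    by (subst AE_all_countable) auto
  then have g1: "AE x in lborel. g x \<le> 1"
  proof eventually_elim
    case (elim x)
    obtain n :: nat where "\<bar>x\<bar> < real n" using reals_Archimedean2 by blast
    then have "x \<in> {- real n..real n}" by auto
    then show ?case using elim by blast
  qed
  define f where "f x = enn2real (min 1 (g x))" for x
  have m: "min 1 (g x) < top" for x using le_less_trans[OF min.cobounded1[of 1 "g x"]] by simp
  have f: "density_fn f"
    unfolding density_fn_def f_def using g
    by (auto intro!: enn2real_leI)
  have "density lborel (\<lambda>x. ennreal (f x)) = density lborel g"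
    by (rule density_cong) (use g1 f in \<open>auto simp: f_def min_def m[unfolded min_def] elim!: eventually_mono\<close>)
  then have df: "density lborel (\<lambda>x. ennreal (f x)) = \<nu>" using dg by simp
  show ?thesis
  proof (rule that[OF f df])
    fix a b :: real assume ab: "a \<le> b"
    have [measurable]: "f \<in> borel_measurable borel" using f by simp
    have "ennreal (primitive f b - primitive f a) = (\<integral>\<^sup>+z. ennreal (f z) * indicator {a..b} z \<partial>lborel)"
      by (rule primitive_diff_nn[OF f ab, symmetric])
    also have "\<dots> = (\<integral>\<^sup>+z. ennreal (f z) * indicator {a<..b} z \<partial>lborel)"
      by (rule nn_integral_cong_AE, rule AE_mp[OF AE_lborel_singleton[of a]], rule AE_I2) (auto simp: indicator_def)
    also have "\<dots> = emeasure \<nu> {a<..b}" unfolding df[symmetric] by (subst emeasure_density) auto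
    also have "\<dots> = ennreal (F b - F a)" by (rule nu[OF ab])
    finally show "primitive f b - primitive f a = F b - F a"
      using potential_mono[OF F ab] potential_mono[OF primitive_potential[OF f] ab] by simp
  qed
qed

text \<open>Lebesgue differentiation along a fixed sequence of increments. The existence proof uses it to define the solution by difference quotients of a
  continuous potential, which makes it Borel in time and space together.\<close>

lemma difference_quotient_AE:
  assumes f: "density_fn f"
  shows "AE x in lborel. (\<lambda>n. 2 ^ n * (primitive f (x + 1 / 2 ^ n) - primitive f x)) \<longlonglongrightarrow> f x"
proof -
  have i: "set_integrable lborel {x..y} f" for x y 
    by (rule density_fn_integrable[OF f]) (auto simp: emeasure_lborel_Icc_eq)
  have e: "integral {x..y} f = primitive f y - primitive f x" if "x \<le> y" for x y
    using set_borel_integral_eq_integral(2)[OF i] primitive_diff[OF f that] by simp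
  have io: "f integrable_on cbox x y" for x y
    using set_borel_integral_eq_integral(1)[OF i] by simp
  obtain N where N: "negligible N" and lim:
      "\<And>x e. \<lbrakk>x \<notin> N; 0 < e\<rbrakk> \<Longrightarrow> \<exists>d>0. \<forall>h. 0 < h \<and> h < d \<longrightarrow>
         norm(integral (cbox x (x + h *\<^sub>R One)) f /\<^sub>R h ^ DIM(real) - f x) < e"
    using integrable_ccontinuous_explicit[OF io] by blast
  have "(\<lambda>n. 2 ^ n * (primitive f (x + 1 / 2 ^ n) - primitive f x)) \<longlonglongrightarrow> f x" if x: "x \<notin> N" for x
  proof (rule LIMSEQ_I)
    fix r :: real assume "r > 0"
    then obtain d where d: "d > 0" "\<And>h. 0 < h \<Longrightarrow> h < d \<Longrightarrow> norm(integral (cbox x (x + h *\<^sub>R One)) f /\<^sub>R h ^ DIM(real) - f x) < r"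
      using lim[OF x] by blast
    obtain n0 where n0: "(1/2::real) ^ n0 < d" using real_arch_pow_inv[of d "1/2"] d by auto
    show "\<exists>no. \<forall>n\<ge>no. norm (2 ^ n * (primitive f (x + 1 / 2 ^ n) - primitive f x) - f x) < r"
    proof (intro exI allI impI)
      fix n assume "n0 \<le> n"
      then have "(1/2::real)^n \<le> (1/2)^n0" by (intro power_decreasing) auto
      then have h: "1/2^n < d" using n0 by (simp add: power_divide)
      show "norm (2 ^ n * (primitive f (x + 1 / 2 ^ n) - primitive f x) - f x) < r"
        using d(2)[of "1/2^n"] h by (simp add: e field_simps)
    qed
  qed
  then have "AE x in lebesgue. (\<lambda>n. 2 ^ n * (primitive f (x + 1 / 2 ^ n) - primitive f x)) \<longlonglongrightarrow> f x"
    using N by (intro AE_I'[of N]) (auto simp: negligible_iff_null_sets)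
  then show ?thesis by (simp add: AE_completion_iff)
qed

text \<open>A change of variables for a homeomorphism that need not be differentiable: an inverse with Lipschitz constant \<open>C\<close> suffices for the inequality.\<close>

lemma nn_integral_expanding:
  fixes Z Y :: "real \<Rightarrow> real"
  assumes inv: "\<And>x. Z (Y x) = x" "\<And>y. Y (Z y) = y"
    and mono: "\<And>a b. a < b \<Longrightarrow> Y a < Y b"
    and C: "0 < C" "\<And>a b. a \<le> b \<Longrightarrow> Y b - Y a \<le> C * (b - a)"
    and Z[measurable]: "Z \<in> borel_measurable borel"
    and g[measurable]: "g \<in> borel_measurable borel"
  shows "(\<integral>\<^sup>+y. g (Z y) \<partial>lborel) \<le> ennreal C * (\<integral>\<^sup>+x. g x \<partial>lborel)"
proof -
  have mono': "a < b \<longleftrightarrow> Y a < Y b" for a b using mono[of a b] mono[of b a] by (metis less_asym neq_iff)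
  define \<nu> where "\<nu> = scale_measure (ennreal (1 / C)) (distr lborel borel Z)"
  have F: "potential (\<lambda>x. Y x / C)"
    unfolding potential_def using C mono by (auto simp: field_simps le_less)
  have "emeasure \<nu> A \<le> emeasure lborel A" if "A \<in> sets borel" for A
  proof (rule measure_dominated_by_lborel[OF _ F _ that])
    show "sets \<nu> = sets borel" by (simp add: \<nu>_def)
    fix a b :: real assume ab: "a \<le> b"
    have "Z -` {a<..b} = {Y a<..Y b}"
      using inv mono' by (auto simp: not_less[symmetric]) (metis inv(1) inv(2) mono')+
    then have "emeasure \<nu> {a<..b} = ennreal (1/C) * ennreal (Y b - Y a)"
      using ab mono[of a b] by (cases "a = b") (auto simp: \<nu>_def emeasure_distr)
    also have "\<dots> = ennreal (Y b / C - Y a / C)"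
      using C ab mono[of a b] by (cases "a = b") (auto simp: ennreal_mult[symmetric] diff_divide_distrib)
    finally show "emeasure \<nu> {a<..b} = ennreal (Y b / C - Y a / C)" .
  qed
  then have "\<nu> \<le> lborel" by (subst le_measure) (auto simp: \<nu>_def)
  then have "nn_integral \<nu> g \<le> nn_integral lborel g"
    by (intro nn_integral_mono_measure) (auto simp: \<nu>_def)
  moreover have "nn_integral \<nu> g = ennreal (1/C) * (\<integral>\<^sup>+y. g (Z y) \<partial>lborel)"
    unfolding \<nu>_def by (subst nn_integral_scale_measure) (auto simp: nn_integral_distr)
  ultimately have "ennreal C * (ennreal (1/C) * (\<integral>\<^sup>+y. g (Z y) \<partial>lborel)) \<le> ennreal C * (\<integral>\<^sup>+x. g x \<partial>lborel)"
    by (intro mult_left_mono) auto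
  then show ?thesis using C by (simp add: mult.assoc[symmetric] ennreal_mult[symmetric])
qed

section \<open>Weighted Picard iteration\<close>

text \<open>The Banach fixed point theorem in a weighted supremum norm, for functions restricted to \<open>D\<close>. An exponential weight in time turns
  a Volterra operator into a contraction on the whole half-line, so that no solutions on short time intervals have to be glued. The
  set \<open>C\<close> carries the invariants of the iteration.\<close>

lemma picard_fixed_point:
  fixes \<Gamma> :: "('p \<Rightarrow> real) \<Rightarrow> ('p \<Rightarrow> real)"
  assumes start: "X0 \<in> C" and inv: "\<And>X. X \<in> C \<Longrightarrow> \<Gamma> X \<in> C"
    and init: "\<And>p. p \<in> D \<Longrightarrow> \<bar>\<Gamma> X0 p - X0 p\<bar> \<le> c0 * \<omega> p"
    and contr: "\<And>X Y c. X \<in> C \<Longrightarrow> Y \<in> C \<Longrightarrow> (\<And>p. p \<in> D \<Longrightarrow> \<bar>X p - Y p\<bar> \<le> c * \<omega> p) \<Longrightarrow> 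
       (\<And>p. p \<in> D \<Longrightarrow> \<bar>\<Gamma> X p - \<Gamma> Y p\<bar> \<le> (c/2) * \<omega> p)"
    and closed: "\<And>S X c. (\<And>n::nat. S n \<in> C) \<Longrightarrow> (\<And>n p. p \<in> D \<Longrightarrow> \<bar>S n p - X p\<bar> \<le> c * (1/2)^n * \<omega> p) \<Longrightarrow> X \<in> C"
  shows "\<exists>X\<in>C. \<forall>p\<in>D. \<Gamma> X p = X p"
proof -
  define S where "S n = (\<Gamma> ^^ n) X0" for n
  have S: "S n \<in> C" for n by (induction n) (auto simp: S_def start inv)
  have step: "\<bar>S (Suc n) p - S n p\<bar> \<le> (c0 * (1/2)^n) * \<omega> p" if "p \<in> D" for n p
    using that
  proof (induction n arbitrary: p)
    case 0 then show ?case using init by (simp add: S_def)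
  next
    case (Suc n)
    have "\<bar>\<Gamma> (S (Suc n)) p - \<Gamma> (S n) p\<bar> \<le> (c0 * (1/2)^n) / 2 * \<omega> p"
      by (rule contr[OF S S Suc.IH Suc.prems])
    then show ?case by (simp add: S_def)
  qed
  define X where "X p = lim (\<lambda>n. S n p)" for p
  have close: "\<bar>S n p - X p\<bar> \<le> (2 * c0) * (1/2)^n * \<omega> p" if p: "p \<in> D" for n p
  proof -
    have nn: "0 \<le> c0 * \<omega> p" using step[OF p, of 0] abs_ge_zero order_trans by force
    have far: "\<bar>S (n + k) p - S n p\<bar> \<le> (c0 * \<omega> p) * (2 * (1/2)^n - 2 * (1/2)^(n + k))" for n k
    proof (induction k)
      case (Suc k)
      have "\<bar>S (n + Suc k) p - S n p\<bar> \<le> \<bar>S (Suc (n + k)) p - S (n + k) p\<bar> + \<bar>S (n + k) p - S n p\<bar>" by simp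
      also have "\<dots> \<le> (c0 * (1/2)^(n + k)) * \<omega> p + (c0 * \<omega> p) * (2 * (1/2)^n - 2 * (1/2)^(n + k))"
        by (intro add_mono step[OF p] Suc)
      also have "\<dots> = (c0 * \<omega> p) * (2 * (1/2)^n - 2 * (1/2)^(n + Suc k))" by (simp add: algebra_simps)
      finally show ?case .
    qed simp
    have far': "\<bar>S m p - S n p\<bar> \<le> (2 * c0) * (1/2)^n * \<omega> p" if "n \<le> m" for n m
    proof -
      have "\<bar>S (n + (m - n)) p - S n p\<bar> \<le> (c0 * \<omega> p) * (2 * (1/2)^n - 2 * (1/2)^(n + (m - n)))" by (rule far)
      also have "\<dots> \<le> (c0 * \<omega> p) * (2 * (1/2)^n)" using nn by (intro mult_left_mono) auto
      finally show ?thesis using that by (simp add: algebra_simps)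
    qed
    have "(\<lambda>n. (2 * c0) * (1/2::real)^n * \<omega> p) \<longlonglongrightarrow> (2 * c0) * 0 * \<omega> p"
      by (intro tendsto_intros LIMSEQ_power_zero) auto
    then have z: "(\<lambda>n. (2 * c0) * (1/2::real)^n * \<omega> p) \<longlonglongrightarrow> 0" by simp
    have "Cauchy (\<lambda>n. S n p)"
    proof (rule CauchyI')
      fix e :: real assume "e > 0"
      then have "\<forall>\<^sub>F n in sequentially. (2 * c0) * (1/2::real)^n * \<omega> p < e"
        using order_tendstoD(2)[OF z] by auto
      then obtain M where "\<And>n. n \<ge> M \<Longrightarrow> (2 * c0) * (1/2::real)^n * \<omega> p < e" by (auto simp: eventually_sequentially)
      then show "\<exists>M. \<forall>m\<ge>M. \<forall>n>m. dist (S m p) (S n p) < e"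
        by (intro exI[of _ M]) (smt (verit) dist_real_def far' less_imp_le)
    qed
    then have lim: "(\<lambda>n. S n p) \<longlonglongrightarrow> X p"
      unfolding X_def by (simp add: Cauchy_convergent convergent_LIMSEQ_iff[symmetric])
    have "(\<lambda>m. \<bar>S n p - S m p\<bar>) \<longlonglongrightarrow> \<bar>S n p - X p\<bar>" by (intro tendsto_intros lim)
    moreover have "\<forall>m\<ge>n. \<bar>S n p - S m p\<bar> \<le> (2 * c0) * (1/2)^n * \<omega> p"
      using far' by (metis abs_minus_commute)
    ultimately show ?thesis
      by (rule LIMSEQ_le_const2[OF _ exI])
  qed
  have XC: "X \<in> C" by (rule closed[OF S close])
  have "\<Gamma> X p = X p" if p: "p \<in> D" for p
  proof -
    have "\<bar>\<Gamma> X p - X p\<bar> \<le> (2 * c0 * \<omega> p) * (1/2)^n" for n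
    proof -
      have "\<bar>\<Gamma> (S n) p - \<Gamma> X p\<bar> \<le> ((2 * c0) * (1/2)^n) / 2 * \<omega> p"
        by (rule contr[OF S XC close p])
      moreover have "\<Gamma> (S n) p = S (Suc n) p" by (simp add: S_def)
      moreover have "\<bar>S (Suc n) p - X p\<bar> \<le> (2 * c0) * (1/2)^Suc n * \<omega> p" by (rule close[OF p])
      ultimately show ?thesis by (simp add: algebra_simps)
    qed
    moreover have "(\<lambda>n. (2 * c0 * \<omega> p) * (1/2::real)^n) \<longlonglongrightarrow> (2 * c0 * \<omega> p) * 0"
      by (intro tendsto_intros LIMSEQ_power_zero) auto
    ultimately have "\<bar>\<Gamma> X p - X p\<bar> \<le> 0"
      by (intro LIMSEQ_le_const[of "\<lambda>n. (2 * c0 * \<omega> p) * (1/2::real)^n"]) auto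
    then show ?thesis by simp
  qed
  then show ?thesis using XC by blast
qed

lemma continuous_on_integral_upto:
  fixes h :: "real \<Rightarrow> 'a::topological_space \<Rightarrow> real"
  assumes h: "continuous_on ({0..} \<times> UNIV) (\<lambda>(s, a). h s a)"
  shows "continuous_on ({0..} \<times> UNIV) (\<lambda>(t, a). integral {0..t} (\<lambda>s. h s a))"
proof -
  have eq: "integral {0..t} (\<lambda>s. h s a) = integral (cbox 0 1) (\<lambda>\<sigma>. t * h (t * \<sigma>) a)" if "t \<ge> 0" for t a
  proof (cases "t = 0")
    case False
    then have t: "t > 0" using that by simp
    have "(\<lambda>x. x / t) ` {0..t} = {0..1}"
      using t by (auto simp: image_iff field_simps intro!: bexI[of _ "t * _"])
    then have "integral {0..1} (\<lambda>x. h (t * x) a) = (1 / \<bar>t\<bar>) *\<^sub>R integral {0..t} (\<lambda>s. h s a)"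
      using integral_stretch_real[of t 0 t "\<lambda>s. h s a"] t by simp
    then show ?thesis using t by (simp add: field_simps)
  qed simp
  have "continuous_on ({0..} \<times> UNIV) (\<lambda>p. integral (cbox 0 1) ((\<lambda>p \<sigma>. fst p * h (fst p * \<sigma>) (snd p)) p))"
  proof (rule integral_continuous_on_param)
    have "continuous_on (({0..} \<times> UNIV) \<times> cbox 0 1) (\<lambda>x. (\<lambda>(s, a). h s a) (fst (fst x) * snd x, snd (fst x)))"
      by (rule continuous_on_compose2[OF h]) (auto intro!: continuous_intros)
    then show "continuous_on (({0..} \<times> UNIV) \<times> cbox 0 1) (\<lambda>(p, \<sigma>). fst p * h (fst p * \<sigma>) (snd p))"
      unfolding case_prod_beta by (intro continuous_intros) auto
  qed
  then show ?thesis
    by (rule continuous_on_eq) (auto simp: eq)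
qed

lemma continuous_on_interval_integrable:
  fixes h :: "real \<Rightarrow> real"
  assumes "continuous_on {0..} h" "0 \<le> a"
  shows "h integrable_on {a..t}"
  by (rule integrable_continuous_interval, rule continuous_on_subset[OF assms(1)]) (use assms(2) in auto)

lemma integral_upto_has_derivative:
  fixes g :: "real \<Rightarrow> real"
  assumes g: "continuous_on {0..} g" and t: "0 \<le> t"
  shows "((\<lambda>s. integral {0..s} g) has_real_derivative g t) (at t within {0..})"
proof -
  have "((\<lambda>s. integral {0..s} g) has_real_derivative g t) (at t within {0..t+1})"
    by (rule integral_has_real_derivative) (use t continuous_on_subset[OF g] in auto)
  moreover have "at t within {0..} = at t within {0..t + 1}"
    using t by (intro at_within_nhd[of _ "{..<t+1}"]) auto
  ultimately show ?thesis by simp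
qed

lemma continuous_on_halfplane:
  fixes f :: "real \<Rightarrow> real \<Rightarrow> real"
  assumes lim: "\<And>\<tau> \<xi> t x. (\<And>n::nat. 0 \<le> \<tau> n) \<Longrightarrow> 0 \<le> t \<Longrightarrow> \<tau> \<longlonglongrightarrow> t \<Longrightarrow> \<xi> \<longlonglongrightarrow> x \<Longrightarrow>
    (\<lambda>n. f (\<tau> n) (\<xi> n)) \<longlonglongrightarrow> f t x"
  shows "continuous_on ({0..} \<times> UNIV) (\<lambda>(t, x). f t x)"
proof (rule continuous_on_sequentiallyI)
  fix p :: "nat \<Rightarrow> real \<times> real" and q
  assume p: "\<forall>n. p n \<in> {0..} \<times> UNIV" "p \<longlonglongrightarrow> q" and q: "q \<in> {0..} \<times> UNIV"
  have "(\<lambda>n. f (fst (p n)) (snd (p n))) \<longlonglongrightarrow> f (fst q) (snd q)"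
    using p(1) q by (intro lim tendsto_fst[OF p(2)] tendsto_snd[OF p(2)]) (auto simp: mem_Times_iff)
  then show "(\<lambda>n. (\<lambda>(t, x). f t x) (p n)) \<longlonglongrightarrow> (\<lambda>(t, x). f t x) q"
    by (simp add: case_prod_beta)
qed

lemma halfplane_tendsto:
  assumes f: "continuous_on ({0..} \<times> UNIV) (\<lambda>(t, x). f t x)"
    and "\<And>n::nat. 0 \<le> \<tau> n" "0 \<le> t" "\<tau> \<longlonglongrightarrow> t"
  shows "(\<lambda>n. f (\<tau> n) (x::real)) \<longlonglongrightarrow> f (t::real) x"
proof -
  have "(\<lambda>n. (\<lambda>(t, x). f t x) (\<tau> n, x)) \<longlonglongrightarrow> (\<lambda>(t, x). f t x) (t, x)"
    by (rule continuous_on_tendsto_compose[OF f]) (use assms in \<open>auto intro!: tendsto_intros\<close>)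
  then show ?thesis by simp
qed

lemma continuous_on_extend_halfplane:
  fixes f :: "real \<Rightarrow> real \<Rightarrow> real"
  assumes f: "continuous_on ({0..} \<times> UNIV) (\<lambda>(t, x). f t x)"
  shows "continuous_on UNIV (\<lambda>p. f (max 0 (fst p)) (snd p))"
proof -
  have "continuous_on UNIV (\<lambda>p. (\<lambda>(t, x). f t x) (max 0 (fst p), snd p))"
    by (rule continuous_on_compose2[OF f]) (auto intro!: continuous_intros)
  then show ?thesis by simp
qed

lemma exp_weight_integral:
  fixes c \<alpha> t :: real
  assumes "\<alpha> \<noteq> 0" "0 \<le> t"
  shows "((\<lambda>s. exp (\<alpha> * s) * c) has_integral (c / \<alpha>) * (exp (\<alpha> * t) - 1)) {0..t}"
proof -
  have "((\<lambda>s. exp (\<alpha> * s) * c) has_integral ((c / \<alpha>) * exp (\<alpha> * t) - (c / \<alpha>) * exp (\<alpha> * 0))) {0..t}"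
    by (rule fundamental_theorem_of_calculus)
      (use assms in \<open>auto intro!: derivative_eq_intros simp: has_real_derivative_iff_has_vector_derivative[symmetric]\<close>)
  then show ?thesis by (simp add: algebra_simps)
qed

lemma continuous_on_weighted_limit:
  fixes S :: "nat \<Rightarrow> 'p::topological_space \<Rightarrow> real"
  assumes S: "\<And>n. continuous_on D (S n)" and \<omega>: "continuous_on D \<omega>" "\<And>p. p \<in> D \<Longrightarrow> 0 < \<omega> p"
    and lim: "\<And>n p. p \<in> D \<Longrightarrow> \<bar>S n p - X p\<bar> \<le> c * (1/2)^n * \<omega> p"
  shows "continuous_on D X"
proof -
  have "(\<lambda>n. c * (1/2::real)^n) \<longlonglongrightarrow> c * 0" by (intro tendsto_intros LIMSEQ_power_zero) auto
  then have z: "(\<lambda>n. c * (1/2::real)^n) \<longlonglongrightarrow> 0" by simp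
  have "uniform_limit D (\<lambda>n p. S n p / \<omega> p) (\<lambda>p. X p / \<omega> p) sequentially"
  proof (rule uniform_limitI)
    fix e :: real assume "e > 0"
    then have "\<forall>\<^sub>F n in sequentially. c * (1/2)^n < e" using order_tendstoD(2)[OF z] by auto
    then show "\<forall>\<^sub>F n in sequentially. \<forall>p\<in>D. dist (S n p / \<omega> p) (X p / \<omega> p) < e"
    proof eventually_elim
      case (elim n)
      show ?case
      proof
        fix p assume p: "p \<in> D"
        have "\<bar>S n p - X p\<bar> / \<omega> p \<le> c * (1/2)^n"
          using lim[OF p, of n] \<omega>(2)[OF p] by (simp add: divide_le_eq)
        then show "dist (S n p / \<omega> p) (X p / \<omega> p) < e"
          using elim \<omega>(2)[OF p] by (simp add: dist_real_def flip: diff_divide_distrib)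
      qed
    qed
  qed
  then have "continuous_on D (\<lambda>p. X p / \<omega> p)"
    by (rule uniform_limit_theorem[rotated]) (use S \<omega> in \<open>auto intro!: continuous_intros always_eventually simp: less_imp_neq[symmetric]\<close>)
  then have "continuous_on D (\<lambda>p. X p / \<omega> p * \<omega> p)"
    by (rule continuous_on_mult) (rule \<omega>)
  then show ?thesis
    by (rule continuous_on_eq) (use \<omega>(2) in force)
qed

section \<open>The nonlocal flow\<close>

locale nonlocal_flow =
  fixes k u0 :: "real \<Rightarrow> real"
  assumes k: "monotone_kernel k" and u0: "density_fn u0"
begin

definition M0 :: "real \<Rightarrow> real" where "M0 = primitive u0"

lemma M0: "potential M0" unfolding M0_def by (rule primitive_potential[OF u0])

lemma K: "0 < k 0" by (rule monotone_kernel_pos[OF k])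

text \<open>\<open>X a\<close> is the present position of the car that started at \<open>a\<close>. The inequality says that the transported density is at most $1$. It also makes \<open>X\<close>
  monotone, and it is linear in \<open>X\<close>.\<close>

definition admissible :: "(real \<Rightarrow> real) \<Rightarrow> bool" where
  "admissible X \<longleftrightarrow> continuous_on UNIV X \<and> (\<forall>a b. a \<le> b \<longrightarrow> M0 b - M0 a \<le> X b - X a) \<and>
     (\<exists>C. \<forall>a. \<bar>X a - a\<bar> \<le> C)"

text \<open>The potential of the transported density. All choices of \<open>a\<close> give the same value (\<open>label_at\<close>), as cars at the same position
  have no mass between them.\<close>

definition label :: "(real \<Rightarrow> real) \<Rightarrow> real \<Rightarrow> real" where
  "label X x = M0 (SOME a. X a = x)"

lemma admissible_ineq: "admissible X \<Longrightarrow> a \<le> b \<Longrightarrow> M0 b - M0 a \<le> X b - X a"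
  by (auto simp: admissible_def)

lemma admissible_mono: "admissible X \<Longrightarrow> a \<le> b \<Longrightarrow> X a \<le> X b"
  using admissible_ineq[of X a b] potential_mono[OF M0, of a b] by auto

lemma admissible_surj:
  assumes "admissible X" obtains a where "X a = x"
proof -
  obtain C where C: "\<And>a. \<bar>X a - a\<bar> \<le> C" using assms by (auto simp: admissible_def)
  have "\<exists>a\<ge>x - C. a \<le> x + C \<and> X a = x"
  proof (rule IVT')
    show "X (x - C) \<le> x" using C[of "x - C"] by (auto simp: abs_le_iff)
    show "x \<le> X (x + C)" using C[of "x + C"] by (auto simp: abs_le_iff)
    show "x - C \<le> x + C" using C[of 0] by auto
    show "continuous_on {x - C..x + C} X" using assms by (auto simp: admissible_def intro: continuous_on_subset)
  qed
  then show thesis using that by blast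
qed

lemma label_at [simp]:
  assumes "admissible X" shows "label X (X a) = M0 a"
proof -
  have *: "M0 b \<le> M0 a" if "X a = X b" for a b
    using admissible_ineq[OF assms, of a b] potential_mono[OF M0, of b a] that by (cases "a \<le> b") auto
  have "X (SOME b. X b = X a) = X a" by (rule someI[of _ a]) simp
  then show ?thesis unfolding label_def using *[of a] *[of _ a] by (metis antisym)
qed

lemma label_potential:
  assumes "admissible X" shows "potential (label X)"
  unfolding potential_def
proof (intro allI impI)
  fix x y :: real assume xy: "x \<le> y"
  obtain a where a: "X a = x" using admissible_surj[OF assms] .
  obtain b where b: "X b = y" using admissible_surj[OF assms] .
  have ab: "a \<le> b \<or> x = y" using admissible_mono[OF assms, of b a] a b xy by (cases "a \<le> b") auto
  show "label X x \<le> label X y \<and> label X y - label X x \<le> y - x"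
  proof (cases "a \<le> b")
    case True
    have "label X x = M0 a" "label X y = M0 b" using a b label_at[OF assms] by auto
    then show ?thesis using admissible_ineq[OF assms True] potential_mono[OF M0 True] a b by auto
  qed (use ab in auto)
qed

text \<open>The potential depends on the flow with Lipschitz constant $1$ in the supremum norm, since labels travel with the cars. For the densities there is no such bound.\<close>

lemma label_stable:
  assumes X: "admissible X" and Y: "admissible Y" and d: "\<And>a. \<bar>X a - Y a\<bar> \<le> d"
  shows "\<bar>label X z - label Y z\<bar> \<le> d"
proof -
  obtain a where a: "X a = z" using admissible_surj[OF X] .
  have "label X z = label Y (Y a)" using label_at[OF X, of a] label_at[OF Y, of a] a by simp
  then show ?thesis using potential_abs[OF label_potential[OF Y], of "Y a" z] d[of a] a by auto
qed

text \<open>One explicit Euler step of length \<open>1 / k 0\<close> with the speed of the cars. The length is the inverse of the Lipschitz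
  constant in \<open>lookahead_one_sided\<close>, which is what \<open>push_ineq\<close> needs.\<close>

definition push :: "(real \<Rightarrow> real) \<Rightarrow> real \<Rightarrow> real" where
  "push X a = X a + (1 - lookahead k (label X) (X a)) / k 0"

lemma push_bounds:
  assumes "admissible X" shows "X a \<le> push X a" "push X a \<le> X a + 1 / k 0"
  using lookahead_nonneg[OF k label_potential[OF assms], of "X a"] lookahead_le_1[OF k label_potential[OF assms], of "X a"] K
  by (auto simp: push_def field_simps)

text \<open>The maximum principle: a step that starts from a density of at most $1$ leads to such a density again, for by
  \<open>lookahead_one_sided\<close> the cars behind gain at most the empty road between them and those ahead.\<close>

lemma push_ineq:
  assumes X: "admissible X" and ab: "a \<le> b"
  shows "M0 b - M0 a \<le> push X b - push X a"
proof -
  have le: "X a \<le> X b" by (rule admissible_mono[OF X ab])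
  have "lookahead k (label X) (X b) - lookahead k (label X) (X a) \<le> k 0 * ((X b - X a) - (M0 b - M0 a))"
    using lookahead_one_sided[OF k label_potential[OF X] le] X by simp
  then have "(lookahead k (label X) (X b) - lookahead k (label X) (X a)) / k 0 \<le> (X b - X a) - (M0 b - M0 a)"
    using K by (simp add: field_simps)
  moreover have "push X b - push X a = (X b - X a) - (lookahead k (label X) (X b) - lookahead k (label X) (X a)) / k 0"
    by (simp add: push_def diff_divide_distrib)
  ultimately show ?thesis by simp
qed

lemma push_stable:
  assumes X: "admissible X" and Y: "admissible Y" and d: "\<And>a. \<bar>X a - Y a\<bar> \<le> d"
  shows "\<bar>push X a - push Y a\<bar> \<le> 4 * d"
proof -
  have 1: "\<bar>lookahead k (label X) (X a) - lookahead k (label Y) (X a)\<bar> \<le> k 0 * (2 * d)"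
    by (rule lookahead_stable[OF k label_potential[OF X] label_potential[OF Y] label_stable[OF X Y d]])
  have 2: "\<bar>lookahead k (label Y) (X a) - lookahead k (label Y) (Y a)\<bar> \<le> k 0 * d"
    by (rule order_trans[OF lookahead_lipschitz[OF k label_potential[OF Y]]]) (use mult_left_mono[OF d[of a], of "k 0"] K in simp)
  define A B where "A = lookahead k (label X) (X a)" and "B = lookahead k (label Y) (Y a)"
  have "\<bar>B - A\<bar> \<le> k 0 * (3 * d)" using 1 2 unfolding A_def B_def by (simp add: algebra_simps abs_le_iff)
  then have "\<bar>B - A\<bar> / k 0 \<le> 3 * d" using K by (simp add: field_simps)
  then have "\<bar>(B - A) / k 0\<bar> \<le> 3 * d" using K by simp
  moreover have "push X a - push Y a = (X a - Y a) + (B - A) / k 0"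
    by (simp add: push_def A_def B_def diff_divide_distrib)
  ultimately show ?thesis using d[of a] by linarith
qed

text \<open>Flows as functions on pairs of a time and an initial position, to fit \<open>picard_fixed_point\<close>.\<close>

definition flows :: "(real \<times> real \<Rightarrow> real) set" where
  "flows = {Z. continuous_on ({0..} \<times> UNIV) Z \<and>
     (\<forall>t\<ge>0. \<forall>a b. a \<le> b \<longrightarrow> M0 b - M0 a \<le> Z (t, b) - Z (t, a)) \<and>
     (\<forall>t\<ge>0. \<forall>a. a \<le> Z (t, a) \<and> Z (t, a) \<le> a + t)}"

lemma flows_admissible:
  assumes Z: "Z \<in> flows" and t: "0 \<le> t" shows "admissible (\<lambda>a. Z (t, a))"
  unfolding admissible_def
proof (intro conjI)
  have "continuous_on ({0..} \<times> UNIV) Z" using Z by (simp add: flows_def)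
  then show "continuous_on UNIV (\<lambda>a. Z (t, a))"
    by (rule continuous_on_compose2) (use t in \<open>auto intro!: continuous_intros\<close>)
  show "\<exists>C. \<forall>a. \<bar>Z (t, a) - a\<bar> \<le> C" 
  proof (intro exI[of _ t] allI)
    fix a
    have "a \<le> Z (t, a)" "Z (t, a) \<le> a + t" using Z t by (auto simp: flows_def)
    then show "\<bar>Z (t, a) - a\<bar> \<le> t" by (simp add: abs_le_iff)
  qed
qed (use Z t in \<open>auto simp: flows_def\<close>)

lemma label_continuous:
  fixes X :: "real \<Rightarrow> real \<Rightarrow> real"
  assumes X: "continuous_on ({0..} \<times> UNIV) (\<lambda>(t, a). X t a)" "\<And>t. 0 \<le> t \<Longrightarrow> admissible (X t)"
  shows "continuous_on ({0..} \<times> UNIV) (\<lambda>(t, x). label (X t) x)"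
proof (rule continuous_on_halfplane)
  fix \<tau> \<xi> :: "nat \<Rightarrow> real" and t x :: real assume tn: "\<And>n::nat. 0 \<le> \<tau> n" and t: "0 \<le> t" and lim: "\<tau> \<longlonglongrightarrow> t" "\<xi> \<longlonglongrightarrow> x"
  obtain a where a: "X t a = x" using admissible_surj[OF X(2)[OF t]] .
  have lx: "label (X t) x = M0 a" using label_at[OF X(2)[OF t], of a] a by simp
  have Xn: "(\<lambda>n. X (\<tau> n) a) \<longlonglongrightarrow> x" using halfplane_tendsto[OF X(1) tn t lim(1), of a] a by simp
  have bound: "\<bar>label (X (\<tau> n)) (\<xi> n) - label (X t) x\<bar> \<le> \<bar>\<xi> n - X (\<tau> n) a\<bar>" for n
    using potential_abs[OF label_potential[OF X(2)[OF tn]], of n "\<xi> n" "X (\<tau> n) a"] label_at[OF X(2)[OF tn], of n a] lx by simp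
  have "(\<lambda>n. \<bar>\<xi> n - X (\<tau> n) a\<bar>) \<longlonglongrightarrow> \<bar>x - x\<bar>" by (intro tendsto_intros lim Xn)
  then have "(\<lambda>n. \<bar>\<xi> n - X (\<tau> n) a\<bar>) \<longlonglongrightarrow> 0" by simp
  then have "(\<lambda>n. label (X (\<tau> n)) (\<xi> n) - label (X t) x) \<longlonglongrightarrow> 0"
    by (rule Lim_null_comparison[OF always_eventually, rotated]) (simp only: real_norm_def bound simp_thms)
  then show "(\<lambda>n. label (X (\<tau> n)) (\<xi> n)) \<longlonglongrightarrow> label (X t) x" by (rule LIM_zero_cancel)
qed

end

lemma lookahead_continuous:
  fixes M :: "real \<Rightarrow> real \<Rightarrow> real"
  assumes k: "monotone_kernel k" 
    and M: "continuous_on ({0..} \<times> UNIV) (\<lambda>(t, x). M t x)" "\<And>t. 0 \<le> t \<Longrightarrow> potential (M t)"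
  shows "continuous_on ({0..} \<times> UNIV) (\<lambda>(t, x). lookahead k (M t) x)"
proof (rule continuous_on_halfplane)
  fix \<tau> \<xi> :: "nat \<Rightarrow> real" and t x :: real assume tn: "\<And>n::nat. 0 \<le> \<tau> n" and t: "0 \<le> t" and lim: "\<tau> \<longlonglongrightarrow> t" "\<xi> \<longlonglongrightarrow> x"
  have fixed: "(\<lambda>n. lookahead k (M (\<tau> n)) x) \<longlonglongrightarrow> lookahead k (M t) x"
    by (rule lookahead_tendsto[OF k M(2)[OF t] M(2)[OF tn] halfplane_tendsto[OF M(1) tn t lim(1)]])
  have "(\<lambda>n. k 0 * \<bar>\<xi> n - x\<bar>) \<longlonglongrightarrow> k 0 * \<bar>x - x\<bar>" by (intro tendsto_intros lim)
  then have "(\<lambda>n. k 0 * \<bar>\<xi> n - x\<bar>) \<longlonglongrightarrow> 0" by simp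
  then have "(\<lambda>n. lookahead k (M (\<tau> n)) (\<xi> n) - lookahead k (M (\<tau> n)) x) \<longlonglongrightarrow> 0"
    by (rule Lim_null_comparison[OF always_eventually, rotated]) 
      (simp only: real_norm_def lookahead_lipschitz[OF k M(2)[OF tn]] simp_thms)
  from tendsto_add[OF this fixed]
  show "(\<lambda>n. lookahead k (M (\<tau> n)) (\<xi> n)) \<longlonglongrightarrow> lookahead k (M t) x" by simp
qed

context nonlocal_flow begin

lemma push_continuous:
  assumes Z: "Z \<in> flows"
  shows "continuous_on ({0..} \<times> UNIV) (\<lambda>(t, a). push (\<lambda>b. Z (t, b)) a)"
proof -
  have Zc: "continuous_on ({0..} \<times> UNIV) (\<lambda>(t, a). (\<lambda>t a. Z (t, a)) t a)" using Z by (simp add: flows_def)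
  have "continuous_on ({0..} \<times> UNIV) (\<lambda>(t, x). lookahead k (label (\<lambda>b. Z (t, b))) x)"
    using lookahead_continuous[OF k label_continuous[OF Zc flows_admissible[OF Z]] label_potential[OF flows_admissible[OF Z]]]
    by simp
  from continuous_on_compose2[OF this, of "{0..} \<times> UNIV" "\<lambda>p. (fst p, Z p)"]
  have "continuous_on ({0..} \<times> UNIV) (\<lambda>p. lookahead k (label (\<lambda>b. Z (fst p, b))) (Z p))"
    using Z by (force simp: flows_def intro!: continuous_intros)
  then show ?thesis unfolding push_def case_prod_beta prod.collapse
    using Z K by (auto simp: flows_def intro!: continuous_intros)
qed

text \<open>The equation of motion reads $X' = k(0)\,(G(X) - X)$ with the Euler step $G$. In this integrated form the new flow is an average of the initial flow and of
  Euler steps, so it stays in the convex set of the admissible flows.\<close>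

definition duhamel :: "(real \<times> real \<Rightarrow> real) \<Rightarrow> real \<times> real \<Rightarrow> real" where
  "duhamel Z = (\<lambda>(t, a). exp (- (k 0 * t)) * (a + integral {0..t} (\<lambda>s. exp (k 0 * s) * (k 0 * push (\<lambda>b. Z (s, b)) a))))"

lemma push_integrand:
  assumes Z: "Z \<in> flows" 
  shows "continuous_on {0..} (\<lambda>s. exp (k 0 * s) * (k 0 * push (\<lambda>b. Z (s, b)) a))"
proof -
  have "continuous_on {0..} (\<lambda>s. (\<lambda>(t, a). push (\<lambda>b. Z (t, b)) a) (s, a))"
    by (rule continuous_on_compose2[OF push_continuous[OF Z]]) (auto intro!: continuous_intros)
  then show ?thesis by (auto intro!: continuous_intros)
qed

lemma duhamel_flows:
  assumes Z: "Z \<in> flows" shows "duhamel Z \<in> flows"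
proof -
  note adm = flows_admissible[OF Z]
  let ?h = "\<lambda>a s. exp (k 0 * s) * (k 0 * push (\<lambda>b. Z (s, b)) a)"
  have int: "?h a integrable_on {0..t}" for a t
    by (rule continuous_on_interval_integrable[OF push_integrand[OF Z]]) simp
  have w: "((\<lambda>s. exp (k 0 * s) * (k 0 * c)) has_integral c * (exp (k 0 * t) - 1)) {0..t}" if "0 \<le> t" for c t
    using exp_weight_integral[of "k 0" t "k 0 * c"] K that by simp
  have "continuous_on ({0..} \<times> UNIV) (\<lambda>(s, a). ?h a s)"
    using push_continuous[OF Z] unfolding case_prod_beta by (auto intro!: continuous_intros)
  from continuous_on_integral_upto[OF this]
  have cont: "continuous_on ({0..} \<times> UNIV) (duhamel Z)"
    unfolding duhamel_def case_prod_beta by (auto intro!: continuous_intros)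
  have lower: "M0 b - M0 a \<le> duhamel Z (t, b) - duhamel Z (t, a)" if t: "0 \<le> t" and ab: "a \<le> b" for t a b
  proof -
    have "(M0 b - M0 a) * (exp (k 0 * t) - 1) \<le> integral {0..t} (\<lambda>s. ?h b s - ?h a s)"
    proof (rule has_integral_le[OF w[OF t] integrable_integral])
      show "(\<lambda>s. ?h b s - ?h a s) integrable_on {0..t}" by (intro integrable_diff int)
      fix s assume s: "s \<in> {0..t}"
      have "exp (k 0 * s) * (k 0 * (M0 b - M0 a)) \<le> exp (k 0 * s) * (k 0 * (push (\<lambda>b. Z (s, b)) b - push (\<lambda>b. Z (s, b)) a))"
        using push_ineq[OF adm ab, of s] s K by (intro mult_left_mono) auto
      then show "exp (k 0 * s) * (k 0 * (M0 b - M0 a)) \<le> ?h b s - ?h a s" by (simp add: algebra_simps)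
    qed
    also have "\<dots> = integral {0..t} (?h b) - integral {0..t} (?h a)" by (rule integral_diff[OF int int])
    finally have "(M0 b - M0 a) * exp (k 0 * t) \<le> (b + integral {0..t} (?h b)) - (a + integral {0..t} (?h a))"
      using potential_lip[OF M0 ab] by (simp add: algebra_simps)
    then have "exp (- (k 0 * t)) * ((M0 b - M0 a) * exp (k 0 * t)) \<le> exp (- (k 0 * t)) * ((b + integral {0..t} (?h b)) - (a + integral {0..t} (?h a)))"
      by (intro mult_left_mono) auto
    also have "exp (- (k 0 * t)) * ((M0 b - M0 a) * exp (k 0 * t)) = M0 b - M0 a"
      by (simp add: mult.left_commute[of "exp (- (k 0 * t))"] flip: exp_add)
    finally show ?thesis unfolding duhamel_def by (simp add: right_diff_distrib)
  qed
  have bounds: "a \<le> duhamel Z (t, a)" "duhamel Z (t, a) \<le> a + t" if t: "0 \<le> t" for t a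
  proof -
    have Zb: "a \<le> Z (s, a)" "Z (s, a) \<le> a + s" if "0 \<le> s" for s using Z that by (auto simp: flows_def)
    have "a * (exp (k 0 * t) - 1) \<le> integral {0..t} (?h a)"
    proof (rule has_integral_le[OF w[OF t] integrable_integral[OF int]])
      fix s assume s: "s \<in> {0..t}"
      show "exp (k 0 * s) * (k 0 * a) \<le> ?h a s"
        using push_bounds(1)[OF adm, of s a] Zb(1)[of s] s K by (intro mult_left_mono) auto
    qed
    then have "a * exp (k 0 * t) \<le> a + integral {0..t} (?h a)" by (simp add: algebra_simps)
    then have "exp (- (k 0 * t)) * (a * exp (k 0 * t)) \<le> duhamel Z (t, a)"
      unfolding duhamel_def prod.case by (intro mult_left_mono) auto
    then show "a \<le> duhamel Z (t, a)"
      by (simp add: mult.left_commute[of "exp (- (k 0 * t))"] flip: exp_add)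
    have w2: "((\<lambda>s. exp (k 0 * s) * (k 0 * (a + s + 1 / k 0))) has_integral (a + t) * exp (k 0 * t) - (a + 0) * exp (k 0 * 0)) {0..t}"
      by (rule fundamental_theorem_of_calculus[OF t])
        (use K in \<open>auto intro!: derivative_eq_intros simp: has_real_derivative_iff_has_vector_derivative[symmetric] field_simps\<close>)
    have "integral {0..t} (?h a) \<le> (a + t) * exp (k 0 * t) - (a + 0) * exp (k 0 * 0)"
    proof (rule has_integral_le[OF integrable_integral[OF int] w2])
      fix s assume s: "s \<in> {0..t}"
      show "?h a s \<le> exp (k 0 * s) * (k 0 * (a + s + 1 / k 0))"
        using push_bounds(2)[OF adm, of s a] Zb(2)[of s] s K by (intro mult_left_mono) auto
    qed
    then have "duhamel Z (t, a) \<le> exp (- (k 0 * t)) * ((a + t) * exp (k 0 * t))"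
      unfolding duhamel_def by auto
    then show "duhamel Z (t, a) \<le> a + t"
      by (simp add: mult.left_commute[of "exp (- (k 0 * t))"] flip: exp_add)
  qed
  show ?thesis unfolding flows_def using cont lower bounds by auto
qed

text \<open>An Euler step has Lipschitz constant $4$; with the weight \<open>exp (7 * k 0 * t)\<close> the time integral divides this by $8$.\<close>

lemma duhamel_contraction:
  assumes X: "X \<in> flows" and Y: "Y \<in> flows" 
    and le: "\<And>p. p \<in> {0..} \<times> UNIV \<Longrightarrow> \<bar>X p - Y p\<bar> \<le> c * exp (7 * k 0 * fst p)"
    and p: "p \<in> {0..} \<times> UNIV"
  shows "\<bar>duhamel X p - duhamel Y p\<bar> \<le> (c / 2) * exp (7 * k 0 * fst p)"
proof -
  obtain t a where ta: "p = (t, a)" "0 \<le> t" using p by auto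
  let ?h = "\<lambda>Z s. exp (k 0 * s) * (k 0 * push (\<lambda>b. Z (s, b)) a)"
  have int: "?h Z integrable_on {0..t}" if "Z \<in> flows" for Z
    by (rule continuous_on_interval_integrable[OF push_integrand[OF that]]) simp
  have c: "0 \<le> c" using le[of "(0, 0)"] by auto
  have w: "((\<lambda>s. exp (8 * k 0 * s) * (k 0 * (4 * c))) has_integral (k 0 * (4 * c) / (8 * k 0)) * (exp (8 * k 0 * t) - 1)) {0..t}"
    by (rule exp_weight_integral) (use K ta in auto)
  have "\<bar>integral {0..t} (\<lambda>s. ?h X s - ?h Y s)\<bar> \<le> (k 0 * (4 * c) / (8 * k 0)) * (exp (8 * k 0 * t) - 1)"
    unfolding real_norm_def[symmetric]
  proof (rule integral_norm_bound_integral[of _ _ "\<lambda>s. exp (8 * k 0 * s) * (k 0 * (4 * c))", THEN order_trans])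
    show "(\<lambda>s. ?h X s - ?h Y s) integrable_on {0..t}" by (intro integrable_diff int X Y)
    show "(\<lambda>s. exp (8 * k 0 * s) * (k 0 * (4 * c))) integrable_on {0..t}" using w by blast
    fix s assume s: "s \<in> {0..t}"
    have "\<bar>push (\<lambda>b. X (s, b)) a - push (\<lambda>b. Y (s, b)) a\<bar> \<le> 4 * (c * exp (7 * k 0 * s))"
      by (rule push_stable[OF flows_admissible[OF X] flows_admissible[OF Y]]) (use s le[of "(s, _)"] in auto)
    then have "exp (k 0 * s) * k 0 * \<bar>push (\<lambda>b. X (s, b)) a - push (\<lambda>b. Y (s, b)) a\<bar> \<le> exp (k 0 * s) * k 0 * (4 * (c * exp (7 * k 0 * s)))"
      using K by (intro mult_left_mono) auto
    moreover have "\<bar>?h X s - ?h Y s\<bar> = exp (k 0 * s) * k 0 * \<bar>push (\<lambda>b. X (s, b)) a - push (\<lambda>b. Y (s, b)) a\<bar>"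
      using K by (simp add: abs_mult flip: right_diff_distrib)
    moreover have "exp (8 * k 0 * s) = exp (k 0 * s) * exp (7 * k 0 * s)" by (simp flip: exp_add)
    ultimately show "norm (?h X s - ?h Y s) \<le> exp (8 * k 0 * s) * (k 0 * (4 * c))"
      by (simp add: ac_simps)
  qed (rule eq_refl[OF integral_unique[OF w]])
  also have "\<dots> \<le> (c / 2) * exp (8 * k 0 * t)" using c K by (simp add: field_simps)
  finally have *: "\<bar>integral {0..t} (?h X) - integral {0..t} (?h Y)\<bar> \<le> (c / 2) * exp (8 * k 0 * t)"
    using integral_diff[OF int[OF X] int[OF Y]] by simp
  have "duhamel X p - duhamel Y p = exp (- (k 0 * t)) * (integral {0..t} (?h X) - integral {0..t} (?h Y))"
    by (simp add: duhamel_def ta algebra_simps)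
  then have "\<bar>duhamel X p - duhamel Y p\<bar> = exp (- (k 0 * t)) * \<bar>integral {0..t} (?h X) - integral {0..t} (?h Y)\<bar>"
    by (simp add: abs_mult)
  also have "\<dots> \<le> exp (- (k 0 * t)) * ((c / 2) * exp (8 * k 0 * t))" using * by (intro mult_left_mono) auto
  also have "\<dots> = (c / 2) * (exp (- (k 0 * t)) * exp (8 * k 0 * t))" by simp
  also have "exp (- (k 0 * t)) * exp (8 * k 0 * t) = exp (7 * k 0 * t)" by (simp flip: exp_add)
  finally show ?thesis using ta by simp
qed

lemma flows_closed:
  assumes S: "\<And>n::nat. S n \<in> flows" 
    and lim: "\<And>n p. p \<in> {0..} \<times> UNIV \<Longrightarrow> \<bar>S n p - X p\<bar> \<le> c * (1/2)^n * exp (7 * k 0 * fst p)"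
  shows "X \<in> flows"
proof -
  have z: "(\<lambda>n. c * (1/2::real)^n * w) \<longlonglongrightarrow> 0" for w
  proof -
    have "(\<lambda>n. c * (1/2::real)^n * w) \<longlonglongrightarrow> c * 0 * w"
      by (intro tendsto_intros LIMSEQ_power_zero) auto
    then show ?thesis by simp
  qed
  have pw: "(\<lambda>n. S n (t, a)) \<longlonglongrightarrow> X (t, a)" if "0 \<le> t" for t a
  proof (rule LIM_zero_cancel, rule Lim_null_comparison[OF _ z])
    show "\<forall>\<^sub>F n in sequentially. norm (S n (t, a) - X (t, a)) \<le> c * (1/2)^n * exp (7 * k 0 * t)"
      using lim[of "(t, a)"] that by auto
  qed
  have cont: "continuous_on ({0..} \<times> UNIV) X"
    by (rule continuous_on_weighted_limit[OF _ _ _ lim]) (use S in \<open>auto simp: flows_def intro!: continuous_intros\<close>)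
  have "M0 b - M0 a \<le> X (t, b) - X (t, a)" if "0 \<le> t" "a \<le> b" for t a b
  proof (rule LIMSEQ_le_const[OF tendsto_diff[OF pw pw]])
    show "\<exists>N. \<forall>n\<ge>N. M0 b - M0 a \<le> S n (t, b) - S n (t, a)" using S that by (auto simp: flows_def)
  qed (use that in auto)
  moreover have "a \<le> X (t, a)" if "0 \<le> t" for t a
    by (rule LIMSEQ_le_const[OF pw[OF that]]) (use S that in \<open>auto simp: flows_def\<close>)
  moreover have "X (t, a) \<le> a + t" if "0 \<le> t" for t a
    by (rule LIMSEQ_le_const2[OF pw[OF that]]) (use S that in \<open>auto simp: flows_def\<close>)
  ultimately show ?thesis using cont by (auto simp: flows_def)
qed

theorem flow_exists:
  obtains X where "continuous_on ({0..} \<times> UNIV) (\<lambda>(t, a). X t a)" "\<And>a. X 0 a = a"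
    "\<And>t. 0 \<le> t \<Longrightarrow> admissible (X t)"
    "\<And>t a. 0 \<le> t \<Longrightarrow> ((\<lambda>t. X t a) has_real_derivative 1 - lookahead k (label (X t)) (X t a)) (at t within {0..})"
proof -
  have "\<exists>Z\<in>flows. \<forall>p\<in>{0..} \<times> UNIV. duhamel Z p = Z p"
  proof (rule picard_fixed_point[where \<omega>="\<lambda>p. exp (7 * k 0 * fst p)" and ?X0.0=snd and ?c0.0="1 / (7 * k 0)"])
    show start: "snd \<in> flows" by (auto simp: flows_def potential_lip[OF M0] intro!: continuous_intros)
    show "duhamel X \<in> flows" if "X \<in> flows" for X by (rule duhamel_flows[OF that])
    show "\<bar>duhamel snd p - snd p\<bar> \<le> 1 / (7 * k 0) * exp (7 * k 0 * fst p)" if pD: "p \<in> {0..} \<times> UNIV" for p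
    proof -
      obtain t a where p: "p = (t, a)" "0 \<le> t" using pD by (cases p) auto
      have "a \<le> duhamel snd p" "duhamel snd p \<le> a + t" using duhamel_flows[OF start] p by (auto simp: flows_def)
      moreover have "7 * k 0 * t \<le> exp (7 * k 0 * t)" using exp_ge_add_one_self[of "7 * k 0 * t"] by linarith
      then have "t \<le> 1 / (7 * k 0) * exp (7 * k 0 * t)" using K by (simp add: field_simps)
      ultimately show ?thesis using p by simp
    qed
    show "\<bar>duhamel X p - duhamel Y p\<bar> \<le> (c / 2) * exp (7 * k 0 * fst p)" 
      if "X \<in> flows" "Y \<in> flows" "\<And>p. p \<in> {0..} \<times> UNIV \<Longrightarrow> \<bar>X p - Y p\<bar> \<le> c * exp (7 * k 0 * fst p)" "p \<in> {0..} \<times> UNIV"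
      for X Y c p
      by (rule duhamel_contraction[OF that])
    show "X \<in> flows" 
      if "\<And>n. S n \<in> flows" "\<And>n p. p \<in> {0..} \<times> UNIV \<Longrightarrow> \<bar>S n p - X p\<bar> \<le> c * (1/2)^n * exp (7 * k 0 * fst p)"
      for S X c
      by (rule flows_closed[OF that])
  qed
  then obtain Z where Z: "Z \<in> flows" and fp: "\<And>t a. 0 \<le> t \<Longrightarrow> duhamel Z (t, a) = Z (t, a)" by auto
  show thesis
  proof (rule that[of "\<lambda>t a. Z (t, a)"])
    show "continuous_on ({0..} \<times> UNIV) (\<lambda>(t, a). Z (t, a))" using Z by (simp add: flows_def)
    show "Z (0, a) = a" for a using Z by (force simp: flows_def intro: antisym)
    show "admissible (\<lambda>a. Z (t, a))" if "0 \<le> t" for t by (rule flows_admissible[OF Z that])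
    fix t a :: real assume t: "0 \<le> t"
    let ?h = "\<lambda>s. exp (k 0 * s) * (k 0 * push (\<lambda>b. Z (s, b)) a)"
    define J H where "J = (\<lambda>t. integral {0..t} ?h)" and "H = ?h t"
    have I: "(J has_real_derivative H) (at t within {0..})"
      unfolding J_def H_def by (rule integral_upto_has_derivative[OF push_integrand[OF Z] t])
    have "((\<lambda>t. duhamel Z (t, a)) has_real_derivative 
        - k 0 * duhamel Z (t, a) + exp (- (k 0 * t)) * H) (at t within {0..})"
      unfolding duhamel_def prod.case J_def[THEN fun_cong, symmetric]
      by (auto intro!: derivative_eq_intros I simp: algebra_simps)
    moreover have "exp (- (k 0 * t)) * H = k 0 * push (\<lambda>b. Z (t, b)) a"
      by (simp add: H_def mult.assoc[symmetric] flip: exp_add)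
    moreover have "- k 0 * duhamel Z (t, a) + k 0 * push (\<lambda>b. Z (t, b)) a = 1 - lookahead k (label (\<lambda>b. Z (t, b))) (Z (t, a))"
      using K by (simp add: fp[OF t] push_def field_simps)
    ultimately have "((\<lambda>t. duhamel Z (t, a)) has_real_derivative 1 - lookahead k (label (\<lambda>b. Z (t, b))) (Z (t, a))) (at t within {0..})"
      by simp
    then show "((\<lambda>t. Z (t, a)) has_real_derivative 1 - lookahead k (label (\<lambda>b. Z (t, b))) (Z (t, a))) (at t within {0..})"
      by (rule has_field_derivative_transform_within[where d=1]) (use t fp in auto)
  qed
qed

end

section \<open>Existence of a solution\<close>

lemma nondecreasing_halfline:
  fixes f f' :: "real \<Rightarrow> real"
  assumes d: "\<And>t. 0 \<le> t \<Longrightarrow> (f has_real_derivative f' t) (at t within {0..})"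
    and pos: "\<And>t. 0 \<le> t \<Longrightarrow> 0 \<le> f' t" and st: "0 \<le> s" "s \<le> t"
  shows "f s \<le> f t"
proof (rule DERIV_nonneg_imp_increasing_open[OF st(2)])
  show "continuous_on {s..t} f"
    by (rule continuous_on_subset[of "{0..}"], rule DERIV_continuous_on[where D=f']) (use d st in auto)
  fix x assume x: "s < x" "x < t"
  then have "at x within {0..} = at x" using st by (intro at_within_interior) auto
  then show "\<exists>y. (f has_real_derivative y) (at x) \<and> 0 \<le> y" using d[of x] pos[of x] x st by auto
qed

lemma test_functionE:
  assumes "test_function \<phi>"
  obtains f1 f2 T0 T R where
    "\<And>p. (\<phi> has_derivative (\<lambda>h. fst h * f1 p + snd h * f2 p)) (at p)"
    "continuous_on UNIV f1" "continuous_on UNIV f2" "0 < T0"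
    "\<And>t x. \<not> (T0 \<le> t \<and> t \<le> T \<and> \<bar>x\<bar> \<le> R) \<Longrightarrow> \<phi> (t, x) = 0 \<and> f1 (t, x) = 0 \<and> f2 (t, x) = 0"
proof -
  define S where "S = closure {p. \<phi> p \<noteq> 0}"
  have S: "compact S" "S \<subseteq> {0<..} \<times> UNIV" and sm: "smooth_plane \<phi>"
    using assms by (auto simp: test_function_def S_def)
  obtain f1 f2 where d: "\<And>p. (\<phi> has_derivative (\<lambda>h. fst h * f1 p + snd h * f2 p)) (at p)"
    and sm12: "smooth_plane f1" "smooth_plane f2"
    using sm by (cases rule: smooth_plane.cases) auto
  have cont: "continuous_on UNIV f" if "smooth_plane f" for f
    using that by (cases rule: smooth_plane.cases) (auto intro!: has_derivative_continuous_on)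
  have zero: "\<phi> p = 0 \<and> f1 p = 0 \<and> f2 p = 0" if p: "p \<notin> S" for p
  proof -
    have "open (- S)" unfolding S_def by auto
    have z: "\<phi> q = 0" if "q \<notin> S" for q using that closure_subset[of "{p. \<phi> p \<noteq> 0}"] by (auto simp: S_def)
    have "(\<phi> has_derivative (\<lambda>h. 0)) (at p)"
      by (rule has_derivative_transform_within_open[of "\<lambda>_. 0" _ p UNIV "- S"]) (use \<open>open (- S)\<close> p z in auto)
    then have "(\<lambda>h. fst h * f1 p + snd h * f2 p) = (\<lambda>h. 0)"
      by (rule has_derivative_unique[OF d])
    from fun_cong[OF this, of "(1, 0)"] fun_cong[OF this, of "(0, 1)"] z[OF p] show ?thesis by simp
  qed
  obtain T0 where T0: "0 < T0" "\<And>p. p \<in> S \<Longrightarrow> T0 \<le> fst p"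
  proof (cases "S = {}")
    case True then show ?thesis using that[of 1] by auto
  next
    case False
    have "\<exists>q\<in>S. \<forall>p\<in>S. fst q \<le> fst p"
      by (rule continuous_attains_inf[OF S(1) False]) (intro continuous_intros)
    then show ?thesis using that S(2) by (metis greaterThan_iff mem_Times_iff subsetD)
  qed
  obtain B where B: "\<And>p. p \<in> S \<Longrightarrow> norm p \<le> B"
    using compact_imp_bounded[OF S(1)] by (auto simp: bounded_iff)
  show thesis
  proof (rule that[OF d cont[OF sm12(1)] cont[OF sm12(2)] T0(1)])
    fix t x assume *: "\<not> (T0 \<le> t \<and> t \<le> B \<and> \<bar>x\<bar> \<le> B)"
    have "(t, x) \<notin> S"
    proof
      assume "(t, x) \<in> S"
      then have "T0 \<le> t" "norm (t, x) \<le> B" using T0(2)[of "(t, x)"] B[of "(t, x)"] by auto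
      moreover have "\<bar>t\<bar> \<le> norm (t, x)" "\<bar>x\<bar> \<le> norm (t, x)" 
        using norm_fst_le[of t x] norm_snd_le[of x t] by auto
      ultimately show False using * by auto
    qed
    then show "\<phi> (t, x) = 0 \<and> f1 (t, x) = 0 \<and> f2 (t, x) = 0" by (rule zero)
  qed
qed

lemma partial_deriv:
  fixes \<phi> :: "real \<times> real \<Rightarrow> real"
  assumes d: "\<And>p. (\<phi> has_derivative (\<lambda>h. fst h * f1 p + snd h * f2 p)) (at p)"
  shows "deriv (\<lambda>s. \<phi> (s, x)) t = f1 (t, x)" "deriv (\<lambda>y. \<phi> (t, y)) x = f2 (t, x)"
proof -
  have "((\<lambda>s. (s, x)) has_derivative (\<lambda>h. (h, 0))) (at t)" by (auto intro!: derivative_eq_intros)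
  from has_derivative_compose[OF this d]
  have "((\<lambda>s. \<phi> (s, x)) has_derivative (\<lambda>h. fst (h, 0::real) * f1 (t, x) + snd (h, 0) * f2 (t, x))) (at t)" .
  then show "deriv (\<lambda>s. \<phi> (s, x)) t = f1 (t, x)"
    by (intro DERIV_imp_deriv) (simp add: has_field_derivative_def mult.commute[of _ "f1 (t, x)"])
  have "((\<lambda>y. (t, y)) has_derivative (\<lambda>h. (0, h))) (at x)" by (auto intro!: derivative_eq_intros)
  from has_derivative_compose[OF this d]
  have "((\<lambda>y. \<phi> (t, y)) has_derivative (\<lambda>h. fst (0::real, h) * f1 (t, x) + snd (0::real, h) * f2 (t, x))) (at x)" .
  then show "deriv (\<lambda>y. \<phi> (t, y)) x = f2 (t, x)"
    by (intro DERIV_imp_deriv) (simp add: has_field_derivative_def mult.commute[of _ "f2 (t, x)"])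
qed

lemma integrable_compact_support_plane:
  fixes g :: "real \<times> real \<Rightarrow> real"
  assumes g: "g \<in> borel_measurable borel" and B: "\<And>p. \<bar>g p\<bar> \<le> B"
    and supp: "\<And>t x. \<not> (\<bar>t\<bar> \<le> T \<and> \<bar>x\<bar> \<le> R) \<Longrightarrow> g (t, x) = 0"
  shows "integrable (lborel \<Otimes>\<^sub>M lborel) g"
  unfolding lborel_prod
proof (rule integrableI_bounded_set[where A="cbox (-T, -R) (T, R)" and B=B])
  show "emeasure lborel (cbox (-T, -R) (T, R)) < \<infinity>" by (rule emeasure_lborel_cbox_finite)
  show "AE p in lborel. p \<in> cbox (- T, - R) (T, R) \<longrightarrow> norm (g p) \<le> B" using B by auto
  have "g p = 0" if "p \<notin> cbox (- T, - R) (T, R)" for p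
    using that supp[of "fst p" "snd p"] by (cases p) (auto simp: cbox_Pair_eq abs_le_iff)
  then show "AE p in lborel. p \<notin> cbox (- T, - R) (T, R) \<longrightarrow> g p = 0" by auto
qed (use g in auto)

lemma lookahead_cong_diff:
  assumes "\<And>x r. 0 \<le> r \<Longrightarrow> M (x + r) - M x = M' (x + r) - M' x" and k: "monotone_kernel k"
  shows "lookahead k M x = lookahead k M' x"
  unfolding lookahead_def
  by (rule set_lebesgue_integral_cong) (use assms level_nonneg[OF k] in auto)

locale flow_solution = nonlocal_flow +
  fixes X :: "real \<Rightarrow> real \<Rightarrow> real"
  assumes X_cont: "continuous_on ({0..} \<times> UNIV) (\<lambda>(t, a). X t a)" 
    and X_0: "\<And>a. X 0 a = a"
    and X_adm: "\<And>t. 0 \<le> t \<Longrightarrow> admissible (X t)"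
    and X_deriv: "\<And>t a. 0 \<le> t \<Longrightarrow> ((\<lambda>t. X t a) has_real_derivative 1 - lookahead k (label (X t)) (X t a)) (at t within {0..})"
begin

abbreviation P :: "real \<Rightarrow> real \<Rightarrow> real" where "P t \<equiv> label (X t)"

definition v :: "real \<Rightarrow> real \<Rightarrow> real" where "v t x = 1 - lookahead k (P t) x"

lemma P_potential: "0 \<le> t \<Longrightarrow> potential (P t)" by (rule label_potential[OF X_adm])

lemma P_X: "0 \<le> t \<Longrightarrow> P t (X t a) = M0 a" by (rule label_at[OF X_adm])

lemma v_range: "0 \<le> t \<Longrightarrow> 0 \<le> v t x" "0 \<le> t \<Longrightarrow> v t x \<le> 1"
  using lookahead_nonneg[OF k P_potential] lookahead_le_1[OF k P_potential] by (auto simp: v_def)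

lemma v_lipschitz: "0 \<le> t \<Longrightarrow> \<bar>v t x - v t y\<bar> \<le> k 0 * \<bar>x - y\<bar>"
  using lookahead_lipschitz[OF k P_potential, of t x y] by (auto simp: v_def abs_minus_commute)

lemma P_cont: "continuous_on ({0..} \<times> UNIV) (\<lambda>(t, x). P t x)"
  by (rule label_continuous[OF X_cont X_adm])

lemma v_cont: "continuous_on ({0..} \<times> UNIV) (\<lambda>(t, x). v t x)"
  using lookahead_continuous[OF k P_cont P_potential] unfolding v_def case_prod_beta by (intro continuous_intros)

lemma X_deriv': "0 \<le> t \<Longrightarrow> ((\<lambda>t. X t a) has_real_derivative v t (X t a)) (at t within {0..})"
  using X_deriv by (simp add: v_def)

lemma X_mono: "0 \<le> t \<Longrightarrow> a \<le> b \<Longrightarrow> X t a \<le> X t b" by (rule admissible_mono[OF X_adm])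

lemma X_time:
  assumes "0 \<le> s" "s \<le> t" shows "X s a \<le> X t a" "X t a - X s a \<le> t - s"
proof -
  show "X s a \<le> X t a"
    by (rule nondecreasing_halfline[OF X_deriv' _ assms]) (auto intro: v_range)
  have "s - X s a \<le> t - X t a"
    by (rule nondecreasing_halfline[where f'="\<lambda>t. 1 - v t (X t a)", OF _ _ assms]) 
      (auto intro!: derivative_eq_intros X_deriv' v_range)
  then show "X t a - X s a \<le> t - s" by simp
qed

lemma X_time_abs: "0 \<le> s \<Longrightarrow> 0 \<le> t \<Longrightarrow> \<bar>X t a - X s a\<bar> \<le> \<bar>t - s\<bar>"
  using X_time[of s t a] X_time[of t s a] by (cases "s \<le> t") auto

text \<open>The velocity has the Lipschitz constant \<open>k 0\<close> in space, so Gronwall's inequality controls distances of cars from both sides.\<close>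

lemma X_expand:
  assumes st: "0 \<le> s" "s \<le> t" and ab: "a \<le> b"
  shows "X t b - X t a \<le> exp (k 0 * (t - s)) * (X s b - X s a)" 
    "X s b - X s a \<le> exp (k 0 * (t - s)) * (X t b - X t a)"
proof -
  have b: "\<bar>v r (X r b) - v r (X r a)\<bar> \<le> k 0 * (X r b - X r a)" if "0 \<le> r" for r
    using v_lipschitz[OF that, of "X r b" "X r a"] X_mono[OF that ab] by simp
  have "exp (k 0 * s) * (X s b - X s a) \<le> exp (k 0 * t) * (X t b - X t a)"
  proof (rule nondecreasing_halfline[where f'="\<lambda>r. exp (k 0 * r) * (k 0 * (X r b - X r a) + (v r (X r b) - v r (X r a)))", OF _ _ st])
    fix r :: real assume r: "0 \<le> r"
    show "((\<lambda>r. exp (k 0 * r) * (X r b - X r a)) has_real_derivative exp (k 0 * r) * (k 0 * (X r b - X r a) + (v r (X r b) - v r (X r a)))) (at r within {0..})"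
      by (auto intro!: derivative_eq_intros X_deriv' r simp: algebra_simps)
    show "0 \<le> exp (k 0 * r) * (k 0 * (X r b - X r a) + (v r (X r b) - v r (X r a)))"
      using b[OF r] by (intro mult_nonneg_nonneg) (auto simp: abs_le_iff)
  qed
  then have "exp (- (k 0 * s)) * (exp (k 0 * s) * (X s b - X s a)) \<le> exp (- (k 0 * s)) * (exp (k 0 * t) * (X t b - X t a))"
    by (intro mult_left_mono) auto
  then show "X s b - X s a \<le> exp (k 0 * (t - s)) * (X t b - X t a)"
    by (simp add: mult.assoc[symmetric] right_diff_distrib flip: exp_add)
  have "- (exp (- (k 0 * s)) * (X s b - X s a)) \<le> - (exp (- (k 0 * t)) * (X t b - X t a))"
  proof (rule nondecreasing_halfline[where f'="\<lambda>r. exp (- (k 0 * r)) * (k 0 * (X r b - X r a) - (v r (X r b) - v r (X r a)))", OF _ _ st])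
    fix r :: real assume r: "0 \<le> r"
    show "((\<lambda>r. - (exp (- (k 0 * r)) * (X r b - X r a))) has_real_derivative exp (- (k 0 * r)) * (k 0 * (X r b - X r a) - (v r (X r b) - v r (X r a)))) (at r within {0..})"
      by (auto intro!: derivative_eq_intros X_deriv' r simp: algebra_simps)
    show "0 \<le> exp (- (k 0 * r)) * (k 0 * (X r b - X r a) - (v r (X r b) - v r (X r a)))"
      using b[OF r] by (intro mult_nonneg_nonneg) (auto simp: abs_le_iff)
  qed
  then have "exp (k 0 * t) * (exp (- (k 0 * t)) * (X t b - X t a)) \<le> exp (k 0 * t) * (exp (- (k 0 * s)) * (X s b - X s a))"
    by (intro mult_left_mono) auto
  then show "X t b - X t a \<le> exp (k 0 * (t - s)) * (X s b - X s a)"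
    by (simp add: mult.assoc[symmetric] right_diff_distrib flip: exp_add)
qed

lemma X_expand_abs:
  assumes "0 \<le> s" "0 \<le> t" "a \<le> b"
  shows "X t b - X t a \<le> exp (k 0 * \<bar>t - s\<bar>) * (X s b - X s a)"
  using X_expand[of s t a b] X_expand[of t s a b] assms by (cases "s \<le> t") auto

lemma X_strict: "0 \<le> t \<Longrightarrow> a < b \<Longrightarrow> X t a < X t b"
  using X_expand(2)[of 0 t a b] X_mono[of t a b] by (cases "X t a = X t b") (auto simp: X_0)

lemma X_inj: "0 \<le> t \<Longrightarrow> X t a = X t b \<longleftrightarrow> a = b"
  using X_strict[of t a b] X_strict[of t b a] by (metis less_irrefl neq_iff)

lemma X_less_iff: "0 \<le> t \<Longrightarrow> X t a < X t b \<longleftrightarrow> a < b"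
  using X_strict[of t a b] X_mono[of t b a] by (auto simp: not_less[symmetric])

lemma X_le_iff: "0 \<le> t \<Longrightarrow> X t a \<le> X t b \<longleftrightarrow> a \<le> b"
  using X_less_iff[of t b a] by (auto simp: not_less[symmetric])

definition Y :: "real \<Rightarrow> real \<Rightarrow> real" where "Y t x = (SOME a. X t a = x)"

lemma X_Y: "0 \<le> t \<Longrightarrow> X t (Y t x) = x"
  unfolding Y_def by (rule someI_ex) (metis admissible_surj[OF X_adm])

lemma Y_X: "0 \<le> t \<Longrightarrow> Y t (X t a) = a"
  using X_Y[of t "X t a"] by (simp add: X_inj)

lemma P_Y: "0 \<le> t \<Longrightarrow> P t x = M0 (Y t x)"
  using P_X[of t "Y t x"] by (simp add: X_Y)

lemma Y_less_iff: "0 \<le> t \<Longrightarrow> Y t x < Y t y \<longleftrightarrow> x < y"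
  using X_less_iff[of t "Y t x" "Y t y"] by (simp add: X_Y)

lemma X_measurable: assumes "0 \<le> t" shows "X t \<in> borel_measurable borel"
  using X_adm[OF assms] by (auto simp: admissible_def intro: borel_measurable_continuous_onI)

definition quotient :: "real \<Rightarrow> nat \<Rightarrow> real \<Rightarrow> real" where
  "quotient t n x = 2 ^ n * (P t (x + 1 / 2 ^ n) - P t x)"

text \<open>The limit exists almost everywhere. Taking it pointwise gives a Borel function of time and space together, and cutting it off makes it bounded everywhere.\<close>

definition u :: "real \<Rightarrow> real \<Rightarrow> real" where
  "u t x = max 0 (min 1 (lim (\<lambda>n. quotient (max 0 t) n x)))"

lemma P_measurable_plane: "(\<lambda>(t, x). P (max 0 t) x) \<in> borel_measurable borel"
  using borel_measurable_continuous_onI[OF continuous_on_extend_halfplane[OF P_cont]] by (simp add: case_prod_beta')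

lemma u_measurable_plane: "(\<lambda>(t, x). u t x) \<in> borel_measurable borel"
proof -
  have [measurable]: "(\<lambda>p. P (max 0 (fst p)) (snd p + c)) \<in> borel_measurable borel" for c :: real
    using measurable_compose[OF borel_measurable_continuous_onI P_measurable_plane, of "\<lambda>p. (fst p, snd p + c)"]
    by (simp add: case_prod_beta' continuous_intros)
  have [measurable]: "(\<lambda>p. P (max 0 (fst p)) (snd p)) \<in> borel_measurable borel"
    using P_measurable_plane by (simp add: case_prod_beta')
  show ?thesis unfolding u_def quotient_def case_prod_beta by measurable
qed

lemma u_measurable: "u t \<in> borel_measurable borel"
  using measurable_compose[OF borel_measurable_continuous_onI u_measurable_plane, of "\<lambda>x. (t, x)"]
  by (simp add: continuous_intros)

lemma u_density: "density_fn (u t)"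
  using u_measurable by (auto simp: density_fn_def u_def)

text \<open>The initial mass, transported by the flow, has the potential \<open>P t\<close>, which is 1-Lipschitz. So it has a density with values in $[0,1]$, and this is almost everywhere the limit of
  the difference quotients.\<close>

lemma u_facts:
  assumes t: "0 \<le> t"
  shows "density lborel (\<lambda>x. ennreal (u t x)) = distr (density lborel (\<lambda>x. ennreal (u0 x))) borel (X t)"
    "\<And>a b. a \<le> b \<Longrightarrow> primitive (u t) b - primitive (u t) a = P t b - P t a"
    "AE x in lborel. (\<lambda>n. quotient t n x) \<longlonglongrightarrow> u t x"
proof -
  define \<nu> where "\<nu> = distr (density lborel (\<lambda>x. ennreal (u0 x))) borel (X t)"
  have [measurable]: "X t \<in> borel_measurable borel" "u0 \<in> borel_measurable borel"
    using X_measurable[OF t] u0 by auto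
  have \<nu>: "emeasure \<nu> {a<..b} = ennreal (P t b - P t a)" if ab: "a \<le> b" for a b
  proof -
    have pre: "X t -` {a<..b} = {Y t a<..Y t b}"
    proof (intro set_eqI)
      fix c show "c \<in> X t -` {a<..b} \<longleftrightarrow> c \<in> {Y t a<..Y t b}"
        using X_less_iff[OF t, of "Y t a" c] X_le_iff[OF t, of c "Y t b"] by (simp add: X_Y[OF t])
    qed
    have ab': "Y t a \<le> Y t b" using Y_less_iff[OF t, of b a] ab by (auto simp: not_less[symmetric])
    have "emeasure \<nu> {a<..b} = (\<integral>\<^sup>+x. ennreal (u0 x) * indicator {Y t a<..Y t b} x \<partial>lborel)"
      unfolding \<nu>_def by (subst emeasure_distr) (auto simp: pre emeasure_density)
    also have "\<dots> = (\<integral>\<^sup>+x. ennreal (u0 x) * indicator {Y t a..Y t b} x \<partial>lborel)"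
      by (rule nn_integral_cong_AE, rule AE_mp[OF AE_lborel_singleton[of "Y t a"]], rule AE_I2) (auto simp: indicator_def)
    also have "\<dots> = ennreal (M0 (Y t b) - M0 (Y t a))"
      unfolding M0_def by (rule primitive_diff_nn[OF u0 ab'])
    finally show ?thesis by (simp add: P_Y[OF t])
  qed
  obtain f where f: "density_fn f" "density lborel (\<lambda>x. ennreal (f x)) = \<nu>"
    and pf: "\<And>a b. a \<le> b \<Longrightarrow> primitive f b - primitive f a = P t b - P t a"
    by (rule density_of_potential[OF _ P_potential[OF t] \<nu>]) (auto simp: \<nu>_def)
  have "AE x in lborel. (\<lambda>n. quotient t n x) \<longlonglongrightarrow> f x"
    using difference_quotient_AE[OF f(1)] pf by (simp add: quotient_def)
  then have AE: "AE x in lborel. (\<lambda>n. quotient t n x) \<longlonglongrightarrow> f x \<and> u t x = f x"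
    by eventually_elim (use t f in \<open>auto simp: u_def limI max_def min_def not_le not_less dest: antisym intro: antisym\<close>)
  then show "AE x in lborel. (\<lambda>n. quotient t n x) \<longlonglongrightarrow> u t x" by eventually_elim auto
  have uf: "AE x in lborel. u t x = f x" using AE by eventually_elim auto
  have [measurable]: "u t \<in> borel_measurable borel" "f \<in> borel_measurable borel" using u_measurable f by auto
  have "density lborel (\<lambda>x. ennreal (u t x)) = density lborel (\<lambda>x. ennreal (f x))"
    by (rule density_cong) (use uf in auto)
  then show "density lborel (\<lambda>x. ennreal (u t x)) = distr (density lborel (\<lambda>x. ennreal (u0 x))) borel (X t)"
    using f(2) by (simp add: \<nu>_def)
  have "primitive (u t) x = primitive f x" for x
    unfolding primitive_def set_lebesgue_integral_def
    by (intro arg_cong2[where f="(-)"] integral_cong_AE) (use uf in auto)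
  then show "primitive (u t) b - primitive (u t) a = P t b - P t a" if "a \<le> b" for a b
    using pf[OF that] by simp
qed

lemma convolution_u:
  assumes "0 \<le> t" shows "space_convolution u k t x = lookahead k (P t) x"
proof -
  have "space_convolution u k t x = lookahead k (primitive (u t)) x"
    unfolding space_convolution_def by (rule convolution_eq_lookahead[OF k u_density])
  also have "\<dots> = lookahead k (P t) x"
    by (rule lookahead_cong_diff[OF u_facts(2)[OF assms] k]) auto
  finally show ?thesis .
qed

lemma u_initial: "AE x in lborel. u 0 x = u0 x"
proof -
  have "X 0 = (\<lambda>a. a)" using X_0 by auto
  then have "P 0 x = primitive u0 x" for x using P_X[of 0 x] by (simp add: M0_def)
  then have "AE x in lborel. (\<lambda>n. quotient 0 n x) \<longlonglongrightarrow> u0 x"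
    using difference_quotient_AE[OF u0] by (simp add: quotient_def)
  then show ?thesis using u_facts(3)[of 0, simplified]
    by eventually_elim (auto intro: LIMSEQ_unique)
qed

text \<open>Following the cars turns the integral over the plane into an integral over initial positions of the total time derivative of the test function along a trajectory.
  This vanishes, as the test function has compact support in the times $t > 0$.\<close>

lemma u_weak:
  assumes V: "\<And>r. V r = 1 - r"
  shows "distributional_solution V k u"
  unfolding distributional_solution_def
proof (intro allI impI)
  fix \<phi> assume "test_function \<phi>"
  then obtain f1 f2 T0 T R where
    d: "\<And>p. (\<phi> has_derivative (\<lambda>h. fst h * f1 p + snd h * f2 p)) (at p)"
    and c1: "continuous_on UNIV f1" and c2: "continuous_on UNIV f2" and T0: "0 < T0"
    and z: "\<And>t x. \<not> (T0 \<le> t \<and> t \<le> T \<and> \<bar>x\<bar> \<le> R) \<Longrightarrow> \<phi> (t, x) = 0 \<and> f1 (t, x) = 0 \<and> f2 (t, x) = 0"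
    by (rule test_functionE) blast
  define g where "g p = f1 p + v (max 0 (fst p)) (snd p) * f2 p" for p
  have gc: "continuous_on UNIV g" unfolding g_def
    by (intro continuous_intros continuous_on_extend_halfplane[OF v_cont] c1 c2)
  have g0: "g (t, x) = 0" if "\<not> (T0 \<le> t \<and> t \<le> T \<and> \<bar>x\<bar> \<le> R)" for t x
    using z[OF that] by (simp add: g_def)
  have "compact (g ` cbox (0, -R) (T, R))"
    by (rule compact_continuous_image) (auto intro: continuous_on_subset[OF gc])
  then obtain B where B: "\<And>p. p \<in> cbox (0, -R) (T, R) \<Longrightarrow> \<bar>g p\<bar> \<le> B"
    using compact_imp_bounded[of "g ` cbox (0, -R) (T, R)"] unfolding bounded_iff real_norm_def by blast
  have gB: "\<bar>g p\<bar> \<le> \<bar>B\<bar>" for p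
  proof (cases "p \<in> cbox (0, -R) (T, R)")
    case True then show ?thesis using B[of p] by auto
  next
    case False 
    then have "g (fst p, snd p) = 0" using T0 by (intro g0) (cases p; auto simp: cbox_Pair_eq abs_le_iff)
    then show ?thesis by simp
  qed
  have [measurable]: "g \<in> borel_measurable borel" by (rule borel_measurable_continuous_onI[OF gc])
  have [measurable]: "(\<lambda>p. u (fst p) (snd p)) \<in> borel_measurable borel" using u_measurable_plane by (simp add: case_prod_beta')
  have I: "u t x * deriv (\<lambda>s. \<phi> (s, x)) t + u t x * V (space_convolution u k t x) * deriv (\<lambda>y. \<phi> (t, y)) x
     = u t x * g (t, x)" for t x
  proof (cases "0 \<le> t")
    case True
    then show ?thesis by (simp add: partial_deriv[OF d] V convolution_u v_def g_def algebra_simps)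
  next
    case False
    then have "\<not> (T0 \<le> t \<and> t \<le> T \<and> \<bar>x\<bar> \<le> R)" using T0 by auto
    from z[OF this] show ?thesis by (simp add: partial_deriv[OF d] g_def)
  qed
  have int1: "integrable (lborel \<Otimes>\<^sub>M lborel) (\<lambda>p. u (fst p) (snd p) * g p)"
  proof (rule integrable_compact_support_plane[where B="\<bar>B\<bar>" and T=T and R=R])
    show "(\<lambda>p. u (fst p) (snd p) * g p) \<in> borel_measurable borel" by measurable
    show "\<bar>u (fst p) (snd p) * g p\<bar> \<le> \<bar>B\<bar>" for p
      using mult_mono[OF density_fnD(2)[OF u_density[of "fst p"], of "snd p"] gB[of p]] density_fnD(1)[OF u_density[of "fst p"], of "snd p"]
      by (simp add: abs_mult)
    show "u (fst (t, x)) (snd (t, x)) * g (t, x) = 0" if "\<not> (\<bar>t\<bar> \<le> T \<and> \<bar>x\<bar> \<le> R)" for t x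
      using g0[of t x] that T0 by auto
  qed
  define G where "G t a = g (t, X (max 0 t) a)" for t a
  have Xmc: "continuous_on UNIV (\<lambda>p. X (max 0 (fst p)) (snd p))"
    by (rule continuous_on_extend_halfplane[OF X_cont])
  have Gc: "continuous_on UNIV (\<lambda>(t, a). G t a)"
    unfolding G_def case_prod_beta using Xmc
    by (intro continuous_on_compose2[OF gc]) (auto intro!: continuous_intros)
  have [measurable]: "(\<lambda>p. G (fst p) (snd p)) \<in> borel_measurable borel"
    using borel_measurable_continuous_onI[OF Gc] by (simp add: case_prod_beta')
  have [measurable]: "u0 \<in> borel_measurable borel" using u0 by simp
  have int2: "integrable (lborel \<Otimes>\<^sub>M lborel) (\<lambda>p. u0 (snd p) * G (fst p) (snd p))"
  proof (rule integrable_compact_support_plane[where B="\<bar>B\<bar>" and T=T and R="R+T"])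
    show "(\<lambda>p. u0 (snd p) * G (fst p) (snd p)) \<in> borel_measurable borel" 
      by (intro borel_measurable_times measurable_compose[OF borel_measurable_continuous_onI[of snd]]) 
        (auto intro!: continuous_intros)
    show "\<bar>u0 (snd p) * G (fst p) (snd p)\<bar> \<le> \<bar>B\<bar>" for p
      using mult_mono[OF density_fnD(2)[OF u0, of "snd p"] gB] density_fnD(1)[OF u0, of "snd p"]
      by (simp add: abs_mult G_def)
    show "u0 (snd (t, x)) * G (fst (t, x)) (snd (t, x)) = 0" if "\<not> (\<bar>t\<bar> \<le> T \<and> \<bar>x\<bar> \<le> R + T)" for t x
    proof (cases "T0 \<le> t \<and> t \<le> T")
      case True
      then have t: "0 \<le> t" "t \<le> T" using T0 by auto
      then have "\<bar>X t x - x\<bar> \<le> T" using X_time_abs[of 0 t x] by (simp add: X_0)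
      then have "\<not> \<bar>X t x\<bar> \<le> R" using that t by auto
      then show ?thesis using g0[of t "X t x"] t by (simp add: G_def)
    next
      case False
      then show ?thesis using g0[of t] by (auto simp: G_def)
    qed
  qed
  have inner: "(LBINT x. u t x * g (t, x)) = (LBINT a. u0 a * G t a)" for t
  proof (cases "0 \<le> t")
    case True
    have [measurable]: "X t \<in> borel_measurable borel" "u t \<in> borel_measurable borel" using X_measurable[OF True] u_measurable by auto
    have [measurable]: "(\<lambda>x. g (t, x)) \<in> borel_measurable borel"
      by (intro borel_measurable_continuous_onI continuous_on_compose2[OF gc]) (auto intro!: continuous_intros)
    have "(LBINT x. u t x * g (t, x)) = integral\<^sup>L (density lborel (\<lambda>x. ennreal (u t x))) (\<lambda>x. g (t, x))"
      using u_density by (subst integral_density) auto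
    also have "\<dots> = integral\<^sup>L (density lborel (\<lambda>x. ennreal (u0 x))) (\<lambda>a. g (t, X t a))"
      unfolding u_facts(1)[OF True] by (subst integral_distr) auto
    also have "\<dots> = (LBINT a. u0 a * g (t, X t a))"
      using u0 by (subst integral_density) auto
    finally show ?thesis using True by (simp add: G_def)
  next
    case False
    then have "g (t, x) = 0" for x using g0[of t x] T0 by auto
    then show ?thesis by (simp add: G_def)
  qed
  have zero: "(LBINT t. u0 a * G t a) = 0" for a
  proof -
    define T1 where "T1 = \<bar>T\<bar> + 1"
    have T1: "0 \<le> T1" "T < T1" by (auto simp: T1_def)
    have "(LBINT t. G t a) = (LBINT t. indicator {0..T1} t *\<^sub>R G t a)"
    proof (rule Bochner_Integration.integral_cong[OF refl])
      fix t :: real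
      show "G t a = indicator {0..T1} t *\<^sub>R G t a"
        using g0[of t "X (max 0 t) a"] T0 T1 by (cases "0 \<le> t \<and> t \<le> T1") (auto simp: indicator_def G_def)
    qed
    also have "\<dots> = \<phi> (T1, X T1 a) - \<phi> (0, X 0 a)"
    proof (rule integral_FTC_atLeastAtMost[OF T1(1)])
      show "continuous_on {0..T1} (\<lambda>t. G t a)"
      proof -
        have "continuous_on {0..T1} (\<lambda>t. (\<lambda>(t, a). G t a) (t, a))"
          by (rule continuous_on_compose2[OF Gc]) (auto intro!: continuous_intros)
        then show ?thesis by simp
      qed
      fix t assume t: "0 \<le> t" "t \<le> T1"
      have X1: "((\<lambda>t. X t a) has_derivative (\<lambda>h. h * v t (X t a))) (at t within {0..T1})"
        using has_field_derivative_subset[OF X_deriv'[OF t(1), of a], of "{0..T1}"]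
        by (auto simp: has_field_derivative_def mult.commute[of _ "v t (X t a)"])
      have "((\<lambda>t. \<phi> (t, X t a)) has_derivative (\<lambda>h. fst (h, h * v t (X t a)) * f1 (t, X t a) + snd (h, h * v t (X t a)) * f2 (t, X t a))) (at t within {0..T1})"
        by (rule has_derivative_compose[where f="\<lambda>t. (t, X t a)" and f'="\<lambda>h. (h, h * v t (X t a))", OF _ d]) (auto intro!: derivative_eq_intros X1)
      then show "((\<lambda>t. \<phi> (t, X t a)) has_vector_derivative G t a) (at t within {0..T1})"
        unfolding has_vector_derivative_def
        by (rule has_derivative_eq_rhs) (use t in \<open>auto simp: G_def g_def algebra_simps\<close>)
    qed
    also have "\<dots> = 0" using z[of T1 "X T1 a"] z[of 0 "X 0 a"] T0 T1 by auto
    finally show ?thesis by simp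
  qed
  have "(\<integral>(t, x). u t x * deriv (\<lambda>s. \<phi> (s, x)) t + u t x * V (space_convolution u k t x) * deriv (\<lambda>y. \<phi> (t, y)) x \<partial>(lborel :: (real \<times> real) measure))
    = integral\<^sup>L (lborel \<Otimes>\<^sub>M lborel) (\<lambda>p. u (fst p) (snd p) * g p)"
    unfolding I lborel_prod by (rule Bochner_Integration.integral_cong) auto
  also have "\<dots> = (LBINT t. LBINT x. u t x * g (t, x))"
    using lborel_pair.integral_fst'[OF int1] by simp
  also have "\<dots> = (LBINT t. LBINT a. u0 a * G t a)" unfolding inner ..
  also have "\<dots> = (LBINT a. LBINT t. u0 a * G t a)"
    using int2 by (intro lborel_pair.Fubini_integral[symmetric]) (simp add: case_prod_beta')
  also have "\<dots> = 0" unfolding zero by simp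
  finally show "(\<integral>(t, x). u t x * deriv (\<lambda>s. \<phi> (s, x)) t + u t x * V (space_convolution u k t x) * deriv (\<lambda>y. \<phi> (t, y)) x \<partial>(lborel :: (real \<times> real) measure)) = 0" .
qed

end

context flow_solution begin

lemma quotient_range:
  assumes "0 \<le> t" shows "0 \<le> quotient t n x" "quotient t n x \<le> 1"
  using potential_mono[OF P_potential[OF assms], of x "x + 1 / 2 ^ n"] 
    potential_lip[OF P_potential[OF assms], of x "x + 1 / 2 ^ n"]
  by (auto simp: quotient_def field_simps)

lemma quotient_measurable:
  assumes "0 \<le> t" shows "quotient t n \<in> borel_measurable borel"
proof -
  have [measurable]: "P t \<in> borel_measurable borel" by (rule potential_measurable[OF P_potential[OF assms]])
  show ?thesis unfolding quotient_def by measurable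
qed

lemma quotient_lipschitz:
  assumes "0 \<le> t" shows "\<bar>quotient t n x - quotient t n y\<bar> \<le> 2 * 2 ^ n * \<bar>x - y\<bar>"
proof -
  have "quotient t n x - quotient t n y = 2 ^ n * ((P t (x + 1 / 2 ^ n) - P t (y + 1 / 2 ^ n)) - (P t x - P t y))"
    by (simp add: quotient_def algebra_simps)
  then have "\<bar>quotient t n x - quotient t n y\<bar> = 2 ^ n * \<bar>(P t (x + 1 / 2 ^ n) - P t (y + 1 / 2 ^ n)) - (P t x - P t y)\<bar>"
    by (simp add: abs_mult)
  also have "\<dots> \<le> 2 ^ n * (2 * \<bar>x - y\<bar>)"
  proof (rule mult_left_mono)
    have "\<bar>P t (x + 1 / 2 ^ n) - P t (y + 1 / 2 ^ n)\<bar> \<le> \<bar>x - y\<bar>"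
      using potential_abs[OF P_potential[OF assms], of "x + 1 / 2 ^ n" "y + 1 / 2 ^ n"] by simp
    moreover have "\<bar>P t x - P t y\<bar> \<le> \<bar>x - y\<bar>" by (rule potential_abs[OF P_potential[OF assms]])
    ultimately show "\<bar>(P t (x + 1 / 2 ^ n) - P t (y + 1 / 2 ^ n)) - (P t x - P t y)\<bar> \<le> 2 * \<bar>x - y\<bar>"
      using abs_triangle_ineq4[of "P t (x + 1 / 2 ^ n) - P t (y + 1 / 2 ^ n)" "P t x - P t y"] by simp
  qed simp
  finally show ?thesis by simp
qed

text \<open>Mass travels with the flow, and between the times \<open>t\<close> and \<open>s\<close> lengths change by a factor of at most \<open>exp (k 0 * \<bar>s - t\<bar>)\<close>. Hence so do the
  averages of the density on corresponding intervals. The bound is uniform in the length of the interval, so it passes to the density itself.\<close>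

lemma quotient_transport:
  assumes t: "0 \<le> t" and s: "0 \<le> s"
  shows "\<bar>quotient s n (X s a) - quotient t n (X t a)\<bar> \<le> exp (k 0 * \<bar>s - t\<bar>) - 1"
proof -
  define c where "c = exp (k 0 * \<bar>s - t\<bar>)"
  have c: "1 \<le> c" using K by (simp add: c_def)
  define h :: real where "h = 1 / 2 ^ n"
  have h: "0 < h" by (simp add: h_def)
  define b where "b = Y s (X s a + h)"
  have b: "X s b = X s a + h" by (simp add: b_def X_Y[OF s])
  have ab: "a \<le> b" using X_less_iff[OF s, of b a] b h by (auto simp: not_less[symmetric])
  define h' where "h' = X t b - X t a"
  have h': "h' \<le> c * h" "h \<le> c * h'"
    using X_expand_abs[OF s t ab] X_expand_abs[OF t s ab] b by (auto simp: h'_def c_def abs_minus_commute)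
  have "h' - h \<le> (c - 1) * h" using h' by (simp add: algebra_simps)
  moreover have "h - h' \<le> (c - 1) * h"
  proof (cases "h' \<le> h")
    case True
    have "h - h' \<le> (c - 1) * h'" using h' by (simp add: algebra_simps)
    also have "\<dots> \<le> (c - 1) * h" using c True by (intro mult_left_mono) auto
    finally show ?thesis .
  next
    case False
    have "0 \<le> (c - 1) * h" using c h by auto
    then show ?thesis using False by linarith
  qed
  ultimately have hh: "\<bar>h' - h\<bar> \<le> (c - 1) * h" by (simp add: abs_le_iff)
  have "P s (X s a + h) - P s (X s a) = P t (X t a + h') - P t (X t a)"
    using P_X[OF s, of a] P_X[OF s, of b] P_X[OF t, of a] P_X[OF t, of b] b by (simp add: h'_def)
  then have "quotient s n (X s a) - quotient t n (X t a) = 2 ^ n * (P t (X t a + h') - P t (X t a + h))"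
    unfolding quotient_def h_def[symmetric] by (simp add: right_diff_distrib)
  then have "\<bar>quotient s n (X s a) - quotient t n (X t a)\<bar> = 2 ^ n * \<bar>P t (X t a + h') - P t (X t a + h)\<bar>"
    by (simp add: abs_mult)
  also have "\<dots> \<le> 2 ^ n * ((c - 1) * h)"
    using potential_abs[OF P_potential[OF t], of "X t a + h'" "X t a + h"] hh by (intro mult_left_mono) auto
  also have "\<dots> = c - 1" by (simp add: h_def)
  finally show ?thesis by (simp add: c_def)
qed

definition residue_L1 :: "real \<Rightarrow> real \<Rightarrow> nat \<Rightarrow> real" where
  "residue_L1 t R n = (LBINT x:{-R..R}. \<bar>u t x - quotient t n x\<bar>)"

lemma residue_bound:
  assumes "0 \<le> t" shows "\<bar>u t x - quotient t n x\<bar> \<le> 1"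
  using quotient_range[OF assms, of n x] density_fnD(1,2)[OF u_density[of t], of x] by (simp add: abs_le_iff)

lemma residue_tendsto:
  assumes t: "0 \<le> t" shows "residue_L1 t R \<longlonglongrightarrow> 0"
proof -
  have [measurable]: "quotient t n \<in> borel_measurable borel" "u t \<in> borel_measurable borel" for n
    using quotient_measurable[OF t] u_measurable by auto
  have "(\<lambda>n. LBINT x. indicator {-R..R} x *\<^sub>R \<bar>u t x - quotient t n x\<bar>) \<longlonglongrightarrow> (LBINT x::real. (0::real))"
  proof (rule integral_dominated_convergence[where w="indicator {-R..R}"])
    show "AE x in lborel. (\<lambda>n. indicator {-R..R} x *\<^sub>R \<bar>u t x - quotient t n x\<bar>) \<longlonglongrightarrow> 0"
      using u_facts(3)[OF t]
    proof eventually_elim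
      case (elim x)
      have "(\<lambda>n. indicator {-R..R} x *\<^sub>R \<bar>u t x - quotient t n x\<bar>) \<longlonglongrightarrow> indicator {-R..R} x *\<^sub>R \<bar>u t x - u t x\<bar>"
        by (intro tendsto_intros elim)
      then show ?case by simp
    qed
    show "AE x in lborel. norm (indicator {-R..R} x *\<^sub>R \<bar>u t x - quotient t n x\<bar>) \<le> indicator {-R..R} x" for n
      using residue_bound[OF t] by (auto simp: indicator_def)
  qed auto
  then show ?thesis unfolding residue_L1_def[abs_def] set_lebesgue_integral_def by simp
qed

text \<open>Between two times the solution is a transported copy of itself, up to a small factor in the values. A shift by a small distance is harmless for the averages
  \<open>quotient t n\<close>, which are Lipschitz, and the error of replacing the density by these averages is measured at the one time \<open>t\<close> only.\<close>

lemma u_L1_estimate: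
  assumes t: "0 \<le> t" and s: "0 \<le> s" and st: "\<bar>s - t\<bar> \<le> 1" and R: "0 < R"
  shows "(LBINT x:{-R..R}. \<bar>u s x - u t x\<bar>) \<le> 
     2 * R * (exp (k 0 * \<bar>s - t\<bar>) - 1 + 2 * 2 ^ n * \<bar>s - t\<bar>) + (exp (k 0 * \<bar>s - t\<bar>) + 1) * residue_L1 t (R + 1) n"
proof -
  define c where "c = exp (k 0 * \<bar>s - t\<bar>)"
  have c: "1 \<le> c" using K by (simp add: c_def)
  \<comment> \<open>\<open>Z\<close> leads from the position of a car at time \<open>s\<close> to its position at time \<open>t\<close>.\<close>
  define Z where "Z y = X t (Y s y)" for y
  define W where "W x = X s (Y t x)" for x
  have inv: "Z (W x) = x" "W (Z y) = y" for x y
    by (simp_all add: Z_def W_def X_Y Y_X s t)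
  have Wmono: "W a < W b" if "a < b" for a b
    using that by (simp add: W_def X_less_iff[OF s] Y_less_iff[OF t])
  have Wexp: "W b - W a \<le> c * (b - a)" if "a \<le> b" for a b
  proof -
    have "Y t a \<le> Y t b" using Y_less_iff[OF t, of b a] that by (auto simp: not_less[symmetric])
    from X_expand_abs[OF t s this] show ?thesis by (simp add: W_def c_def X_Y[OF t])
  qed
  have Zmono: "mono Z"
  proof (rule monoI)
    fix x y :: real assume "x \<le> y"
    then have "Y s x \<le> Y s y" using Y_less_iff[OF s, of y x] by (auto simp: not_less[symmetric])
    then show "Z x \<le> Z y" by (simp add: Z_def X_le_iff[OF t])
  qed
  have Zm[measurable]: "Z \<in> borel_measurable borel" by (rule borel_measurable_mono[OF Zmono])
  have Zclose: "\<bar>Z y - y\<bar> \<le> \<bar>s - t\<bar>" for y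
    using X_time_abs[OF s t, of "Y s y"] by (simp add: Z_def X_Y[OF s] abs_minus_commute)
  have expand: "(\<integral>\<^sup>+y. g (Z y) \<partial>lborel) \<le> ennreal c * (\<integral>\<^sup>+x. g x \<partial>lborel)" if "g \<in> borel_measurable borel" for g
    by (rule nn_integral_expanding[OF inv Wmono _ Wexp Zm that]) (use c in auto)
  have mq[measurable]: "quotient t n \<in> borel_measurable borel" "u t \<in> borel_measurable borel" "u s \<in> borel_measurable borel" for n
    using quotient_measurable[OF t] u_measurable by auto
  have AEZ: "AE y in lborel. (\<lambda>n. quotient t n (Z y)) \<longlonglongrightarrow> u t (Z y)"
  proof -
    obtain N where N: "\<And>x. x \<in> space lborel - N \<Longrightarrow> (\<lambda>n. quotient t n x) \<longlonglongrightarrow> u t x" "N \<in> null_sets lborel"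
      by (rule AE_E3[OF u_facts(3)[OF t]]) blast
    have [measurable]: "N \<in> sets borel" and N0: "emeasure lborel N = 0" using N(2) by auto
    have "(\<integral>\<^sup>+y. indicator N (Z y) \<partial>lborel) \<le> ennreal c * (\<integral>\<^sup>+x. indicator N x \<partial>lborel)"
      by (rule expand) measurable
    also have "\<dots> = 0" using N0 by simp
    finally have "(\<integral>\<^sup>+y. indicator N (Z y) \<partial>lborel) = 0" by simp
    moreover have "(\<lambda>y. indicator N (Z y) :: ennreal) \<in> borel_measurable lborel" by measurable
    ultimately have "AE y in lborel. indicator N (Z y) = (0::ennreal)"
      using nn_integral_0_iff_AE by blast
    then show ?thesis
    proof eventually_elim
      case (elim y)
      then have "Z y \<notin> N" by (simp add: indicator_eq_0_iff)
      then show ?case using N(1) by auto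
    qed
  qed
  have close: "AE y in lborel. \<bar>u s y - u t (Z y)\<bar> \<le> c - 1"
    using u_facts(3)[OF s] AEZ
  proof eventually_elim
    case (elim y)
    have "(\<lambda>n. \<bar>quotient s n y - quotient t n (Z y)\<bar>) \<longlonglongrightarrow> \<bar>u s y - u t (Z y)\<bar>"
      by (intro tendsto_intros elim)
    moreover have "\<bar>quotient s n y - quotient t n (Z y)\<bar> \<le> c - 1" for n
      using quotient_transport[OF t s, of n "Y s y"] by (simp add: Z_def c_def X_Y[OF s])
    ultimately show ?case by (intro LIMSEQ_le_const2) auto
  qed
  define e where "e x = \<bar>u t x - quotient t n x\<bar>" for x
  define g where "g x = ennreal (indicator {-(R+1)..R+1} x * e x)" for x
  have [measurable]: "e \<in> borel_measurable borel" unfolding e_def by measurable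
  have gm[measurable]: "g \<in> borel_measurable borel" unfolding g_def by measurable
  define A where "A = c - 1 + 2 * 2 ^ n * \<bar>s - t\<bar>"
  have A: "0 \<le> A" using c by (simp add: A_def)
  have Eint: "integrable lborel (\<lambda>x. indicator {-(R+1)..R+1} x * e x)"
    by (rule integrableI_bounded_set[where A="{-(R+1)..R+1}" and B=1])
      (use residue_bound[OF t] in \<open>auto simp: e_def indicator_def emeasure_lborel_Icc_eq\<close>)
  have E: "(\<integral>\<^sup>+x. g x \<partial>lborel) = ennreal (residue_L1 t (R + 1) n)"
    unfolding g_def residue_L1_def set_lebesgue_integral_def
    by (subst nn_integral_eq_integral[OF Eint]) (auto simp: e_def)
  have E0: "0 \<le> residue_L1 t (R + 1) n"
    unfolding residue_L1_def set_lebesgue_integral_def by (intro integral_nonneg_AE) auto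
  have Lint: "integrable lborel (\<lambda>x. indicator {-R..R} x * \<bar>u s x - u t x\<bar>)"
  proof (rule integrableI_bounded_set[where A="{-R..R}" and B=1])
    have "\<bar>u s x - u t x\<bar> \<le> 1" for x
      using density_fnD(1,2)[OF u_density[of t], of x] density_fnD(1,2)[OF u_density[of s], of x] by (simp add: abs_le_iff)
    then show "AE x in lborel. x \<in> {-R..R} \<longrightarrow> norm (indicator {-R..R} x * \<bar>u s x - u t x\<bar>) \<le> 1" by auto
  qed (auto simp: indicator_def emeasure_lborel_Icc_eq)
  have "ennreal (LBINT x:{-R..R}. \<bar>u s x - u t x\<bar>) = (\<integral>\<^sup>+y. ennreal (indicator {-R..R} y * \<bar>u s y - u t y\<bar>) \<partial>lborel)"
    unfolding set_lebesgue_integral_def by (subst nn_integral_eq_integral[OF Lint]) auto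
  also have "\<dots> \<le> (\<integral>\<^sup>+y. (ennreal (indicator {-R..R} y * A) + g (Z y)) + g y \<partial>lborel)"
  proof (rule nn_integral_mono_AE)
    show "AE y in lborel. ennreal (indicator {-R..R} y * \<bar>u s y - u t y\<bar>) \<le> (ennreal (indicator {-R..R} y * A) + g (Z y)) + g y"
      using close
    proof eventually_elim
      case (elim y)
      show ?case
      proof (cases "y \<in> {-R..R}")
        case True
        have Zy: "Z y \<in> {-(R+1)..R+1}" using Zclose[of y] st True by (auto simp: abs_le_iff)
        have "\<bar>quotient t n (Z y) - quotient t n y\<bar> \<le> 2 * 2 ^ n * \<bar>Z y - y\<bar>" by (rule quotient_lipschitz[OF t])
        also have "\<dots> \<le> 2 * 2 ^ n * \<bar>s - t\<bar>" using Zclose by (intro mult_left_mono) auto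
        finally have "\<bar>u s y - u t y\<bar> \<le> A + e (Z y) + e y"
          using elim unfolding A_def e_def by linarith
        then have "ennreal \<bar>u s y - u t y\<bar> \<le> ennreal (A + e (Z y) + e y)" by (rule ennreal_leI)
        also have "\<dots> = ennreal A + ennreal (e (Z y)) + ennreal (e y)"
          using A by (simp add: ennreal_plus e_def)
        finally show ?thesis using True Zy by (simp add: g_def)
      qed simp
    qed
  qed
  also have "\<dots> = (\<integral>\<^sup>+y. ennreal (indicator {-R..R} y * A) \<partial>lborel) + (\<integral>\<^sup>+y. g (Z y) \<partial>lborel) + (\<integral>\<^sup>+y. g y \<partial>lborel)"
    by (subst nn_integral_add, measurable, subst nn_integral_add, measurable)
  also have "(\<integral>\<^sup>+y. ennreal (indicator {-R..R} y * A) \<partial>lborel) = ennreal (2 * R * A)"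
    using A R by (subst nn_integral_eq_integral) auto
  also have "ennreal (2 * R * A) + (\<integral>\<^sup>+y. g (Z y) \<partial>lborel) + (\<integral>\<^sup>+y. g y \<partial>lborel) \<le> 
      ennreal (2 * R * A) + ennreal c * ennreal (residue_L1 t (R + 1) n) + ennreal (residue_L1 t (R + 1) n)"
    using expand[OF gm] unfolding E by (intro add_mono) auto
  also have "\<dots> = ennreal (2 * R * A + c * residue_L1 t (R + 1) n + residue_L1 t (R + 1) n)"
    using A R E0 c by (simp add: ennreal_mult ennreal_plus)
  finally have "(LBINT x:{-R..R}. \<bar>u s x - u t x\<bar>) \<le> 2 * R * A + c * residue_L1 t (R + 1) n + residue_L1 t (R + 1) n"
    using A R E0 c by (subst (asm) ennreal_le_iff) (auto intro!: add_nonneg_nonneg)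
  then show ?thesis by (simp add: A_def c_def algebra_simps)
qed

lemma u_continuous_L1: "continuous_in_L1_loc u"
  unfolding continuous_in_L1_loc_def
proof (intro allI impI)
  fix t R :: real assume t: "0 \<le> t" and R: "0 < R"
  let ?L = "\<lambda>s. LINT x:{-R..R}|lborel. \<bar>u s x - u t x\<bar>"
  have nn: "0 \<le> ?L s" for s
    unfolding set_lebesgue_integral_def by (intro integral_nonneg_AE) auto
  show "(?L \<longlongrightarrow> 0) (at t within {0..})"
  proof (rule tendstoI)
    fix e :: real assume e: "0 < e"
    have "\<forall>\<^sub>F n in sequentially. residue_L1 t (R + 1) n < e / 2"
      by (rule order_tendstoD(2)[OF residue_tendsto[OF t]]) (use e in simp)
    then obtain n where n: "residue_L1 t (R + 1) n < e / 2" by (auto simp: eventually_sequentially)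
    let ?B = "\<lambda>s. 2 * R * (exp (k 0 * \<bar>s - t\<bar>) - 1 + 2 * 2 ^ n * \<bar>s - t\<bar>) + (exp (k 0 * \<bar>s - t\<bar>) + 1) * residue_L1 t (R + 1) n"
    have "(?B \<longlongrightarrow> ?B t) (at t within {0..})" by (intro tendsto_intros)
    then have "\<forall>\<^sub>F s in at t within {0..}. ?B s < e"
      by (rule order_tendstoD(2)) (use n in simp)
    moreover have "\<forall>\<^sub>F s in at t within {0..}. dist s t < 1 \<and> s \<in> {0..}"
      by (auto simp: eventually_at intro!: exI[of _ 1])
    ultimately show "\<forall>\<^sub>F s in at t within {0..}. dist (?L s) 0 < e"
    proof eventually_elim
      case (elim s)
      have "?L s \<le> ?B s" by (rule u_L1_estimate[OF t _ _ R]) (use elim in \<open>auto simp: dist_real_def\<close>)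
      then show ?case using elim nn[of s] by simp
    qed
  qed
qed

theorem u_solution:
  assumes V: "\<And>r. V r = 1 - r" shows "cauchy_solution V k u0 u"
  unfolding cauchy_solution_def
proof (intro conjI)
  have "(\<lambda>(t, x). u t x) \<in> borel_measurable borel" by (rule u_measurable_plane)
  then show "set_borel_measurable borel ({0..} \<times> UNIV) (\<lambda>(t, x). u t x)"
    unfolding set_borel_measurable_def
    by (intro borel_measurable_scaleR borel_measurable_indicator) (auto intro!: borel_closed closed_Times)
  show "\<forall>t\<ge>0. AE x in lborel. 0 \<le> u t x \<and> u t x \<le> 1" using u_density by auto
qed (rule u_continuous_L1 u_weak[OF V] u_initial)+

end

theorem cauchy_solution_exists:
  assumes "monotone_kernel k" "density_fn u0" "\<And>r. V r = 1 - r"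
  shows "\<exists>u. cauchy_solution V k u0 u"
proof -
  interpret nonlocal_flow k u0 by unfold_locales fact+
  obtain X where "continuous_on ({0..} \<times> UNIV) (\<lambda>(t, a). X t a)" "\<And>a. X 0 a = a"
    "\<And>t. 0 \<le> t \<Longrightarrow> admissible (X t)"
    "\<And>t a. 0 \<le> t \<Longrightarrow> ((\<lambda>t. X t a) has_real_derivative 1 - lookahead k (label (X t)) (X t a)) (at t within {0..})"
    by (rule flow_exists) blast
  then interpret flow_solution k u0 X by unfold_locales
  show ?thesis using u_solution[OF assms(3)] by blast
qed

section \<open>Smooth steps as test functions\<close>

text \<open>This class of functions, flat at $0$, is closed under derivatives up to linear combinations; a single function $e^{-1/x}$ would not be.\<close>

definition flat :: "nat \<Rightarrow> real \<Rightarrow> real" where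
  "flat n x = (if 0 < x then (1 / x) ^ n * exp (- (1 / x)) else 0)"

lemma flat_limit: "((\<lambda>h. flat n h / h) \<longlongrightarrow> 0) (at 0)"
proof -
  have "((\<lambda>y::real. y ^ Suc n / exp y) \<longlongrightarrow> 0) at_top" by (rule tendsto_power_div_exp_0)
  then have "((\<lambda>h::real. inverse h ^ Suc n / exp (inverse h)) \<longlongrightarrow> 0) (at_right 0)"
    by (rule filterlim_compose) (rule filterlim_inverse_at_top_right)
  moreover have "\<forall>\<^sub>F h in at_right 0. inverse h ^ Suc n / exp (inverse h) = flat n h / h"
    by (auto simp: eventually_at_right_field flat_def exp_minus field_simps intro!: exI[of _ 1])
  ultimately have r: "((\<lambda>h. flat n h / h) \<longlongrightarrow> 0) (at_right 0)" by (rule Lim_transform_eventually)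
  have "\<forall>\<^sub>F h in at_left 0. 0 = flat n h / h"
    by (auto simp: eventually_at_left_field flat_def intro!: exI[of _ "-1"])
  then have l: "((\<lambda>h. flat n h / h) \<longlongrightarrow> 0) (at_left 0)" by (rule Lim_transform_eventually[OF tendsto_const])
  show ?thesis using l r by (simp add: filterlim_at_split)
qed

lemma flat_deriv: "(flat n has_real_derivative (flat (n + 2) x + (- real n) * flat (n + 1) x)) (at x)"
proof (cases "x = 0")
  case True
  have "(flat n has_real_derivative 0) (at 0)"
    unfolding DERIV_def using flat_limit[of n] by (simp add: flat_def[of _ 0])
  then show ?thesis using True by (simp add: flat_def)
next
  case False
  show ?thesis
  proof (cases "0 < x")
    case True
    have "((\<lambda>x. (1 / x) ^ n * exp (- (1 / x))) has_real_derivative 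
        (real n * (1 / x) ^ (n - 1) * (- 1 / x^2)) * exp (- (1 / x)) + (1 / x) ^ n * (exp (- (1 / x)) * (1 / x^2))) (at x)"
      using True by (auto intro!: derivative_eq_intros simp: power2_eq_square)
    moreover have "(real n * (1 / x) ^ (n - 1) * (- 1 / x^2)) * exp (- (1 / x)) + (1 / x) ^ n * (exp (- (1 / x)) * (1 / x^2))
        = flat (n + 2) x + (- real n) * flat (n + 1) x"
      using True by (cases n) (auto simp: flat_def power2_eq_square field_simps)
    ultimately have "((\<lambda>x. (1 / x) ^ n * exp (- (1 / x))) has_real_derivative (flat (n + 2) x + (- real n) * flat (n + 1) x)) (at x)"
      by simp
    then show ?thesis
      by (rule has_field_derivative_transform_within_open[where S= "{0<..}"]) (use True in \<open>auto simp: flat_def\<close>)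
  next
    case F: False
    have "((\<lambda>x::real. 0::real) has_real_derivative 0) (at x)" by simp
    then have "(flat n has_real_derivative 0) (at x)"
      by (rule has_field_derivative_transform_within_open[where S= "{..<0}"]) (use False F in \<open>auto simp: flat_def\<close>)
    then show ?thesis using F by (simp add: flat_def)
  qed
qed

text \<open>Enough closure properties for a smooth step, in a form for which the existence of a derivative in the same class is proved by rule induction. The coinductive
  notion for functions of two variables then follows for products.\<close>

inductive smooth_real :: "(real \<Rightarrow> real) \<Rightarrow> bool" where
  flat: "smooth_real (flat n)"
| const: "smooth_real (\<lambda>x. c)"
| add: "smooth_real f \<Longrightarrow> smooth_real g \<Longrightarrow> smooth_real (\<lambda>x. f x + g x)"
| mult: "smooth_real f \<Longrightarrow> smooth_real g \<Longrightarrow> smooth_real (\<lambda>x. f x * g x)"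
| affine: "smooth_real f \<Longrightarrow> smooth_real (\<lambda>x. f (c * x + d))"
| antiderivative: "(\<And>x. (F has_real_derivative f x) (at x)) \<Longrightarrow> smooth_real f \<Longrightarrow> smooth_real F"

lemma smooth_real_deriv:
  assumes "smooth_real f"
  shows "\<exists>f'. (\<forall>x. (f has_real_derivative f' x) (at x)) \<and> smooth_real f'"
  using assms
proof induction
  case (flat n)
  have "smooth_real (\<lambda>x. flat (n + 2) x + (- real n) * flat (n + 1) x)"
    by (rule smooth_real.add[OF smooth_real.flat smooth_real.mult[OF smooth_real.const smooth_real.flat]])
  then show ?case
    by (intro exI[of _ "\<lambda>x. flat (n + 2) x + (- real n) * flat (n + 1) x"] conjI allI flat_deriv)
next
  case (const c)
  show ?case by (intro exI[of _ "\<lambda>x. 0"] conjI smooth_real.const) auto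
next
  case (add f g)
  then obtain f' g' where "\<And>x. (f has_real_derivative f' x) (at x)" "smooth_real f'"
      "\<And>x. (g has_real_derivative g' x) (at x)" "smooth_real g'" by blast
  then show ?case by (intro exI[of _ "\<lambda>x. f' x + g' x"] conjI smooth_real.add allI DERIV_add) auto
next
  case (mult f g)
  then obtain f' g' where "\<And>x. (f has_real_derivative f' x) (at x)" "smooth_real f'"
      "\<And>x. (g has_real_derivative g' x) (at x)" "smooth_real g'" by blast
  then show ?case using mult.hyps
    by (intro exI[of _ "\<lambda>x. f' x * g x + g' x * f x"] conjI smooth_real.add smooth_real.mult allI DERIV_mult) auto
next
  case (affine f c d)
  then obtain f' where f': "\<And>x. (f has_real_derivative f' x) (at x)" "smooth_real f'" by blast
  have "((\<lambda>x. f (c * x + d)) has_real_derivative f' (c * x + d) * c) (at x)" for x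
    by (rule DERIV_chain2[OF f'(1)]) (auto intro!: derivative_eq_intros)
  moreover have "smooth_real (\<lambda>x. f' (c * x + d) * c)"
    by (rule smooth_real.mult[OF smooth_real.affine[OF f'(2)] smooth_real.const])
  ultimately show ?case by (intro exI[of _ "\<lambda>x. f' (c * x + d) * c"]) auto
qed blast

lemma smooth_plane_product:
  assumes "smooth_real f" "smooth_real g"
  shows "smooth_plane (\<lambda>p. f (fst p) * g (snd p))"
proof -
  define Q where "Q \<phi> \<longleftrightarrow> (\<exists>f g. smooth_real f \<and> smooth_real g \<and> \<phi> = (\<lambda>p. f (fst p) * g (snd p)))" for \<phi> :: "real \<times> real \<Rightarrow> real"
  have step: "\<exists>f f1 f2. \<phi> = f \<and> (\<forall>p. (f has_derivative (\<lambda>h. fst h * f1 p + snd h * f2 p)) (at p)) \<and>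
       (Q f1 \<or> smooth_plane f1) \<and> (Q f2 \<or> smooth_plane f2)" if Q: "Q \<phi>" for \<phi>
  proof -
    obtain f g where fg: "smooth_real f" "smooth_real g" and \<phi>: "\<phi> = (\<lambda>p. f (fst p) * g (snd p))"
      using Q by (auto simp: Q_def)
    obtain f' where f': "\<And>x. (f has_real_derivative f' x) (at x)" "smooth_real f'" using smooth_real_deriv[OF fg(1)] by blast
    obtain g' where g': "\<And>x. (g has_real_derivative g' x) (at x)" "smooth_real g'" using smooth_real_deriv[OF fg(2)] by blast
    have d1: "((\<lambda>p. f (fst p)) has_derivative (\<lambda>h. f' (fst p) * fst h)) (at p)" for p :: "real \<times> real"
    proof -
      have "(fst has_derivative fst) (at p)" by (auto intro!: derivative_eq_intros)
      from has_derivative_compose[OF this f'(1)[unfolded has_field_derivative_def]] show ?thesis .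
    qed
    have d2: "((\<lambda>p. g (snd p)) has_derivative (\<lambda>h. g' (snd p) * snd h)) (at p)" for p :: "real \<times> real"
    proof -
      have "(snd has_derivative snd) (at p)" by (auto intro!: derivative_eq_intros)
      from has_derivative_compose[OF this g'(1)[unfolded has_field_derivative_def]] show ?thesis .
    qed
    have "(\<phi> has_derivative (\<lambda>h. fst h * (f' (fst p) * g (snd p)) + snd h * (f (fst p) * g' (snd p)))) (at p)" for p
      unfolding \<phi> by (rule has_derivative_eq_rhs[OF has_derivative_mult[OF d1 d2]]) (auto simp: algebra_simps)
    moreover have "Q (\<lambda>p. f' (fst p) * g (snd p))" "Q (\<lambda>p. f (fst p) * g' (snd p))"
      using fg f' g' by (auto simp: Q_def)
    ultimately show ?thesis
      by (intro exI[of _ \<phi>] exI[of _ "\<lambda>p. f' (fst p) * g (snd p)"] exI[of _ "\<lambda>p. f (fst p) * g' (snd p)"]) auto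
  qed
  show ?thesis
    by (rule smooth_plane.coinduct[of Q, OF _ step]) (use assms in \<open>auto simp: Q_def\<close>)
qed

lemma primitive_deriv:
  assumes f: "density_fn f" and c: "continuous_on UNIV f"
  shows "(primitive f has_real_derivative f x) (at x)"
proof -
  have i: "set_integrable lborel {x..y} f" for x y 
    by (rule density_fn_integrable[OF f]) (auto simp: emeasure_lborel_Icc_eq)
  have e: "primitive f y = primitive f (x - 1) + integral {x - 1..y} f" if "x - 1 \<le> y" for y
    using set_borel_integral_eq_integral(2)[OF i] primitive_diff[OF f that] by simp
  have "((\<lambda>y. integral {x - 1..y} f) has_real_derivative f x) (at x within {x - 1..x + 1})"
    by (rule integral_has_real_derivative) (auto intro: continuous_on_subset[OF c])
  then have "((\<lambda>y. integral {x - 1..y} f) has_real_derivative f x) (at x)"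
    by (subst (asm) at_within_interior) auto
  then have "((\<lambda>y. primitive f (x - 1) + integral {x - 1..y} f) has_real_derivative f x) (at x)"
    by (auto intro!: derivative_eq_intros)
  then show ?thesis
    by (rule has_field_derivative_transform_within_open[where S="{x - 1<..}"]) (auto intro!: e[symmetric])
qed

definition bump :: "real \<Rightarrow> real" where "bump x = flat 0 x * flat 0 (1 - x)"

definition step :: "real \<Rightarrow> real" where "step x = primitive bump x / primitive bump 1"

definition step_deriv :: "real \<Rightarrow> real" where "step_deriv x = bump x / primitive bump 1"

lemma bump_smooth: "smooth_real bump"
proof -
  have "smooth_real (\<lambda>x. flat 0 x * flat 0 ((-1) * x + 1))" by (rule smooth_real.mult[OF smooth_real.flat smooth_real.affine[OF smooth_real.flat]])
  then show ?thesis by (simp add: bump_def[abs_def])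
qed

lemma smooth_real_continuous: "smooth_real f \<Longrightarrow> continuous_on S f"
  using smooth_real_deriv[of f] by (meson DERIV_continuous_on continuous_on_subset has_field_derivative_at_within subset_UNIV)

lemma bump_density: "density_fn bump"
proof -
  have "0 \<le> flat 0 x \<and> flat 0 x \<le> 1" for x by (simp add: flat_def)
  then have "0 \<le> bump x \<and> bump x \<le> 1" for x
    unfolding bump_def using mult_le_one by auto
  then show ?thesis unfolding density_fn_def
    using borel_measurable_continuous_onI[OF smooth_real_continuous[OF bump_smooth]] by auto
qed

lemma bump_deriv: "(primitive bump has_real_derivative bump x) (at x)"
  by (rule primitive_deriv[OF bump_density smooth_real_continuous[OF bump_smooth]])

lemma bump_zero: "x \<le> 0 \<or> 1 \<le> x \<Longrightarrow> bump x = 0"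
  by (auto simp: bump_def flat_def)

lemma bump_mass: "0 < primitive bump 1"
proof -
  have p: "primitive bump 0 = 0" by (simp add: primitive_def)
  have m: "primitive bump x \<le> primitive bump y" if "x \<le> y" for x y
    by (rule potential_mono[OF primitive_potential[OF bump_density] that])
  have "0 < bump (1/2)" by (simp add: bump_def flat_def)
  from DERIV_pos_inc_right[OF bump_deriv this] obtain d where
    d: "d > 0" "\<And>h. h > 0 \<Longrightarrow> h < d \<Longrightarrow> primitive bump (1/2) < primitive bump (1/2 + h)" by blast
  define h where "h = min (d/2) (1/2)"
  have "0 < h" "h < d" "h \<le> 1/2" using d by (auto simp: h_def)
  then show ?thesis using d(2)[of h] m[of 0 "1/2"] m[of "1/2 + h" 1] p by auto
qed

lemma step_has_deriv: "(step has_real_derivative step_deriv x) (at x)"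
  unfolding step_def[abs_def] step_deriv_def
  by (rule DERIV_cdivide[OF bump_deriv])

lemma step_mono: "x \<le> y \<Longrightarrow> step x \<le> step y"
  unfolding step_def by (intro divide_right_mono potential_mono[OF primitive_potential[OF bump_density]]) (use bump_mass in auto)

lemma step_const:
  shows "x \<le> 0 \<Longrightarrow> step x = 0" "1 \<le> x \<Longrightarrow> step x = 1"
proof -
  have *: "(LBINT z:{a..b}. bump z) = 0" if "b \<le> 0 \<or> 1 \<le> a" for a b
  proof -
    have "(LBINT z:{a..b}. bump z) = (LBINT z:{a..b}. (0::real))"
      by (rule set_lebesgue_integral_cong) (use that in \<open>auto intro!: bump_zero\<close>)
    then show ?thesis by simp
  qed
  show "step x = 0" if "x \<le> 0"
    using primitive_diff[OF bump_density that] *[of 0 x] that by (simp add: step_def primitive_def)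
  show "step x = 1" if "1 \<le> x"
    using primitive_diff[OF bump_density that] *[of x 1] that bump_mass by (simp add: step_def)
qed

lemma step_range: "0 \<le> step x" "step x \<le> 1"
  using step_mono[of "min x 0" x] step_mono[of x "max x 1"] step_const(1)[of "min x 0"] step_const(2)[of "max x 1"] by auto

lemma step_smooth: "smooth_real step" "smooth_real step_deriv"
proof -
  have "smooth_real (\<lambda>x. bump x * (1 / primitive bump 1))" by (rule smooth_real.mult[OF bump_smooth smooth_real.const])
  then show s: "smooth_real step_deriv" by (simp add: step_deriv_def[abs_def])
  show "smooth_real step" by (rule smooth_real.antiderivative[OF step_has_deriv s])
qed

lemma step_deriv_nonneg: "0 \<le> step_deriv x"
  using bump_mass density_fnD(1)[OF bump_density, of x] by (simp add: step_deriv_def)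

lemma step_deriv_bounded: "step_deriv x \<le> 1 / primitive bump 1"
  using bump_mass density_fnD(2)[OF bump_density, of x] by (simp add: step_deriv_def divide_right_mono)

lemma step_deriv_zero: "x \<le> 0 \<or> 1 \<le> x \<Longrightarrow> step_deriv x = 0"
  using bump_zero[of x] by (simp add: step_deriv_def)

text \<open>A smooth step that rises from $0$ at \<open>x\<close> to $1$ at \<open>x + d\<close>. The one-sided placement matters next to the jam: what lies to the right of \<open>x\<close> only sees points to the right of \<open>x\<close>.\<close>

definition ramp :: "real \<Rightarrow> real \<Rightarrow> real \<Rightarrow> real" where
  "ramp d x z = step ((z - x) / d)"

definition mollifier :: "real \<Rightarrow> real \<Rightarrow> real \<Rightarrow> real" where
  "mollifier d x z = step_deriv ((z - x) / d) / d"

lemma ramp_smooth: "smooth_real (ramp d x)"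
proof -
  have "smooth_real (\<lambda>z. step ((1/d) * z + (- x / d)))" by (rule smooth_real.affine[OF step_smooth(1)])
  then show ?thesis by (simp add: ramp_def[abs_def] diff_divide_distrib)
qed

lemma mollifier_smooth: "smooth_real (mollifier d x)"
proof -
  have "smooth_real (\<lambda>z. step_deriv ((1/d) * z + (- x / d)) * (1/d))" by (rule smooth_real.mult[OF smooth_real.affine[OF step_smooth(2)] smooth_real.const])
  then show ?thesis by (simp add: mollifier_def[abs_def] diff_divide_distrib)
qed

lemma ramp_deriv: "d > 0 \<Longrightarrow> (ramp d x has_real_derivative mollifier d x z) (at z)"
proof -
  assume "d > 0"
  then have "((\<lambda>z. (z - x) / d) has_real_derivative 1 / d) (at z)"
    by (auto intro!: derivative_eq_intros)
  from DERIV_chain2[OF step_has_deriv this] show ?thesis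
    by (simp add: ramp_def[abs_def] mollifier_def)
qed

lemma ramp_deriv_base: "d > 0 \<Longrightarrow> ((\<lambda>x. ramp d x z) has_real_derivative - mollifier d x z) (at x)"
proof -
  assume "d > 0"
  then have "((\<lambda>x. (z - x) / d) has_real_derivative - 1 / d) (at x)"
    by (auto intro!: derivative_eq_intros)
  from DERIV_chain2[OF step_has_deriv this] show ?thesis
    by (simp add: ramp_def[abs_def] mollifier_def)
qed

lemma ramp_range: "0 \<le> ramp d x z" "ramp d x z \<le> 1"
  by (auto simp: ramp_def step_range)

lemma ramp_left: "d > 0 \<Longrightarrow> z \<le> x \<Longrightarrow> ramp d x z = 0"
  by (auto simp: ramp_def intro!: step_const divide_nonpos_pos)

lemma ramp_right: "d > 0 \<Longrightarrow> x + d \<le> z \<Longrightarrow> ramp d x z = 1"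
  by (auto simp: ramp_def intro!: step_const)

lemma ramp_mono: "d > 0 \<Longrightarrow> x \<le> y \<Longrightarrow> ramp d y z \<le> ramp d x z"
  by (auto simp: ramp_def intro!: step_mono divide_right_mono)

lemma mollifier_nonneg: "d > 0 \<Longrightarrow> 0 \<le> mollifier d x z"
  by (simp add: mollifier_def step_deriv_nonneg)

lemma mollifier_bounded: "d > 0 \<Longrightarrow> mollifier d x z \<le> 1 / primitive bump 1 / d"
  unfolding mollifier_def by (intro divide_right_mono step_deriv_bounded) auto

lemma mollifier_zero: "d > 0 \<Longrightarrow> z \<le> x \<or> x + d \<le> z \<Longrightarrow> mollifier d x z = 0"
  unfolding mollifier_def by (subst step_deriv_zero) (auto simp: divide_nonpos_pos)

lemma mollifier_continuous: "d > 0 \<Longrightarrow> continuous_on S (\<lambda>z. mollifier d x z)"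
  by (rule smooth_real_continuous[OF mollifier_smooth])

lemma mollifier_measurable[measurable]: "mollifier d x \<in> borel_measurable borel"
  by (rule borel_measurable_continuous_onI[OF smooth_real_continuous[OF mollifier_smooth]])

lemma ramp_measurable[measurable]: "ramp d x \<in> borel_measurable borel"
  by (rule borel_measurable_continuous_onI[OF smooth_real_continuous[OF ramp_smooth]])

lemma mollifier_integrable: "d > 0 \<Longrightarrow> integrable lborel (mollifier d x)"
proof (rule integrableI_bounded_set[where A="{x..x+d}" and B="1 / primitive bump 1 / d"])
  assume d: "d > 0"
  show "AE z in lborel. z \<in> {x..x + d} \<longrightarrow> norm (mollifier d x z) \<le> 1 / primitive bump 1 / d"
    using mollifier_nonneg[OF d, of x] mollifier_bounded[OF d, of x] by (intro AE_I2) simp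
  show "AE z in lborel. z \<notin> {x..x + d} \<longrightarrow> mollifier d x z = 0"
    using mollifier_zero[OF d, of _ x] by (intro AE_I2) auto
qed (auto simp: emeasure_lborel_Icc_eq)

lemma mollifier_integral: assumes d: "d > 0" shows "(LBINT z. mollifier d x z) = 1"
proof -
  have "(LBINT z. mollifier d x z) = (LBINT z. indicator {x..x+d} z *\<^sub>R mollifier d x z)"
    by (rule Bochner_Integration.integral_cong) (use d in \<open>auto simp: indicator_def intro!: mollifier_zero\<close>)
  also have "\<dots> = ramp d x (x + d) - ramp d x x"
    by (rule integral_FTC_atLeastAtMost)
      (use d in \<open>auto intro!: mollifier_continuous has_field_derivative_at_within ramp_deriv
         simp: has_real_derivative_iff_has_vector_derivative[symmetric]\<close>)
  finally show ?thesis using d by (simp add: ramp_left ramp_right)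
qed

lemma product_test_function:
  assumes "d > 0" "e > 0" "0 < s1" "0 < s2"
  shows "test_function (\<lambda>p. (ramp e s1 (fst p) - ramp e s2 (fst p)) * (ramp d a (snd p) - ramp d b (snd p)))"
proof -
  have s: "smooth_real (\<lambda>z. ramp d x z - ramp d y z)" for d x y
  proof -
    have "smooth_real (\<lambda>z. ramp d x z + (-1) * ramp d y z)" by (rule smooth_real.add[OF ramp_smooth smooth_real.mult[OF smooth_real.const ramp_smooth]])
    then show ?thesis by simp
  qed
  have z: "ramp d x z - ramp d y z = 0" if "d > 0" "z \<notin> {min x y..max x y + d}" for d x y z
  proof (cases "z < min x y")
    case True then show ?thesis using ramp_left[OF that(1), of z x] ramp_left[OF that(1), of z y] by auto
  next
    case False
    then have "z > max x y + d" using that by auto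
    then show ?thesis using ramp_right[OF that(1), of x z] ramp_right[OF that(1), of y z] by auto
  qed
  let ?\<phi> = "\<lambda>p. (ramp e s1 (fst p) - ramp e s2 (fst p)) * (ramp d a (snd p) - ramp d b (snd p))"
  let ?S = "{min s1 s2..max s1 s2 + e} \<times> {min a b..max a b + d}"
  have sub: "closure {p. ?\<phi> p \<noteq> 0} \<subseteq> ?S"
  proof (rule closure_minimal)
    show "{p. ?\<phi> p \<noteq> 0} \<subseteq> ?S"
    proof
      fix p assume "p \<in> {p. ?\<phi> p \<noteq> 0}"
      then have "ramp e s1 (fst p) - ramp e s2 (fst p) \<noteq> 0" "ramp d a (snd p) - ramp d b (snd p) \<noteq> 0" by auto
      then show "p \<in> ?S" using z[OF assms(2), of "fst p" s1 s2] z[OF assms(1), of "snd p" a b] by (metis mem_Times_iff)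
    qed
  qed (intro closed_Times closed_atLeastAtMost)
  have "compact ?S" by (intro compact_Times) auto
  then have "compact (closure {p. ?\<phi> p \<noteq> 0})"
    using compact_Int_closed[OF \<open>compact ?S\<close> closed_closure[of "{p. ?\<phi> p \<noteq> 0}"]] Int_absorb1[OF sub] by simp
  moreover have "closure {p. ?\<phi> p \<noteq> 0} \<subseteq> {0<..} \<times> UNIV"
    by (rule subset_trans[OF sub]) (use assms in auto)
  ultimately show ?thesis unfolding test_function_def 
    by (intro conjI smooth_plane_product[OF s s])
qed

section \<open>Weak solutions and the flux through a point\<close>

lemma ramp_diff_zero: 
  assumes d: "d > 0" and z: "\<not> (min x y \<le> z \<and> z \<le> max x y + d)"
  shows "ramp d x z - ramp d y z = 0 \<and> mollifier d x z - mollifier d y z = 0"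
proof (cases "z < min x y")
  case True
  then have "z \<le> x" "z \<le> y" by auto
  then show ?thesis using ramp_left[OF d] mollifier_zero[OF d] by auto
next
  case False
  then have "x + d \<le> z" "y + d \<le> z" using z by auto
  then show ?thesis using ramp_right[OF d] mollifier_zero[OF d] by simp
qed

lemma ramp_diff_zero_abs: 
  assumes d: "d > 0" and z: "\<bar>x\<bar> + \<bar>y\<bar> + d < \<bar>z\<bar>"
  shows "ramp d x z - ramp d y z = 0" "mollifier d x z - mollifier d y z = 0"
proof -
  have "\<not> (min x y \<le> z \<and> z \<le> max x y + d)" using z d by auto
  from ramp_diff_zero[OF d this] show "ramp d x z - ramp d y z = 0" "mollifier d x z - mollifier d y z = 0" by auto
qed

text \<open>A curve of densities that is continuous in time with values in local $L^1$, with the velocity field that it generates.\<close>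

locale L1_curve =
  fixes k :: "real \<Rightarrow> real" and U :: "real \<Rightarrow> real \<Rightarrow> real"
  assumes k: "monotone_kernel k" 
    and U_plane: "(\<lambda>(t, x). U t x) \<in> borel_measurable borel"
    and U_range: "\<And>t x. 0 \<le> U t x" "\<And>t x. U t x \<le> 1"
    and U_L1: "continuous_in_L1_loc U"
begin

lemma U_measurable[measurable]: "U t \<in> borel_measurable borel"
  using measurable_compose[OF borel_measurable_continuous_onI U_plane, of "\<lambda>x. (t, x)"]
  by (simp add: continuous_intros)

lemma U_density: "density_fn (U t)"
  by (simp add: density_fn_def U_range U_measurable)

abbreviation P :: "real \<Rightarrow> real \<Rightarrow> real" where "P t \<equiv> primitive (U t)"

lemma P_potential: "potential (P t)" by (rule primitive_potential[OF U_density])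

definition v :: "real \<Rightarrow> real \<Rightarrow> real" where "v t x = 1 - lookahead k (P t) x"

lemma convolution_U: "space_convolution U k t x = 1 - v t x"
  unfolding space_convolution_def v_def using convolution_eq_lookahead[OF k U_density] by simp

lemma v_range: "0 \<le> v t x" "v t x \<le> 1"
  using lookahead_nonneg[OF k P_potential] lookahead_le_1[OF k P_potential] by (auto simp: v_def)

lemma v_lipschitz: "\<bar>v t x - v t y\<bar> \<le> k 0 * \<bar>x - y\<bar>"
  using lookahead_lipschitz[OF k P_potential, of t x y] by (auto simp: v_def abs_minus_commute)

lemma U_diff_integrable: "set_integrable lborel {-R..R} (\<lambda>x. \<bar>U s x - U t x\<bar>)"
  unfolding set_integrable_def
proof (rule integrableI_bounded_set[where A="{-R..R}" and B=1])
  have "\<bar>U s x - U t x\<bar> \<le> 1" for x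
    using U_range[of s x] U_range[of t x] by (simp add: abs_le_iff)
  then show "AE x in lborel. x \<in> {-R..R} \<longrightarrow> norm (indicator {-R..R} x *\<^sub>R \<bar>U s x - U t x\<bar>) \<le> 1" by auto
qed (auto simp: indicator_def emeasure_lborel_Icc_eq)

text \<open>Joint continuity of the pairing with bounded test functions of uniformly compact support, needed because the test functions move along with curves in the road.\<close>

lemma pairing_tendsto:
  fixes \<tau> :: "nat \<Rightarrow> real" and q :: "nat \<Rightarrow> real \<Rightarrow> real"
  assumes t: "0 \<le> t" "\<And>n. 0 \<le> \<tau> n" "\<tau> \<longlonglongrightarrow> t"
    and q[measurable]: "\<And>n. q n \<in> borel_measurable borel"
    and C: "\<And>n z. \<bar>q n z\<bar> \<le> C" and supp: "\<And>n z. R < \<bar>z\<bar> \<Longrightarrow> q n z = 0"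
    and lim: "\<And>z. (\<lambda>n. q n z) \<longlonglongrightarrow> q' z"
  shows "(\<lambda>n. LBINT z. U (\<tau> n) z * q n z) \<longlonglongrightarrow> (LBINT z. U t z * q' z)"
proof -
  have C0: "0 \<le> C" using C[of 0 0] by linarith
  define S where "S = max R 1"
  have S: "0 < S" by (simp add: S_def)
  have supp': "q n z = 0" if "S < \<bar>z\<bar>" for n z using supp that by (simp add: S_def)
  have q'C: "\<bar>q' z\<bar> \<le> C" for z
    by (rule LIMSEQ_le_const2[OF tendsto_rabs[OF lim]]) (use C in auto)
  have q'm[measurable]: "q' \<in> borel_measurable borel"
    by (rule borel_measurable_LIMSEQ_real[OF lim q])
  have int: "integrable lborel (\<lambda>z. U s z * q n z)" for s n
  proof (rule integrableI_bounded_set[where A="{-S..S}" and B=C])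
    show "AE z in lborel. z \<in> {-S..S} \<longrightarrow> norm (U s z * q n z) \<le> C"
      using mult_mono[OF U_range(2) C] U_range by (auto simp: abs_mult)
    show "AE z in lborel. z \<notin> {-S..S} \<longrightarrow> U s z * q n z = 0"
    proof (rule AE_I2, rule impI)
      fix z assume "z \<notin> {-S..S}"
      then have "S < \<bar>z\<bar>" by auto
      then show "U s z * q n z = 0" by (simp add: supp')
    qed
  qed (auto simp: emeasure_lborel_Icc_eq)
  have fixed: "(\<lambda>n. LBINT z. U t z * q n z) \<longlonglongrightarrow> (LBINT z. U t z * q' z)"
  proof (rule integral_dominated_convergence[where w="\<lambda>z. indicator {-S..S} z * C"])
    show "AE z in lborel. (\<lambda>n. U t z * q n z) \<longlonglongrightarrow> U t z * q' z" by (intro AE_I2 tendsto_intros lim)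
    show "AE z in lborel. norm (U t z * q n z) \<le> indicator {-S..S} z * C" for n
    proof (rule AE_I2)
      fix z
      show "norm (U t z * q n z) \<le> indicator {-S..S} z * C"
      proof (cases "z \<in> {-S..S}")
        case True then show ?thesis using mult_mono[OF U_range(2)[of t z] C[of n z]] U_range[of t z] by (auto simp: abs_mult)
      next
        case False
        then have "S < \<bar>z\<bar>" by auto
        then show ?thesis using C0 by (simp add: supp')
      qed
    qed
  qed auto
  let ?D = "\<lambda>s. LINT x:{-S..S}|lborel. \<bar>U s x - U t x\<bar>"
  have moving: "(\<lambda>n. (LBINT z. U (\<tau> n) z * q n z) - (LBINT z. U t z * q n z)) \<longlonglongrightarrow> 0"
  proof (rule Lim_null_comparison[OF always_eventually, rotated])
    have "(?D \<longlongrightarrow> 0) (at t within {0..})" using U_L1 S t(1) unfolding continuous_in_L1_loc_def by blast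
    moreover have "?D t = 0" by (simp add: set_lebesgue_integral_def)
    ultimately have "continuous (at t within {0..}) ?D" by (simp add: continuous_within)
    then have "(\<lambda>n. ?D (\<tau> n)) \<longlonglongrightarrow> ?D t"
      using continuous_within_tendsto_compose'[of t "{0..}" ?D \<tau>] t by auto
    then have "(\<lambda>n. C * ?D (\<tau> n)) \<longlonglongrightarrow> C * ?D t" by (intro tendsto_intros)
    then show "(\<lambda>n. C * ?D (\<tau> n)) \<longlonglongrightarrow> 0" using \<open>?D t = 0\<close> by simp
    show "\<forall>n. norm ((LBINT z. U (\<tau> n) z * q n z) - (LBINT z. U t z * q n z)) \<le> C * ?D (\<tau> n)"
    proof
      fix n
      have "(LBINT z. U (\<tau> n) z * q n z) - (LBINT z. U t z * q n z) = (LBINT z. U (\<tau> n) z * q n z - U t z * q n z)"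
        by (rule Bochner_Integration.integral_diff[OF int int, symmetric])
      also have "norm \<dots> \<le> (LBINT z. C * (indicator {-S..S} z *\<^sub>R \<bar>U (\<tau> n) z - U t z\<bar>))"
      proof (rule Bochner_Integration.integral_norm_bound_integral)
        show "integrable lborel (\<lambda>z. U (\<tau> n) z * q n z - U t z * q n z)" by (intro Bochner_Integration.integrable_diff int)
        show "integrable lborel (\<lambda>z. C * (indicator {-S..S} z *\<^sub>R \<bar>U (\<tau> n) z - U t z\<bar>))"
          using U_diff_integrable[of S "\<tau> n" t] unfolding set_integrable_def by (rule integrable_mult_right)
        fix z
        show "norm (U (\<tau> n) z * q n z - U t z * q n z) \<le> C * (indicator {-S..S} z *\<^sub>R \<bar>U (\<tau> n) z - U t z\<bar>)"
        proof (cases "z \<in> {-S..S}")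
          case True
          have "\<bar>U (\<tau> n) z * q n z - U t z * q n z\<bar> = \<bar>q n z\<bar> * \<bar>U (\<tau> n) z - U t z\<bar>"
            by (simp add: left_diff_distrib[symmetric] abs_mult)
          also have "\<dots> \<le> C * \<bar>U (\<tau> n) z - U t z\<bar>" by (intro mult_right_mono C) auto
          finally show ?thesis using True by simp
        next
          case False
          then have "S < \<bar>z\<bar>" by auto
          then show ?thesis using False by (simp add: supp')
        qed
      qed
      also have "\<dots> = C * ?D (\<tau> n)" by (simp add: set_lebesgue_integral_def)
      finally show "norm ((LBINT z. U (\<tau> n) z * q n z) - (LBINT z. U t z * q n z)) \<le> C * ?D (\<tau> n)" .
    qed
  qed
  from tendsto_add[OF moving fixed] show ?thesis by simp
qed

lemma P_cont: "continuous_on ({0..} \<times> UNIV) (\<lambda>(t, x). P t x)"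
proof (rule continuous_on_halfplane)
  fix \<tau> \<xi> :: "nat \<Rightarrow> real" and t x :: real assume tn: "\<And>n::nat. 0 \<le> \<tau> n" and t: "0 \<le> t" and tt: "\<tau> \<longlonglongrightarrow> t" "\<xi> \<longlonglongrightarrow> x"
  have I: "(\<lambda>n. LBINT z. U (\<tau> n) z * indicator {a..b} z) \<longlonglongrightarrow> (LBINT z. U t z * indicator {a..b} z)" for a b :: real
    by (rule pairing_tendsto[OF t tn tt(1), where C=1 and R="max \<bar>a\<bar> \<bar>b\<bar>"]) (auto simp: indicator_def)
  have Pt: "P s x = (LBINT z. U s z * indicator {0..x} z) - (LBINT z. U s z * indicator {x..0} z)" for s
    by (simp add: primitive_def set_lebesgue_integral_def mult.commute)
  have lim: "(\<lambda>n. P (\<tau> n) x) \<longlonglongrightarrow> P t x"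
    unfolding Pt by (intro tendsto_diff I)
  have "(\<lambda>n. \<bar>\<xi> n - x\<bar>) \<longlonglongrightarrow> \<bar>x - x\<bar>" by (intro tendsto_intros tt)
  then have "(\<lambda>n. \<bar>\<xi> n - x\<bar>) \<longlonglongrightarrow> 0" by simp
  then have "(\<lambda>n. P (\<tau> n) (\<xi> n) - P (\<tau> n) x) \<longlonglongrightarrow> 0"
    by (rule Lim_null_comparison[OF always_eventually, rotated]) 
      (simp only: real_norm_def potential_abs[OF P_potential] simp_thms)
  from tendsto_add[OF this lim]
  show "(\<lambda>n. P (\<tau> n) (\<xi> n)) \<longlonglongrightarrow> P t x" by simp
qed

lemma v_cont: "continuous_on ({0..} \<times> UNIV) (\<lambda>(t, x). v t x)"
  using lookahead_continuous[OF k P_cont P_potential] unfolding v_def case_prod_beta by (intro continuous_intros)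

lemma v_measurable[measurable]: "v t \<in> borel_measurable borel"
proof (rule borel_measurable_continuous_onI)
  have "(k 0)-lipschitz_on UNIV (v t)"
    using v_lipschitz monotone_kernel_pos[OF k] by (intro lipschitz_onI) (auto simp: dist_real_def)
  then show "continuous_on UNIV (v t)" by (rule lipschitz_on_continuous_on)
qed

lemma v_tendsto:
  assumes "0 \<le> t" "\<And>n. 0 \<le> \<tau> n" "\<tau> \<longlonglongrightarrow> t" shows "(\<lambda>n. v (\<tau> n) z) \<longlonglongrightarrow> v t z"
  by (rule halfplane_tendsto[OF v_cont assms(2,1,3)])

lemma pairing_continuous:
  assumes q[measurable]: "q \<in> borel_measurable borel" and C: "\<And>z. \<bar>q z\<bar> \<le> C" and supp: "\<And>z. R < \<bar>z\<bar> \<Longrightarrow> q z = 0"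
  shows "continuous_on {0..} (\<lambda>t. LBINT z. U t z * q z)"
    "continuous_on {0..} (\<lambda>t. LBINT z. U t z * (v t z * q z))"
proof -
  have C0: "0 \<le> C" using C[of 0] by linarith
  show "continuous_on {0..} (\<lambda>t. LBINT z. U t z * q z)"
    by (rule continuous_on_sequentiallyI, rule pairing_tendsto[where C=C and R=R]) (use C supp in auto)
  show "continuous_on {0..} (\<lambda>t. LBINT z. U t z * (v t z * q z))"
  proof (rule continuous_on_sequentiallyI)
    fix \<tau> :: "nat \<Rightarrow> real" and t assume *: "\<forall>n. \<tau> n \<in> {0..}" "t \<in> {0..}" "\<tau> \<longlonglongrightarrow> t"
    show "(\<lambda>n. LBINT z. U (\<tau> n) z * (v (\<tau> n) z * q z)) \<longlonglongrightarrow> (LBINT z. U t z * (v t z * q z))"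
    proof (rule pairing_tendsto[where C=C and R=R])
      show "\<bar>v (\<tau> n) z * q z\<bar> \<le> C" for n z
        using mult_mono[OF v_range(2)[of "\<tau> n" z] C[of z]] v_range(1)[of "\<tau> n" z] by (simp add: abs_mult)
      show "(\<lambda>n. v (\<tau> n) z * q z) \<longlonglongrightarrow> v t z * q z" for z
        by (intro tendsto_intros v_tendsto) (use * in auto)
    qed (use * supp in auto)
  qed
qed

end

lemma mollifier_tendsto:
  fixes E :: "real \<Rightarrow> real"
  assumes E: "continuous_on {0..} E" and s: "0 \<le> s"
  shows "((\<lambda>d. LBINT t. E t * mollifier d s t) \<longlongrightarrow> E s) (at_right 0)"
proof (rule tendstoI)
  fix e :: real assume e: "0 < e"
  from E s e obtain d0 where d0: "d0 > 0" "\<And>t. t \<in> {0..} \<Longrightarrow> dist t s < d0 \<Longrightarrow> dist (E t) (E s) < e / 2"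
    unfolding continuous_on_iff by (metis atLeast_iff half_gt_zero)
  show "\<forall>\<^sub>F d in at_right 0. dist (LBINT t. E t * mollifier d s t) (E s) < e"
    unfolding eventually_at_right_field
  proof (intro exI[of _ d0] conjI allI impI)
    fix d :: real assume d: "0 < d" "d < d0"
    have close: "\<bar>E t - E s\<bar> \<le> e / 2" if "t \<in> {s..s+d}" for t
      using d0(2)[of t] that s d by (auto simp: dist_real_def)
    have m: "integrable lborel (mollifier d s)" by (rule mollifier_integrable[OF d(1)])
    have Eb: "integrable lborel (\<lambda>t. (E t - E s) * mollifier d s t)"
    proof (rule Bochner_Integration.integrable_bound[OF integrable_mult_right[OF m, of "e/2"]])
      have "(\<lambda>t. indicator {0..} t *\<^sub>R E t) \<in> borel_measurable borel"
        by (rule borel_measurable_continuous_on_indicator[OF _ E]) auto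
      then have "(\<lambda>t. (indicator {0..} t *\<^sub>R E t - E s) * mollifier d s t) \<in> borel_measurable lborel" by measurable
      also have "(\<lambda>t. (indicator {0..} t *\<^sub>R E t - E s) * mollifier d s t) = (\<lambda>t. (E t - E s) * mollifier d s t)"
      proof
        fix t show "(indicator {0..} t *\<^sub>R E t - E s) * mollifier d s t = (E t - E s) * mollifier d s t"
          using mollifier_zero[OF d(1), of t s] s by (cases "0 \<le> t") auto
      qed
      finally show "(\<lambda>t. (E t - E s) * mollifier d s t) \<in> borel_measurable lborel" .
      show "AE t in lborel. norm ((E t - E s) * mollifier d s t) \<le> norm (e / 2 * mollifier d s t)"
      proof (rule AE_I2)
        fix t
        show "norm ((E t - E s) * mollifier d s t) \<le> norm (e / 2 * mollifier d s t)"
        proof (cases "t \<in> {s..s+d}")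
          case True then show ?thesis using mult_right_mono[OF close[OF True], of "\<bar>mollifier d s t\<bar>"] e by (simp add: abs_mult)
        next
          case False then show ?thesis using mollifier_zero[OF d(1), of t s] by auto
        qed
      qed
    qed
    have "(LBINT t. E t * mollifier d s t) = (LBINT t. (E t - E s) * mollifier d s t + E s * mollifier d s t)"
      by (simp add: algebra_simps)
    also have "\<dots> = (LBINT t. (E t - E s) * mollifier d s t) + E s"
      using mollifier_integral[OF d(1), of s] m Eb by (subst Bochner_Integration.integral_add) auto
    finally have "(LBINT t. E t * mollifier d s t) - E s = (LBINT t. (E t - E s) * mollifier d s t)" by simp
    also have "\<bar>\<dots>\<bar> \<le> (LBINT t. (e/2) * mollifier d s t)"
      unfolding real_norm_def[symmetric]
    proof (rule Bochner_Integration.integral_norm_bound_integral[OF Eb])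
      show "integrable lborel (\<lambda>t. e / 2 * mollifier d s t)" using m by simp
      fix t
      show "norm ((E t - E s) * mollifier d s t) \<le> e / 2 * mollifier d s t"
      proof (cases "t \<in> {s..s+d}")
        case True then show ?thesis using mult_right_mono[OF close[OF True], of "\<bar>mollifier d s t\<bar>"] mollifier_nonneg[OF d(1), of s t] by (simp add: abs_mult)
      next
        case False then show ?thesis using mollifier_zero[OF d(1), of t s] by auto
      qed
    qed
    also have "\<dots> = e / 2" using mollifier_integral[OF d(1), of s] by simp
    finally show "dist (LBINT t. E t * mollifier d s t) (E s) < e" using e by (simp add: dist_real_def)
  qed (use d0 in auto)
qed

locale weak_solution = L1_curve +
  assumes weak: "distributional_solution (\<lambda>r. 1 - r) k U"
begin

lemma product_weak:
  assumes d: "d > 0" and e: "e > 0" and s: "0 < s1" "0 < s2"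
  shows "(LBINT t. (mollifier e s1 t - mollifier e s2 t) * (LBINT z. U t z * (ramp d a z - ramp d b z)) +
     (ramp e s1 t - ramp e s2 t) * (LBINT z. U t z * (v t z * (mollifier d a z - mollifier d b z)))) = 0"
proof -
  define \<theta> where "\<theta> t = ramp e s1 t - ramp e s2 t" for t
  define \<theta>' where "\<theta>' t = mollifier e s1 t - mollifier e s2 t" for t
  define \<psi> where "\<psi> z = ramp d a z - ramp d b z" for z
  define \<psi>' where "\<psi>' z = mollifier d a z - mollifier d b z" for z
  define w where "w t x = v (max 0 t) x" for t x
  have dchi: "(\<theta> has_real_derivative \<theta>' t) (at t)" for t
    unfolding \<theta>_def[abs_def] \<theta>'_def by (intro DERIV_diff ramp_deriv e)
  have dpsi: "(\<psi> has_real_derivative \<psi>' z) (at z)" for z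
    unfolding \<psi>_def[abs_def] \<psi>'_def by (intro DERIV_diff ramp_deriv d)
  have chi0: "\<theta> t = 0 \<and> \<theta>' t = 0" if "\<not> (min s1 s2 \<le> t \<and> t \<le> max s1 s2 + e)" for t
    using ramp_diff_zero[OF e that] by (simp add: \<theta>_def \<theta>'_def)
  have psi0: "\<psi> z = 0 \<and> \<psi>' z = 0" if "\<not> (min a b \<le> z \<and> z \<le> max a b + d)" for z
    using ramp_diff_zero[OF d that] by (simp add: \<psi>_def \<psi>'_def)
  have [measurable]: "\<theta> \<in> borel_measurable borel" "\<theta>' \<in> borel_measurable borel" "\<psi> \<in> borel_measurable borel" "\<psi>' \<in> borel_measurable borel"
    unfolding \<theta>_def[abs_def] \<theta>'_def[abs_def] \<psi>_def[abs_def] \<psi>'_def[abs_def] by measurable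
  have wc: "continuous_on UNIV (\<lambda>p. w (fst p) (snd p))"
    unfolding w_def by (rule continuous_on_extend_halfplane[OF v_cont])
  have [measurable]: "(\<lambda>p. w (fst p) (snd p)) \<in> borel_measurable borel" by (rule borel_measurable_continuous_onI[OF wc])
  have [measurable]: "(\<lambda>p. U (fst p) (snd p)) \<in> borel_measurable borel" using U_plane by (simp add: case_prod_beta')
  define f where "f p = U (fst p) (snd p) * (\<theta>' (fst p) * \<psi> (snd p) + \<theta> (fst p) * (w (fst p) (snd p) * \<psi>' (snd p)))" for p
  have mfst: "(\<lambda>p::real\<times>real. g (fst p)) \<in> borel_measurable borel" "(\<lambda>p::real\<times>real. g (snd p)) \<in> borel_measurable borel" 
    if [measurable]: "g \<in> borel_measurable borel" for g :: "real \<Rightarrow> real"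
    by (auto intro!: measurable_compose[OF borel_measurable_continuous_onI that] continuous_intros)
  have fm: "f \<in> borel_measurable borel"
    unfolding f_def[abs_def] by (intro borel_measurable_times borel_measurable_add mfst) measurable
  obtain B where B: "B \<ge> 0" "\<And>t. \<bar>\<theta>' t\<bar> \<le> B" "\<And>z. \<bar>\<psi>' z\<bar> \<le> B"
  proof -
    have *: "\<bar>mollifier e x t - mollifier e y t\<bar> \<le> 1 / primitive bump 1 / e" if "e > 0" for e x y t
      using mollifier_nonneg[OF that, of x t] mollifier_nonneg[OF that, of y t] mollifier_bounded[OF that, of x t] mollifier_bounded[OF that, of y t]
      by (simp add: abs_le_iff)
    show ?thesis
      by (rule that[of "max (1 / primitive bump 1 / e) (1 / primitive bump 1 / d)"])
        (use *[OF e, of s1 _ s2] *[OF d, of a _ b] bump_mass e in \<open>auto simp: \<theta>'_def \<psi>'_def le_max_iff_disj\<close>)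
  qed
  have chi1: "\<bar>\<theta> t\<bar> \<le> 1" for t
    using ramp_range[of e s1 t] ramp_range[of e s2 t] by (simp add: \<theta>_def abs_le_iff)
  have psi1: "\<bar>\<psi> t\<bar> \<le> 1" for t
    using ramp_range[of d a t] ramp_range[of d b t] by (simp add: \<psi>_def abs_le_iff)
  have fB: "\<bar>f p\<bar> \<le> 2 * B" for p
  proof -
    have 1: "\<bar>\<theta>' (fst p)\<bar> * \<bar>\<psi> (snd p)\<bar> \<le> B * 1" by (intro mult_mono B psi1) (use B in auto)
    have 2: "\<bar>\<theta> (fst p)\<bar> * (\<bar>w (fst p) (snd p)\<bar> * \<bar>\<psi>' (snd p)\<bar>) \<le> 1 * (1 * B)"
      by (intro mult_mono B chi1) (use B v_range in \<open>auto simp: w_def\<close>)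
    have "\<bar>f p\<bar> \<le> 1 * (\<bar>\<theta>' (fst p)\<bar> * \<bar>\<psi> (snd p)\<bar> + \<bar>\<theta> (fst p)\<bar> * (\<bar>w (fst p) (snd p)\<bar> * \<bar>\<psi>' (snd p)\<bar>))"
      unfolding f_def abs_mult 
      by (intro mult_mono) (use U_range in \<open>auto simp: abs_mult[symmetric]\<close>)
    then show ?thesis using 1 2 by simp
  qed
  have fint: "integrable (lborel \<Otimes>\<^sub>M lborel) f"
  proof (rule integrable_compact_support_plane[OF fm fB, where T="max s1 s2 + e" and R="\<bar>a\<bar> + \<bar>b\<bar> + d"])
    fix t x assume *: "\<not> (\<bar>t\<bar> \<le> max s1 s2 + e \<and> \<bar>x\<bar> \<le> \<bar>a\<bar> + \<bar>b\<bar> + d)"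
    show "f (t, x) = 0"
    proof (cases "min s1 s2 \<le> t \<and> t \<le> max s1 s2 + e")
      case True
      then have "\<bar>t\<bar> \<le> max s1 s2 + e" using s by auto
      then have "\<not> (min a b \<le> x \<and> x \<le> max a b + d)" using * d by auto
      then show ?thesis using psi0 by (simp add: f_def)
    next
      case False then show ?thesis using chi0 by (simp add: f_def)
    qed
  qed
  have I: "U t x * deriv (\<lambda>s. (\<lambda>p. \<theta> (fst p) * \<psi> (snd p)) (s, x)) t + U t x * (\<lambda>r. 1 - r) (space_convolution U k t x) * deriv (\<lambda>y. (\<lambda>p. \<theta> (fst p) * \<psi> (snd p)) (t, y)) x = f (t, x)" for t x
  proof -
    have "((\<lambda>s. \<theta> s * \<psi> x) has_real_derivative \<theta>' t * \<psi> x) (at t)" by (rule DERIV_cmult_right[OF dchi])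
    then have 1: "deriv (\<lambda>s. \<theta> s * \<psi> x) t = \<theta>' t * \<psi> x" by (rule DERIV_imp_deriv)
    have "((\<lambda>y. \<theta> t * \<psi> y) has_real_derivative \<theta> t * \<psi>' x) (at x)" by (rule DERIV_cmult[OF dpsi])
    then have 2: "deriv (\<lambda>y. \<theta> t * \<psi> y) x = \<theta> t * \<psi>' x" by (rule DERIV_imp_deriv)
    show ?thesis
    proof (cases "0 \<le> t")
      case True
      then show ?thesis unfolding fst_conv snd_conv 1 2 convolution_U by (simp add: f_def w_def algebra_simps)
    next
      case False
      then have "\<not> (min s1 s2 \<le> t \<and> t \<le> max s1 s2 + e)" using s by auto
      then have "\<theta> t = 0" "\<theta>' t = 0" using chi0[of t] by auto
      then show ?thesis unfolding fst_conv snd_conv 1 2 by (simp add: f_def)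
    qed
  qed
  have "0 = (\<integral>(t, x). U t x * deriv (\<lambda>s. (\<lambda>p. \<theta> (fst p) * \<psi> (snd p)) (s, x)) t + U t x * (\<lambda>r. 1 - r) (space_convolution U k t x) * deriv (\<lambda>y. (\<lambda>p. \<theta> (fst p) * \<psi> (snd p)) (t, y)) x \<partial>(lborel :: (real \<times> real) measure))"
    using weak product_test_function[OF d e s, of a b] unfolding distributional_solution_def \<theta>_def \<psi>_def by (auto simp only:)
  also have "\<dots> = integral\<^sup>L (lborel \<Otimes>\<^sub>M lborel) f"
    unfolding I lborel_prod by (rule Bochner_Integration.integral_cong) auto
  also have "\<dots> = (LBINT t. LBINT x. f (t, x))"
    using lborel_pair.integral_fst'[OF fint] by simp
  also have "\<dots> = (LBINT t. \<theta>' t * (LBINT z. U t z * \<psi> z) + \<theta> t * (LBINT z. U t z * (v t z * \<psi>' z)))"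
  proof (rule Bochner_Integration.integral_cong[OF refl])
    fix t
    have bs: "integrable lborel (\<lambda>z. U t z * q z)" if [measurable]: "q \<in> borel_measurable borel" 
      and "\<And>z. \<bar>q z\<bar> \<le> C" "\<And>z. \<not> (min a b \<le> z \<and> z \<le> max a b + d) \<Longrightarrow> q z = 0" for q C
    proof (rule integrableI_bounded_set[where A="{min a b..max a b + d}" and B=C])
      show "AE z in lborel. z \<in> {min a b..max a b + d} \<longrightarrow> norm (U t z * q z) \<le> C"
        using mult_mono[OF U_range(2) that(2)] U_range by (auto simp: abs_mult)
      show "AE z in lborel. z \<notin> {min a b..max a b + d} \<longrightarrow> U t z * q z = 0" using that(3) by auto
    qed (auto simp: emeasure_lborel_Icc_eq)
    have i1: "integrable lborel (\<lambda>z. U t z * \<psi> z)" by (rule bs[where C=1]) (use psi1 psi0 in auto)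
    have i2: "integrable lborel (\<lambda>z. U t z * (v t z * \<psi>' z))"
    proof (rule bs[where C=B])
      show "\<bar>v t z * \<psi>' z\<bar> \<le> B" for z
        using mult_mono[OF v_range(2)[of t z] B(3)[of z]] v_range(1)[of t z] by (simp add: abs_mult)
    qed (use psi0 in auto)
    show "(LBINT x. f (t, x)) = \<theta>' t * (LBINT z. U t z * \<psi> z) + \<theta> t * (LBINT z. U t z * (v t z * \<psi>' z))"
    proof (cases "0 \<le> t")
      case True
      have "(LBINT x. f (t, x)) = (LBINT z. \<theta>' t * (U t z * \<psi> z) + \<theta> t * (U t z * (v t z * \<psi>' z)))"
        using True by (intro Bochner_Integration.integral_cong) (auto simp: f_def w_def algebra_simps)
      also have "\<dots> = \<theta>' t * (LBINT z. U t z * \<psi> z) + \<theta> t * (LBINT z. U t z * (v t z * \<psi>' z))"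
        using i1 i2 by (subst Bochner_Integration.integral_add) auto
      finally show ?thesis .
    next
      case False
      then have "\<not> (min s1 s2 \<le> t \<and> t \<le> max s1 s2 + e)" using s by auto
      then have "\<theta> t = 0" "\<theta>' t = 0" using chi0[of t] by auto
      then show ?thesis by (simp add: f_def)
    qed
  qed
  finally show ?thesis unfolding \<theta>_def \<theta>'_def \<psi>_def \<psi>'_def by simp
qed

lemma mollifier_diff_bounded: 
  assumes "d > 0" shows "\<bar>mollifier d a z - mollifier d b z\<bar> \<le> 1 / primitive bump 1 / d"
  using mollifier_nonneg[OF assms, of a z] mollifier_nonneg[OF assms, of b z] mollifier_bounded[OF assms, of a z] mollifier_bounded[OF assms, of b z]
  by (simp add: abs_le_iff)

lemma flux_continuous:
  assumes d: "d > 0"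
  shows "continuous_on {0..} (\<lambda>t. LBINT z. U t z * (v t z * (mollifier d a z - mollifier d b z)))"
  by (rule pairing_continuous(2)[where C="1 / primitive bump 1 / d" and R="\<bar>a\<bar> + \<bar>b\<bar> + d"])
    (simp_all only: ramp_diff_zero_abs[OF d] mollifier_diff_bounded[OF d] borel_measurable_diff mollifier_measurable)

lemma ramp_pairing_continuous:
  assumes d: "d > 0"
  shows "continuous_on {0..} (\<lambda>t. LBINT z. U t z * (ramp d a z - ramp d b z))"
proof (rule pairing_continuous(1)[where C=1 and R="\<bar>a\<bar> + \<bar>b\<bar> + d"])
  show "\<bar>ramp d a z - ramp d b z\<bar> \<le> 1" for z
    using ramp_range[of d a z] ramp_range[of d b z] by (simp add: abs_le_iff)
qed (simp_all add: ramp_diff_zero_abs[OF d])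

text \<open>By \<open>product_weak\<close> the derivative in time of \<open>F\<close> is \<open>G\<close> in the sense of distributions. As both are continuous, the difference \<open>E\<close> of \<open>F\<close> and a primitive of \<open>G\<close>
  has the same smoothed values everywhere, and so it is constant.\<close>

theorem flux_identity:
  assumes d: "d > 0" and t: "0 \<le> t"
  shows "(LBINT z. U t z * (ramp d a z - ramp d b z)) = (LBINT z. U 0 z * (ramp d a z - ramp d b z)) +
    integral {0..t} (\<lambda>s. LBINT z. U s z * (v s z * (mollifier d a z - mollifier d b z)))"
proof -
  define F where "F t = (LBINT z. U t z * (ramp d a z - ramp d b z))" for t
  define G where "G t = (LBINT z. U t z * (v t z * (mollifier d a z - mollifier d b z)))" for t
  define H where "H t = integral {0..t} G" for t
  have Fc: "continuous_on {0..} F" unfolding F_def by (rule ramp_pairing_continuous[OF d])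
  have Gc: "continuous_on {0..} G" unfolding G_def by (rule flux_continuous[OF d])
  have Hd: "(H has_real_derivative G t) (at t within {0..})" if "0 \<le> t" for t
    unfolding H_def[abs_def] by (rule integral_upto_has_derivative[OF Gc that])
  have Hc: "continuous_on {0..} H" by (rule DERIV_continuous_on[OF Hd]) auto
  define E where "E t = F t - H t" for t
  have Ec: "continuous_on {0..} E" unfolding E_def by (intro continuous_on_diff Fc Hc)
  have bal: "(LBINT t. E t * mollifier e s1 t) = (LBINT t. E t * mollifier e s2 t)" if e: "0 < e" and s: "0 < s1" "0 < s2" for e s1 s2
  proof -
    define T where "T = max s1 s2 + e"
    have T: "0 \<le> T" using s e by (auto simp: T_def)
    have out: "mollifier e s1 t - mollifier e s2 t = 0 \<and> ramp e s1 t - ramp e s2 t = 0" if "\<not> (0 \<le> t \<and> t \<le> T)" for t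
      using ramp_diff_zero[OF e, of s1 s2 t] that s by (auto simp: T_def)
    have supp: "indicator {0..T} t *\<^sub>R (E t * mollifier e s t) = E t * mollifier e s t" if "s = s1 \<or> s = s2" for s t
    proof (cases "t \<in> {0..T}")
      case False
      then have "t \<le> s \<or> s + e \<le> t" using that s \<open>s1 > 0\<close> by (auto simp: T_def)
      then show ?thesis using mollifier_zero[OF e, of t s] by auto
    qed simp
    have int: "integrable lborel (\<lambda>t. indicator {0..T} t *\<^sub>R q t)" if "continuous_on {0..} q" for q :: "real \<Rightarrow> real"
      using borel_integrable_atLeastAtMost'[of 0 T q] continuous_on_subset[OF that, of "{0..T}"] by (auto simp: set_integrable_def)
    define m where "m t = mollifier e s1 t - mollifier e s2 t" for t
    define r where "r t = ramp e s1 t - ramp e s2 t" for t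
    have mc: "continuous_on {0..} m" unfolding m_def by (intro continuous_on_diff mollifier_continuous e)
    have rd: "(r has_real_derivative m t) (at t)" for t
      unfolding r_def[abs_def] m_def by (intro DERIV_diff ramp_deriv e)
    have rc: "continuous_on {0..} r" by (rule DERIV_continuous_on[where D=m]) (auto intro: has_field_derivative_at_within rd)
    have "0 = (LBINT t. m t * F t + r t * G t)"
      using product_weak[OF d e s, of a b] by (simp add: m_def r_def F_def G_def)
    also have "\<dots> = (LBINT t. indicator {0..T} t *\<^sub>R (m t * F t) + indicator {0..T} t *\<^sub>R (r t * G t))"
      by (rule Bochner_Integration.integral_cong) (use out in \<open>auto simp: indicator_def m_def r_def\<close>)
    also have "\<dots> = (LBINT t. indicator {0..T} t *\<^sub>R (m t * E t) + indicator {0..T} t *\<^sub>R (m t * H t + r t * G t))"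
      by (rule Bochner_Integration.integral_cong) (auto simp: indicator_def E_def algebra_simps)
    also have "\<dots> = (LBINT t. indicator {0..T} t *\<^sub>R (m t * E t)) + (LBINT t. indicator {0..T} t *\<^sub>R (m t * H t + r t * G t))"
      by (rule Bochner_Integration.integral_add; rule int; intro continuous_intros mc rc Ec Hc Gc)
    also have "(LBINT t. indicator {0..T} t *\<^sub>R (m t * H t + r t * G t)) = r T * H T - r 0 * H 0"
    proof (rule integral_FTC_atLeastAtMost[OF T])
      fix t assume "0 \<le> t" "t \<le> T"
      then have "((\<lambda>t. r t * H t) has_real_derivative m t * H t + G t * r t) (at t within {0..T})"
        by (intro DERIV_mult has_field_derivative_at_within[OF rd] has_field_derivative_subset[OF Hd]) auto
      then show "((\<lambda>t. r t * H t) has_vector_derivative m t * H t + r t * G t) (at t within {0..T})"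
        by (simp add: has_real_derivative_iff_has_vector_derivative[symmetric] mult.commute[of "G t"])
    next
      show "continuous_on {0..T} (\<lambda>t. m t * H t + r t * G t)"
        by (rule continuous_on_subset[of "{0..}"]) (auto intro!: continuous_intros mc rc Hc Gc)
    qed
    also have "r T = 0" using e s by (simp add: r_def T_def ramp_right)
    also have "r 0 = 0" using e s by (simp add: r_def ramp_left)
    also have "(LBINT t. indicator {0..T} t *\<^sub>R (m t * E t)) = 
      (LBINT t. indicator {0..T} t *\<^sub>R (E t * mollifier e s1 t) - indicator {0..T} t *\<^sub>R (E t * mollifier e s2 t))"
      by (rule Bochner_Integration.integral_cong) (auto simp: m_def algebra_simps)
    also have "\<dots> = (LBINT t. indicator {0..T} t *\<^sub>R (E t * mollifier e s1 t)) - (LBINT t. indicator {0..T} t *\<^sub>R (E t * mollifier e s2 t))"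
      by (rule Bochner_Integration.integral_diff; rule int; intro continuous_intros Ec mollifier_continuous e)
    also have "(LBINT t. indicator {0..T} t *\<^sub>R (E t * mollifier e s1 t)) = (LBINT t. E t * mollifier e s1 t)"
      by (simp only: supp simp_thms)
    also have "(LBINT t. indicator {0..T} t *\<^sub>R (E t * mollifier e s2 t)) = (LBINT t. E t * mollifier e s2 t)"
      by (simp only: supp simp_thms)
    finally show ?thesis by simp
  qed
  have const: "E s1 = E s2" if s: "0 < s1" "0 < s2" for s1 s2
  proof (rule tendsto_unique)
    show "((\<lambda>e. LBINT t. E t * mollifier e s1 t) \<longlongrightarrow> E s1) (at_right 0)"
      by (rule mollifier_tendsto[OF Ec]) (use s in auto)
    have "((\<lambda>e. LBINT t. E t * mollifier e s2 t) \<longlongrightarrow> E s2) (at_right 0)"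
      by (rule mollifier_tendsto[OF Ec]) (use s in auto)
    moreover have "\<forall>\<^sub>F e in at_right 0. (LBINT t. E t * mollifier e s2 t) = (LBINT t. E t * mollifier e s1 t)"
      using eventually_at_right_less[of "0::real"] by eventually_elim (rule bal[OF _ s(2) s(1)])
    ultimately show "((\<lambda>e. LBINT t. E t * mollifier e s1 t) \<longlongrightarrow> E s2) (at_right 0)"
      by (rule Lim_transform_eventually)
  qed auto
  have "E t = E 0"
  proof (cases "t = 0")
    case False
    then have t': "0 < t" using t by simp
    have lim: "(\<lambda>n. 1 / real (Suc n)) \<longlonglongrightarrow> 0" by (rule LIMSEQ_Suc[OF lim_1_over_n])
    have "(\<lambda>n. E (1 / real (Suc n))) \<longlonglongrightarrow> E 0"
      by (rule continuous_on_tendsto_compose[OF Ec lim]) auto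
    moreover have "E (1 / real (Suc n)) = E t" for n by (rule const) (use t' in auto)
    ultimately have "(\<lambda>n::nat. E t) \<longlonglongrightarrow> E 0" by (simp only:)
    then show ?thesis by (simp only: LIMSEQ_const_iff)
  qed simp
  then show ?thesis by (simp add: E_def F_def H_def G_def[abs_def])
qed

end

section \<open>The jam never moves\<close>

locale jam_solution = weak_solution +
  assumes jam: "AE x in lborel. 0 \<le> x \<longrightarrow> U 0 x = 1"
begin

lemma K: "0 < k 0" by (rule monotone_kernel_pos[OF k])

lemma pairing_indicator:
  assumes "a \<le> b" shows "(LBINT z. U t z * indicator {a..b} z) = P t b - P t a" "integrable lborel (\<lambda>z. U t z * indicator {a..b} z)"
proof -
  show "(LBINT z. U t z * indicator {a..b} z) = P t b - P t a"
    using primitive_diff[OF U_density[of t] assms] by (simp add: set_lebesgue_integral_def mult.commute)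
  have "set_integrable lborel {a..b} (U t)" by (rule density_fn_integrable[OF U_density]) (auto simp: emeasure_lborel_Icc_eq)
  then show "integrable lborel (\<lambda>z. U t z * indicator {a..b} z)" by (simp add: set_integrable_def mult.commute)
qed

lemma pairing_integrable:
  assumes [measurable]: "q \<in> borel_measurable borel" and C: "\<And>z. \<bar>q z\<bar> \<le> C" and supp: "\<And>z. R < \<bar>z\<bar> \<Longrightarrow> q z = 0"
  shows "integrable lborel (\<lambda>z. U t z * q z)"
proof (rule integrableI_bounded_set[where A="{-R..R}" and B=C])
  show "AE z in lborel. z \<in> {-R..R} \<longrightarrow> norm (U t z * q z) \<le> C"
    using mult_mono[OF U_range(2) C] U_range by (auto simp: abs_mult)
  show "AE z in lborel. z \<notin> {-R..R} \<longrightarrow> U t z * q z = 0"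
  proof (rule AE_I2, rule impI)
    fix z assume "z \<notin> {-R..R}"
    then have "R < \<bar>z\<bar>" by auto
    then show "U t z * q z = 0" by (simp add: supp)
  qed
qed (auto simp: emeasure_lborel_Icc_eq)

lemma ramp_pairing_integrable:
  assumes d: "0 < d" shows "integrable lborel (\<lambda>z. U t z * (ramp d a z - ramp d b z))"
proof (rule pairing_integrable[where C=1 and R="\<bar>a\<bar> + \<bar>b\<bar> + d"])
  show "\<bar>ramp d a z - ramp d b z\<bar> \<le> 1" for z
    using ramp_range[of d a z] ramp_range[of d b z] by (simp add: abs_le_iff)
qed (simp_all add: ramp_diff_zero_abs[OF d])

lemma mollifier_pairing_integrable:
  assumes d: "0 < d" shows "integrable lborel (\<lambda>z. U t z * ((v t z - c) * mollifier d a z))"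
proof (rule pairing_integrable[where C="(1 + \<bar>c\<bar>) * (1 / primitive bump 1 / d)" and R="\<bar>a\<bar> + d"])
  show "\<bar>(v t z - c) * mollifier d a z\<bar> \<le> (1 + \<bar>c\<bar>) * (1 / primitive bump 1 / d)" for z
    unfolding abs_mult
  proof (rule mult_mono)
    show "\<bar>v t z - c\<bar> \<le> 1 + \<bar>c\<bar>" using v_range[of t z] by linarith
    show "\<bar>mollifier d a z\<bar> \<le> 1 / primitive bump 1 / d" using mollifier_nonneg[OF d, of a z] mollifier_bounded[OF d, of a z] by simp
  qed auto
  show "(v t z - c) * mollifier d a z = 0" if "\<bar>a\<bar> + d < \<bar>z\<bar>" for z
    using mollifier_zero[OF d, of z a] that d by (cases "z \<le> a") auto
qed measurable

text \<open>Cars that cross \<open>x\<close> fill the road. So empty road between \<open>x\<close> and \<open>R\<close> can only be created by cars that leave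
  through \<open>R\<close>, and it is at most the time integral of the speed there.\<close>

lemma jam_deficit:
  assumes c: "0 \<le> c" and v: "\<And>s z. 0 \<le> s \<Longrightarrow> 0 \<le> z \<Longrightarrow> v s z \<le> c * s ^ n"
    and t: "0 \<le> t" and xR: "0 \<le> x" "x \<le> R"
  shows "(R - x) - (P t R - P t x) \<le> c * t ^ Suc n / real (Suc n)"
proof (rule field_le_epsilon)
  fix d :: real assume d: "0 < d"
  define b where "b = c * t ^ Suc n / real (Suc n)"
  have b: "0 \<le> b" using c t by (simp add: b_def)
  show "(R - x) - (P t R - P t x) \<le> c * t ^ Suc n / real (Suc n) + d"
  proof (cases "x + d \<le> R")
    case False
    then show ?thesis using potential_mono[OF P_potential xR(2), of t] b unfolding b_def by simp
  next
    case True
    define \<psi> where "\<psi> z = ramp d x z - ramp d R z" for z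
    have \<psi>0: "0 \<le> \<psi> z" "\<psi> z \<le> 1" for z
      using ramp_mono[OF d xR(2), of z] ramp_range[of d x z] ramp_range[of d R z] by (auto simp: \<psi>_def)
    have [measurable]: "\<psi> \<in> borel_measurable borel" unfolding \<psi>_def[abs_def] by measurable
    have \<psi>int: "integrable lborel \<psi>"
    proof (rule integrableI_bounded_set[where A="{x..R+d}" and B=1])
      show "AE z in lborel. z \<notin> {x..R+d} \<longrightarrow> \<psi> z = 0"
        using ramp_diff_zero[OF d, of x R] xR by (auto simp: \<psi>_def)
    qed (use \<psi>0 in \<open>auto simp: emeasure_lborel_Icc_eq\<close>)
    have U\<psi>: "integrable lborel (\<lambda>z. U s z * \<psi> z)" for s
      unfolding \<psi>_def by (rule ramp_pairing_integrable[OF d])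
    define G where "G s = (LBINT z. U s z * (v s z * (mollifier d x z - mollifier d R z)))" for s
    have Gc: "continuous_on {0..} G" unfolding G_def by (rule flux_continuous[OF d])
    have Gl: "- (c * s ^ n) \<le> G s" if s: "0 \<le> s" for s
    proof -
      have "- (c * s ^ n) = (LBINT z. - (c * s ^ n) * mollifier d R z)"
        using mollifier_integral[OF d, of R] by simp
      also have "\<dots> \<le> G s"
        unfolding G_def
      proof (rule integral_mono)
        show "integrable lborel (\<lambda>z. - (c * s ^ n) * mollifier d R z)" by (intro integrable_mult_right mollifier_integrable[OF d])
        show "integrable lborel (\<lambda>z. U s z * (v s z * (mollifier d x z - mollifier d R z)))"
          using Bochner_Integration.integrable_diff[OF mollifier_pairing_integrable[OF d, of s 0 x] mollifier_pairing_integrable[OF d, of s 0 R]]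
          by (simp add: algebra_simps)
        fix z
        have m: "0 \<le> mollifier d x z" "0 \<le> mollifier d R z" using mollifier_nonneg[OF d] by auto
        have 1: "0 \<le> U s z * (v s z * mollifier d x z)" using m U_range v_range by simp
        have "v s z * mollifier d R z \<le> c * s ^ n * mollifier d R z"
        proof (cases "0 \<le> z")
          case True then show ?thesis using v[OF s True] m by (intro mult_right_mono) auto
        next
          case False then show ?thesis using mollifier_zero[OF d, of z R] xR by simp
        qed
        moreover have "U s z * (v s z * mollifier d R z) \<le> 1 * (v s z * mollifier d R z)"
          using m U_range v_range by (intro mult_right_mono) auto
        ultimately have 2: "U s z * (v s z * mollifier d R z) \<le> c * s ^ n * mollifier d R z" by simp
        show "- (c * s ^ n) * mollifier d R z \<le> U s z * (v s z * (mollifier d x z - mollifier d R z))"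
          using 1 2 by (simp add: algebra_simps)
      qed
      finally show ?thesis .
    qed
    have pw: "((\<lambda>s. - (c * s ^ n)) has_integral (- b - - (c * 0 ^ Suc n / real (Suc n)))) {0..t}"
      unfolding b_def
    proof (rule fundamental_theorem_of_calculus[OF t])
      fix s
      have "((\<lambda>s. s ^ Suc n) has_real_derivative real (Suc n) * s ^ n) (at s within {0..t})"
        using DERIV_pow[of "Suc n" s] by (auto intro: has_field_derivative_at_within)
      from DERIV_cmult[OF this, of "- c / real (Suc n)"]
      have "((\<lambda>s. - c / real (Suc n) * s ^ Suc n) has_real_derivative - (c * s ^ n)) (at s within {0..t})"
        by (simp del: of_nat_Suc power_Suc)
      then show "((\<lambda>s. - (c * s ^ Suc n / real (Suc n))) has_vector_derivative - (c * s ^ n)) (at s within {0..t})"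
        by (simp add: has_real_derivative_iff_has_vector_derivative[symmetric] del: of_nat_Suc power_Suc)
    qed
    have "- b \<le> integral {0..t} G"
      using has_integral_le[OF pw integrable_integral[OF integrable_continuous_interval]] Gl continuous_on_subset[OF Gc, of "{0..t}"] by auto
    moreover have "(LBINT z. U 0 z * \<psi> z) = (LBINT z. \<psi> z)"
    proof (rule integral_cong_AE)
      show "AE z in lborel. U 0 z * \<psi> z = \<psi> z"
        using jam
      proof eventually_elim
        case (elim z)
        show ?case using elim ramp_diff_zero[OF d, of x R z] xR by (cases "0 \<le> z") (auto simp: \<psi>_def)
      qed
    qed auto
    ultimately have 1: "(LBINT z. \<psi> z) - b \<le> (LBINT z. U t z * \<psi> z)"
      using flux_identity[OF d t, of x R] by (simp add: \<psi>_def G_def[abs_def])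
    have "(R - (x + d)) - (P t R - P t (x + d)) = (LBINT z. indicator {x+d..R} z - U t z * indicator {x+d..R} z)"
      using pairing_indicator[OF True, of t] True by (subst Bochner_Integration.integral_diff) auto
    also have "\<dots> \<le> (LBINT z. \<psi> z - U t z * \<psi> z)"
    proof (rule integral_mono)
      show "integrable lborel (\<lambda>z. \<psi> z - U t z * \<psi> z)" by (intro Bochner_Integration.integrable_diff \<psi>int U\<psi>)
      show "integrable lborel (\<lambda>z. indicator {x+d..R} z - U t z * indicator {x+d..R} z)"
        by (intro Bochner_Integration.integrable_diff pairing_indicator(2)[OF True] indicator_Icc_integrable)
      fix z
      have "indicator {x+d..R} z \<le> \<psi> z"
      proof (cases "z \<in> {x+d..R}")
        case True then show ?thesis using ramp_right[OF d, of x z] ramp_left[OF d, of z R] by (simp add: \<psi>_def)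
      qed (use \<psi>0 in simp)
      then have "(1 - U t z) * indicator {x+d..R} z \<le> (1 - U t z) * \<psi> z"
        using U_range by (intro mult_left_mono) auto
      then show "indicator {x+d..R} z - U t z * indicator {x+d..R} z \<le> \<psi> z - U t z * \<psi> z"
        by (simp add: algebra_simps)
    qed
    also have "\<dots> = (LBINT z. \<psi> z) - (LBINT z. U t z * \<psi> z)"
      by (rule Bochner_Integration.integral_diff[OF \<psi>int U\<psi>])
    also have "\<dots> \<le> b" using 1 by simp
    finally show ?thesis using potential_mono[OF P_potential, of x "x + d" t] d by (simp add: b_def)
  qed
qed

text \<open>The speed of a car in the jam is at most \<open>k 0\<close> times a bound for the empty road ahead of it, and that is bounded by the time integral of the speeds in the jam. This Gronwall argument runs
  as an induction, which asks for no measurability of the supremum of the speeds.\<close>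

lemma v_jam_le:
  assumes t: "0 \<le> t" and x: "0 \<le> x" shows "v t x \<le> (k 0) ^ n / fact n * t ^ n"
  using t x
proof (induction n arbitrary: t x)
  case 0 then show ?case using v_range by simp
next
  case (Suc n)
  let ?c = "(k 0) ^ n / fact n"
  have id: "potential (\<lambda>x. x)" by (simp add: potential_def)
  have "lookahead k (\<lambda>x. x) x = 1"
    using level_integral(2)[OF k] by (simp add: lookahead_def)
  then have "v t x = lookahead k (\<lambda>x. x) x - lookahead k (P t) x" by (simp add: v_def)
  also have "\<dots> \<le> k 0 * (?c * t ^ Suc n / real (Suc n))"
  proof (rule lookahead_diff_le[OF k id P_potential])
    fix r :: real assume r: "0 \<le> r"
    show "x + r - x - (P t (x + r) - P t x) \<le> ?c * t ^ Suc n / real (Suc n)"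
      by (rule jam_deficit) (use Suc K r in auto)
  qed
  also have "\<dots> = (k 0) ^ Suc n / fact (Suc n) * t ^ Suc n" by (simp add: field_simps)
  finally show ?case .
qed

lemma v_jam:
  assumes t: "0 \<le> t" and x: "0 \<le> x" shows "v t x = 0"
proof -
  have "(\<lambda>n. inverse (fact n) * (k 0 * t) ^ n) \<longlonglongrightarrow> 0" by (rule summable_LIMSEQ_zero[OF summable_exp])
  then have "v t x \<le> 0"
    by (rule LIMSEQ_le_const) (use v_jam_le[OF t x] in \<open>auto simp: power_mult_distrib field_simps\<close>)
  then show ?thesis using v_range(1)[of t x] by simp
qed

lemma jam_full:
  assumes t: "0 \<le> t" and x: "0 \<le> x" shows "P t x = x"
proof -
  have "(x - 0) - (P t x - P t 0) \<le> 0 * t ^ Suc 0 / real (Suc 0)"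
    by (rule jam_deficit) (use t x v_jam in auto)
  moreover have "P t 0 = 0" by (simp add: primitive_def)
  ultimately show ?thesis using potential_lip[OF P_potential x, of t] by simp
qed

text \<open>A smoothed version of the mass between $x$ and the jam. In contrast to the exact mass \<open>- P t x\<close> it is differentiable in time and space.\<close>

definition smooth_mass :: "real \<Rightarrow> real \<Rightarrow> real \<Rightarrow> real" where
  "smooth_mass d t x = (LBINT z. U t z * (ramp d x z - ramp d 0 z))"

lemma smooth_mass_bounds:
  assumes d: "0 < d" and t: "0 \<le> t" and x: "x \<le> - d"
  shows "- P t (x + d) \<le> smooth_mass d t x" "smooth_mass d t x \<le> - P t x + d"
proof -
  have P0: "P t 0 = 0" by (simp add: primitive_def)
  have "- P t (x + d) = (LBINT z. U t z * indicator {x+d..0} z)"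
    using pairing_indicator[of "x+d" 0 t] x P0 by simp
  also have "\<dots> \<le> smooth_mass d t x"
    unfolding smooth_mass_def
  proof (rule integral_mono)
    show "integrable lborel (\<lambda>z. U t z * indicator {x+d..0} z)" by (rule pairing_indicator) (use x in auto)
    show "integrable lborel (\<lambda>z. U t z * (ramp d x z - ramp d 0 z))" by (rule ramp_pairing_integrable[OF d])
    fix z
    have "indicator {x+d..0} z \<le> ramp d x z - ramp d 0 z"
    proof (cases "z \<in> {x+d..0}")
      case True then show ?thesis using ramp_right[OF d, of x z] ramp_left[OF d, of z 0] by simp
    qed (use ramp_mono[OF d, of x 0 z] x d in simp)
    then show "U t z * indicator {x+d..0} z \<le> U t z * (ramp d x z - ramp d 0 z)"
      using U_range by (intro mult_left_mono) auto
  qed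
  finally show "- P t (x + d) \<le> smooth_mass d t x" .
  have "smooth_mass d t x \<le> (LBINT z. U t z * indicator {x..d} z)"
    unfolding smooth_mass_def
  proof (rule integral_mono)
    show "integrable lborel (\<lambda>z. U t z * indicator {x..d} z)" by (rule pairing_indicator) (use x d in auto)
    show "integrable lborel (\<lambda>z. U t z * (ramp d x z - ramp d 0 z))" by (rule ramp_pairing_integrable[OF d])
    fix z
    have "ramp d x z - ramp d 0 z \<le> indicator {x..d} z"
    proof (cases "z \<in> {x..d}")
      case True then show ?thesis using ramp_range[of d x z] ramp_range[of d 0 z] by simp
    next
      case False then show ?thesis using ramp_diff_zero[OF d, of x 0 z] x d by simp
    qed
    then show "U t z * (ramp d x z - ramp d 0 z) \<le> U t z * indicator {x..d} z"
      using U_range by (intro mult_left_mono) auto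
  qed
  also have "\<dots> = - P t x + d"
    using pairing_indicator[of x d t] x d jam_full[OF t, of d] by simp
  finally show "smooth_mass d t x \<le> - P t x + d" .
qed

lemma smooth_mass_time:
  assumes d: "0 < d" and t: "0 \<le> t"
  shows "((\<lambda>s. smooth_mass d s x) has_real_derivative (LBINT z. U t z * (v t z * mollifier d x z))) (at t within {0..})"
proof -
  define G where "G s = (LBINT z. U s z * (v s z * (mollifier d x z - mollifier d 0 z)))" for s
  have Gc: "continuous_on {0..} G" unfolding G_def by (rule flux_continuous[OF d])
  have "((\<lambda>s. integral {0..s} G) has_real_derivative G t) (at t within {0..})"
    by (rule integral_upto_has_derivative[OF Gc t])
  then have "((\<lambda>s. smooth_mass d 0 x + integral {0..s} G) has_real_derivative G t) (at t within {0..})"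
    by (auto intro!: derivative_eq_intros)
  then have "((\<lambda>s. smooth_mass d s x) has_real_derivative G t) (at t within {0..})"
  proof (rule has_field_derivative_transform_within[where d=1])
    fix s :: real assume "s \<in> {0..}"
    then show "smooth_mass d 0 x + integral {0..s} G = smooth_mass d s x"
      unfolding smooth_mass_def G_def[abs_def] by (intro flux_identity[OF d, symmetric]) simp
  qed (use t in auto)
  moreover have "G t = (LBINT z. U t z * (v t z * mollifier d x z))"
    unfolding G_def
  proof (rule Bochner_Integration.integral_cong[OF refl])
    fix z
    show "U t z * (v t z * (mollifier d x z - mollifier d 0 z)) = U t z * (v t z * mollifier d x z)"
      using v_jam[OF t, of z] mollifier_zero[OF d, of z 0] by (cases "0 \<le> z") auto
  qed
  ultimately show ?thesis by simp
qed

lemma ramp_lipschitz: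
  assumes d: "0 < d" shows "\<bar>ramp d x z - ramp d y z\<bar> \<le> (1 / primitive bump 1 / d) * \<bar>x - y\<bar>"
proof -
  have "norm (ramp d x z - ramp d y z) \<le> (1 / primitive bump 1 / d) * norm (x - y)"
    by (rule field_differentiable_bound[where S=UNIV and f="\<lambda>x. ramp d x z" and f'="\<lambda>x. - mollifier d x z"])
      (use mollifier_nonneg[OF d] mollifier_bounded[OF d] in \<open>auto intro!: ramp_deriv_base[OF d]\<close>)
  then show ?thesis by simp
qed

text \<open>The mass ahead of a moving point changes by the flux relative to the point. For a characteristic this flux is nearly zero, and for a point that is slower than the cars it is nonnegative.\<close>

lemma smooth_mass_curve:
  assumes d: "0 < d" and t: "0 \<le> t" 
    and \<xi>: "(\<xi> has_real_derivative \<xi>') (at t within {0..})" 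
    and L: "\<And>s. 0 \<le> s \<Longrightarrow> \<bar>\<xi> s - \<xi> t\<bar> \<le> L * \<bar>s - t\<bar>"
  shows "((\<lambda>s. smooth_mass d s (\<xi> s)) has_real_derivative (LBINT z. U t z * ((v t z - \<xi>') * mollifier d (\<xi> t) z))) (at t within {0..})"
proof -
  have "((\<lambda>s. (smooth_mass d s (\<xi> s) - smooth_mass d s (\<xi> t)) / (s - t)) \<longlongrightarrow> (LBINT z. U t z * (- \<xi>' * mollifier d (\<xi> t) z))) (at t within {0..})"
    unfolding tendsto_at_iff_sequentially
  proof (intro allI impI)
    fix S :: "nat \<Rightarrow> real" assume S: "\<forall>i. S i \<in> {0..} - {t}" "S \<longlonglongrightarrow> t"
    obtain B where B: "\<And>n. \<bar>S n\<bar> \<le> B" using S(2) convergent_imp_Bseq[of S] by (auto simp: convergent_def Bseq_def)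
    have L0: "0 \<le> L" using L[of "t + 1"] t by auto
    have \<xi>B: "\<bar>\<xi> (S n)\<bar> \<le> \<bar>\<xi> t\<bar> + L * (B + t)" for n
    proof -
      have "\<bar>\<xi> (S n) - \<xi> t\<bar> \<le> L * \<bar>S n - t\<bar>" using L S(1) by auto
      also have "\<dots> \<le> L * (B + t)" using B[of n] t L0 by (intro mult_left_mono) auto
      finally show ?thesis by linarith
    qed
    define q where "q n z = (ramp d (\<xi> (S n)) z - ramp d (\<xi> t) z) / (S n - t)" for n z
    have "(\<lambda>n. LBINT z. U (S n) z * q n z) \<longlonglongrightarrow> (LBINT z. U t z * (- \<xi>' * mollifier d (\<xi> t) z))"
    proof (rule pairing_tendsto[OF t _ S(2), where C="(1 / primitive bump 1 / d) * L" and R="\<bar>\<xi> t\<bar> + L * (B + t) + \<bar>\<xi> t\<bar> + d"])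
      show "0 \<le> S n" for n using S by auto
      show "q n \<in> borel_measurable borel" for n unfolding q_def[abs_def] by measurable
      show "\<bar>q n z\<bar> \<le> (1 / primitive bump 1 / d) * L" for n z
      proof -
        have "\<bar>ramp d (\<xi> (S n)) z - ramp d (\<xi> t) z\<bar> \<le> (1 / primitive bump 1 / d) * \<bar>\<xi> (S n) - \<xi> t\<bar>" by (rule ramp_lipschitz[OF d])
        also have "\<dots> \<le> (1 / primitive bump 1 / d) * (L * \<bar>S n - t\<bar>)"
          using bump_mass d by (intro mult_left_mono L) (use S in auto)
        finally show ?thesis using S(1) by (auto simp: q_def abs_divide divide_le_eq mult.assoc)
      qed
      show "q n z = 0" if "\<bar>\<xi> t\<bar> + L * (B + t) + \<bar>\<xi> t\<bar> + d < \<bar>z\<bar>" for n z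
        using ramp_diff_zero_abs(1)[OF d, of "\<xi> (S n)" "\<xi> t" z] \<xi>B[of n] that by (simp add: q_def)
      fix z
      have "((\<lambda>s. ramp d (\<xi> s) z) has_real_derivative - mollifier d (\<xi> t) z * \<xi>') (at t within {0..})"
        by (rule DERIV_chain2[OF ramp_deriv_base[OF d] \<xi>])
      then have "((\<lambda>s. (ramp d (\<xi> s) z - ramp d (\<xi> t) z) / (s - t)) \<longlongrightarrow> - mollifier d (\<xi> t) z * \<xi>') (at t within {0..})"
        by (simp add: has_field_derivative_iff)
      then show "(\<lambda>n. q n z) \<longlonglongrightarrow> - \<xi>' * mollifier d (\<xi> t) z"
        unfolding tendsto_at_iff_sequentially using S by (auto simp: q_def o_def mult.commute)
    qed
    moreover have "(smooth_mass d (S n) (\<xi> (S n)) - smooth_mass d (S n) (\<xi> t)) / (S n - t) = (LBINT z. U (S n) z * q n z)" for n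
    proof -
      have "smooth_mass d (S n) (\<xi> (S n)) - smooth_mass d (S n) (\<xi> t) = 
        (LBINT z. U (S n) z * (ramp d (\<xi> (S n)) z - ramp d 0 z) - U (S n) z * (ramp d (\<xi> t) z - ramp d 0 z))"
        unfolding smooth_mass_def by (rule Bochner_Integration.integral_diff[symmetric]; rule ramp_pairing_integrable[OF d])
      also have "\<dots> = (LBINT z. (S n - t) * (U (S n) z * q n z))"
        by (rule Bochner_Integration.integral_cong) (use S(1) in \<open>auto simp: q_def field_simps\<close>)
      finally show ?thesis using S(1) by simp
    qed
    ultimately show "((\<lambda>s. (smooth_mass d s (\<xi> s) - smooth_mass d s (\<xi> t)) / (s - t)) \<circ> S) \<longlonglongrightarrow> (LBINT z. U t z * (- \<xi>' * mollifier d (\<xi> t) z))"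
      by (simp add: o_def)
  qed
  moreover have "((\<lambda>s. (smooth_mass d s (\<xi> t) - smooth_mass d t (\<xi> t)) / (s - t)) \<longlongrightarrow> (LBINT z. U t z * (v t z * mollifier d (\<xi> t) z))) (at t within {0..})"
    using smooth_mass_time[OF d t, of "\<xi> t"] by (simp add: has_field_derivative_iff)
  ultimately have "((\<lambda>s. (smooth_mass d s (\<xi> s) - smooth_mass d s (\<xi> t)) / (s - t) + (smooth_mass d s (\<xi> t) - smooth_mass d t (\<xi> t)) / (s - t)) \<longlongrightarrow>
      (LBINT z. U t z * (- \<xi>' * mollifier d (\<xi> t) z)) + (LBINT z. U t z * (v t z * mollifier d (\<xi> t) z))) (at t within {0..})"
    by (rule tendsto_add)
  moreover have "(LBINT z. U t z * (- \<xi>' * mollifier d (\<xi> t) z)) + (LBINT z. U t z * (v t z * mollifier d (\<xi> t) z)) = 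
      (LBINT z. U t z * ((v t z - \<xi>') * mollifier d (\<xi> t) z))"
  proof -
    have i1: "integrable lborel (\<lambda>z. U t z * (v t z * mollifier d (\<xi> t) z))"
      using mollifier_pairing_integrable[OF d, of t 0 "\<xi> t"] by simp
    have i2: "integrable lborel (\<lambda>z. U t z * (- \<xi>' * mollifier d (\<xi> t) z))"
      using Bochner_Integration.integrable_diff[OF mollifier_pairing_integrable[OF d, of t \<xi>' "\<xi> t"] i1]
      by (simp add: algebra_simps)
    show ?thesis
      by (subst Bochner_Integration.integral_add[OF i2 i1, symmetric]) (rule Bochner_Integration.integral_cong, auto simp: algebra_simps)
  qed
  ultimately show ?thesis
    by (simp add: has_field_derivative_iff diff_divide_distrib)
qed

end

context jam_solution begin

section \<open>Characteristics\<close>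

definition characteristic :: "(real \<Rightarrow> real) \<Rightarrow> bool" where
  "characteristic X \<longleftrightarrow> (\<forall>t\<ge>0. (X has_real_derivative v t (X t)) (at t within {0..}))"

lemma v_along_continuous:
  assumes "continuous_on {0..} X" shows "continuous_on {0..} (\<lambda>s. v s (X s))"
proof -
  have "continuous_on {0..} (\<lambda>s. (\<lambda>(t, x). v t x) (s, X s))"
    by (rule continuous_on_compose2[OF v_cont]) (auto intro!: continuous_intros assms)
  then show ?thesis by simp
qed

lemma characteristic_exists:
  obtains X where "X 0 = a" "characteristic X"
proof -
  define \<Gamma> where "\<Gamma> X t = a + integral {0..t} (\<lambda>s. v s (X s))" for X :: "real \<Rightarrow> real" and t
  have deriv: "(\<Gamma> X has_real_derivative v t (X t)) (at t within {0..})" if X: "continuous_on {0..} X" and t: "0 \<le> t" for X t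
    unfolding \<Gamma>_def[abs_def]
    by (rule derivative_eq_intros integral_upto_has_derivative[OF v_along_continuous[OF X] t] refl)+ simp
  have cont: "continuous_on {0..} (\<Gamma> X)" if "continuous_on {0..} X" for X
    by (rule DERIV_continuous_on[OF deriv[OF that]]) auto
  have int: "(\<lambda>s. v s (X s)) integrable_on {0..t}" if "continuous_on {0..} X" for X t
    by (rule continuous_on_interval_integrable[OF v_along_continuous[OF that]]) simp
  have "\<exists>X\<in>{X. continuous_on {0..} X}. \<forall>p\<in>{0..}. \<Gamma> X p = X p"
  proof (rule picard_fixed_point[where \<omega>="\<lambda>t. exp (2 * k 0 * t)" and ?X0.0="\<lambda>_. a" and ?c0.0="1 / (2 * k 0)"])
    show "(\<lambda>_. a) \<in> {X. continuous_on {0..} X}" by simp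
    show "\<Gamma> X \<in> {X. continuous_on {0..} X}" if "X \<in> {X. continuous_on {0..} X}" for X using cont that by simp
    show "\<bar>\<Gamma> (\<lambda>_. a) t - a\<bar> \<le> 1 / (2 * k 0) * exp (2 * k 0 * t)" if t: "t \<in> {0..}" for t
    proof -
      have "norm (integral {0..t} (\<lambda>s. v s a)) \<le> integral {0..t} (\<lambda>s. 1)"
        by (rule integral_norm_bound_integral) (use int[of "\<lambda>_. a"] v_range in auto)
      then have "\<bar>\<Gamma> (\<lambda>_. a) t - a\<bar> \<le> t" using t by (simp add: \<Gamma>_def)
      moreover have "2 * k 0 * t \<le> exp (2 * k 0 * t)" using exp_ge_add_one_self[of "2 * k 0 * t"] by linarith
      then have "t \<le> 1 / (2 * k 0) * exp (2 * k 0 * t)" using K by (simp add: field_simps)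
      ultimately show ?thesis by simp
    qed
    show "\<bar>\<Gamma> X t - \<Gamma> Y t\<bar> \<le> (c / 2) * exp (2 * k 0 * t)" 
      if X: "X \<in> {X. continuous_on {0..} X}" and Y: "Y \<in> {X. continuous_on {0..} X}" 
        and le: "\<And>p. p \<in> {0..} \<Longrightarrow> \<bar>X p - Y p\<bar> \<le> c * exp (2 * k 0 * p)" and t: "t \<in> {0..}" for X Y c t
    proof -
      have c: "0 \<le> c" using le[of 0] by auto
      have w: "((\<lambda>s. exp (2 * k 0 * s) * (k 0 * c)) has_integral (k 0 * c / (2 * k 0)) * (exp (2 * k 0 * t) - 1)) {0..t}"
        by (rule exp_weight_integral) (use K t in auto)
      have "\<Gamma> X t - \<Gamma> Y t = integral {0..t} (\<lambda>s. v s (X s) - v s (Y s))"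
        using int[of X t] int[of Y t] X Y by (simp add: \<Gamma>_def Henstock_Kurzweil_Integration.integral_diff)
      also have "norm \<dots> \<le> integral {0..t} (\<lambda>s. exp (2 * k 0 * s) * (k 0 * c))"
      proof (rule integral_norm_bound_integral)
        show "(\<lambda>s. v s (X s) - v s (Y s)) integrable_on {0..t}" using int X Y by (intro integrable_diff) auto
        show "(\<lambda>s. exp (2 * k 0 * s) * (k 0 * c)) integrable_on {0..t}" using w by blast
        fix s assume s: "s \<in> {0..t}"
        have "\<bar>v s (X s) - v s (Y s)\<bar> \<le> k 0 * \<bar>X s - Y s\<bar>" by (rule v_lipschitz)
        also have "\<dots> \<le> k 0 * (c * exp (2 * k 0 * s))" using le[of s] s K by (intro mult_left_mono) auto
        finally show "norm (v s (X s) - v s (Y s)) \<le> exp (2 * k 0 * s) * (k 0 * c)" by (simp add: ac_simps)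
      qed
      also have "\<dots> = (k 0 * c / (2 * k 0)) * (exp (2 * k 0 * t) - 1)" by (rule integral_unique[OF w])
      also have "\<dots> \<le> (c / 2) * exp (2 * k 0 * t)" using K c by (simp add: field_simps)
      finally show ?thesis by simp
    qed
    show "X \<in> {X. continuous_on {0..} X}" 
      if "\<And>n. S n \<in> {X. continuous_on {0..} X}" "\<And>n p. p \<in> {0..} \<Longrightarrow> \<bar>S n p - X p\<bar> \<le> c * (1/2)^n * exp (2 * k 0 * p)"
      for S X c
    proof -
      have "continuous_on {0..} X"
      proof (rule continuous_on_weighted_limit[OF _ _ _ that(2)])
        show "continuous_on {0..} (S n)" for n using that(1)[of n] by simp
        show "continuous_on {0..} (\<lambda>p. exp (2 * k 0 * p))" by (intro continuous_intros)
      qed auto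
      then show ?thesis by simp
    qed
  qed
  then obtain X where X: "continuous_on {0..} X" and fp: "\<And>t. 0 \<le> t \<Longrightarrow> \<Gamma> X t = X t" by auto
  have "(X has_real_derivative v t (X t)) (at t within {0..})" if t: "0 \<le> t" for t
    by (rule has_field_derivative_transform_within[OF deriv[OF X t], where d=1]) (use t fp in auto)
  moreover have "X 0 = a" using fp[of 0] by (simp add: \<Gamma>_def)
  ultimately show thesis by (intro that[of X]) (auto simp: characteristic_def)
qed

lemma characteristic_lipschitz:
  assumes X: "characteristic X" and "0 \<le> s" "0 \<le> t"
  shows "\<bar>X s - X t\<bar> \<le> 1 * \<bar>s - t\<bar>"
proof -
  have *: "X s \<le> X t \<and> X t - X s \<le> t - s" if "0 \<le> s" "s \<le> t" for s t
  proof -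
    have "X s \<le> X t"
      by (rule nondecreasing_halfline[where f'="\<lambda>t. v t (X t)", OF _ _ that]) (use X v_range in \<open>auto simp: characteristic_def\<close>)
    moreover have "s - X s \<le> t - X t"
      by (rule nondecreasing_halfline[where f'="\<lambda>t. 1 - v t (X t)", OF _ _ that]) 
        (use X v_range in \<open>auto simp: characteristic_def intro!: derivative_eq_intros\<close>)
    ultimately show ?thesis by simp
  qed
  show ?thesis using *[of s t] *[of t s] assms by (cases "s \<le> t") auto
qed

lemma characteristic_continuous: "characteristic X \<Longrightarrow> continuous_on {0..} X"
  by (rule DERIV_continuous_on) (auto simp: characteristic_def)

text \<open>The square of the distance, multiplied by \<open>exp (2 * k 0 * t)\<close>, cannot decrease, so the distance never vanishes. This is why the empty gaps persist.\<close>

lemma characteristic_separation: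
  assumes X: "characteristic X" and Y: "characteristic Y" and less: "X 0 < Y 0" and t: "0 \<le> t"
  shows "X t < Y t"
proof -
  define D where "D t = Y t - X t" for t
  have D: "(D has_real_derivative v s (Y s) - v s (X s)) (at s within {0..})" if "0 \<le> s" for s
    unfolding D_def[abs_def] using X Y that by (auto simp: characteristic_def intro!: derivative_eq_intros)
  have nz: "D s \<noteq> 0" if s: "0 \<le> s" for s
  proof -
    have "exp (2 * k 0 * 0) * (D 0)\<^sup>2 \<le> exp (2 * k 0 * s) * (D s)\<^sup>2"
    proof (rule nondecreasing_halfline[where f'="\<lambda>r. exp (2 * k 0 * r) * (2 * (k 0 * (D r)\<^sup>2 + D r * (v r (Y r) - v r (X r))))", OF _ _ order.refl s])
      fix r :: real assume r: "0 \<le> r"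
      show "((\<lambda>r. exp (2 * k 0 * r) * (D r)\<^sup>2) has_real_derivative exp (2 * k 0 * r) * (2 * (k 0 * (D r)\<^sup>2 + D r * (v r (Y r) - v r (X r))))) (at r within {0..})"
        by (auto intro!: derivative_eq_intros D r simp: algebra_simps power2_eq_square)
      have "\<bar>D r * (v r (Y r) - v r (X r))\<bar> \<le> \<bar>D r\<bar> * (k 0 * \<bar>D r\<bar>)"
        unfolding abs_mult D_def by (intro mult_left_mono v_lipschitz) auto
      also have "\<dots> = k 0 * (D r)\<^sup>2" by (simp add: power2_eq_square)
      finally show "0 \<le> exp (2 * k 0 * r) * (2 * (k 0 * (D r)\<^sup>2 + D r * (v r (Y r) - v r (X r))))"
        by (intro mult_nonneg_nonneg) (auto simp: abs_le_iff)
    qed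
    moreover have "0 < (D 0)\<^sup>2" using less by (simp add: D_def)
    ultimately show ?thesis by auto
  qed
  have "0 < D t"
  proof (rule ccontr)
    assume "\<not> 0 < D t"
    moreover have "continuous_on {0..t} D"
      unfolding D_def by (intro continuous_on_diff continuous_on_subset[OF characteristic_continuous] X Y) auto
    ultimately have "\<exists>s\<ge>0. s \<le> t \<and> D s = 0"
      using IVT2'[of D t 0 0] t less by (auto simp: D_def)
    then show False using nz by auto
  qed
  then show ?thesis by (simp add: D_def)
qed

lemma characteristic_negative:
  assumes "characteristic X" "X 0 < 0" "0 \<le> t" shows "X t < 0"
proof -
  have "characteristic (\<lambda>_. 0)" by (auto simp: characteristic_def v_jam)
  from characteristic_separation[OF assms(1) this] assms show ?thesis by simp
qed

text \<open>The smoothed mass ahead of the car changes at a rate of at most \<open>k 0 * d\<close>, since the mollifier of width \<open>d\<close> only sees velocities that differ by this much from the speed of the car. Let \<open>d\<close> tend to $0$.\<close>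

lemma characteristic_label:
  assumes X: "characteristic X" and neg: "X 0 < 0" and t: "0 \<le> t"
  shows "P t (X t) = P 0 (X 0)"
proof -
  have negt: "X t < 0" by (rule characteristic_negative[OF X neg t])
  have est: "\<bar>P t (X t) - P 0 (X 0)\<bar> \<le> d * (2 + k 0 * t)" if d: "0 < d" "d \<le> - X 0" "d \<le> - X t" for d
  proof -
    define f where "f s = smooth_mass d s (X s)" for s
    define f' where "f' s = (LBINT z. U s z * ((v s z - v s (X s)) * mollifier d (X s) z))" for s
    have df: "(f has_real_derivative f' s) (at s within {0..})" if s: "0 \<le> s" for s
      unfolding f_def[abs_def] f'_def
      by (rule smooth_mass_curve[where L=1, OF d(1) s]) (use X s characteristic_lipschitz[OF X] in \<open>auto simp: characteristic_def\<close>)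
    have f'_le: "\<bar>f' s\<bar> \<le> k 0 * d" if s: "0 \<le> s" for s
    proof -
      have "norm (f' s) \<le> (LBINT z. (k 0 * d) * mollifier d (X s) z)"
        unfolding f'_def
      proof (rule Bochner_Integration.integral_norm_bound_integral)
        show "integrable lborel (\<lambda>z. U s z * ((v s z - v s (X s)) * mollifier d (X s) z))"
          by (rule mollifier_pairing_integrable[OF d(1)])
        show "integrable lborel (\<lambda>z. (k 0 * d) * mollifier d (X s) z)"
          by (intro integrable_mult_right mollifier_integrable[OF d(1)])
        fix z
        have m: "0 \<le> mollifier d (X s) z" by (rule mollifier_nonneg[OF d(1)])
        show "norm (U s z * ((v s z - v s (X s)) * mollifier d (X s) z)) \<le> (k 0 * d) * mollifier d (X s) z"
        proof (cases "X s \<le> z \<and> z \<le> X s + d")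
          case True
          have "\<bar>v s z - v s (X s)\<bar> \<le> k 0 * \<bar>z - X s\<bar>" by (rule v_lipschitz)
          also have "\<dots> \<le> k 0 * d" using True K by (intro mult_left_mono) auto
          finally have "\<bar>v s z - v s (X s)\<bar> * mollifier d (X s) z \<le> k 0 * d * mollifier d (X s) z"
            using m by (rule mult_right_mono)
          moreover have "U s z * (\<bar>v s z - v s (X s)\<bar> * mollifier d (X s) z) \<le> 1 * (\<bar>v s z - v s (X s)\<bar> * mollifier d (X s) z)"
            using m U_range by (intro mult_right_mono) auto
          ultimately show ?thesis using m U_range by (simp add: abs_mult)
        next
          case False
          then show ?thesis using mollifier_zero[OF d(1), of z "X s"] by auto
        qed
      qed
      also have "\<dots> = k 0 * d" using mollifier_integral[OF d(1), of "X s"] by simp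
      finally show ?thesis by simp
    qed
    have "f 0 + k 0 * d * 0 \<le> f t + k 0 * d * t"
      by (rule nondecreasing_halfline[where f'="\<lambda>s. f' s + k 0 * d", OF _ _ order.refl t])
        (use f'_le in \<open>auto intro!: derivative_eq_intros df simp: abs_le_iff\<close>, smt (verit))
    moreover have "k 0 * d * 0 - f 0 \<le> k 0 * d * t - f t"
      by (rule nondecreasing_halfline[where f'="\<lambda>s. k 0 * d - f' s", OF _ _ order.refl t])
        (use f'_le in \<open>auto intro!: derivative_eq_intros df simp: abs_le_iff\<close>)
    ultimately have "\<bar>f t - f 0\<bar> \<le> k 0 * d * t" by (simp add: abs_le_iff)
    moreover have "\<bar>f s - (- P s (X s))\<bar> \<le> d" if s: "0 \<le> s" "X s \<le> - d" for s
      using smooth_mass_bounds[OF d(1) s] potential_lip[OF P_potential, of "X s" "X s + d" s] d(1)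
      by (simp add: f_def abs_le_iff)
    from this[of t] this[of 0] have "\<bar>f t + P t (X t)\<bar> \<le> d" "\<bar>f 0 + P 0 (X 0)\<bar> \<le> d" using t d by auto
    ultimately show ?thesis by (simp add: algebra_simps abs_le_iff)
  qed
  have "\<bar>P t (X t) - P 0 (X 0)\<bar> \<le> 0 + e" if e: "0 < e" for e
  proof -
    have pos: "0 < 2 + k 0 * t" using K t by (simp add: add_pos_nonneg)
    define d where "d = min (e / (2 + k 0 * t)) (min (- X 0) (- X t))"
    have d: "0 < d" using e pos neg negt by (simp add: d_def)
    have "d * (2 + k 0 * t) \<le> e / (2 + k 0 * t) * (2 + k 0 * t)"
      using pos by (intro mult_right_mono) (auto simp: d_def)
    also have "\<dots> = e" using pos by simp
    finally have "d * (2 + k 0 * t) \<le> e" .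
    moreover have "d \<le> - X 0" "d \<le> - X t" by (auto simp: d_def)
    ultimately show ?thesis using est[OF d] by linarith
  qed
  then have "\<bar>P t (X t) - P 0 (X 0)\<bar> \<le> 0" by (rule field_le_epsilon)
  then show ?thesis by simp
qed

section \<open>Comparison with a uniform platoon\<close>

lemma smooth_mass_continuous:
  assumes d: "0 < d" shows "continuous_on ({0..} \<times> UNIV) (\<lambda>(t, x). smooth_mass d t x)"
proof (rule continuous_on_halfplane)
  fix \<tau> \<xi> :: "nat \<Rightarrow> real" and t x :: real assume tn: "\<And>n::nat. 0 \<le> \<tau> n" and t: "0 \<le> t" and tt: "\<tau> \<longlonglongrightarrow> t" "\<xi> \<longlonglongrightarrow> x"
  obtain B where B: "\<And>n. \<bar>\<xi> n\<bar> \<le> B" using tt(2) convergent_imp_Bseq[of \<xi>] by (auto simp: convergent_def Bseq_def)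
  show "(\<lambda>n. smooth_mass d (\<tau> n) (\<xi> n)) \<longlonglongrightarrow> smooth_mass d t x"
    unfolding smooth_mass_def
  proof (rule pairing_tendsto[OF t tn tt(1), where C=1 and R="B + d"])
    show "\<bar>ramp d (\<xi> n) z - ramp d 0 z\<bar> \<le> 1" for n z
      using ramp_range[of d "\<xi> n" z] ramp_range[of d 0 z] by (simp add: abs_le_iff)
    show "ramp d (\<xi> n) z - ramp d 0 z = 0" if "B + d < \<bar>z\<bar>" for n z
      by (rule ramp_diff_zero_abs(1)[OF d]) (use B[of n] that in simp)
    show "(\<lambda>n. ramp d (\<xi> n) z - ramp d 0 z) \<longlonglongrightarrow> ramp d x z - ramp d 0 z" for z
    proof (intro tendsto_diff tendsto_const)
      have "isCont (\<lambda>x. ramp d x z) x" by (rule DERIV_isCont[OF ramp_deriv_base[OF d]])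
      then show "(\<lambda>n. ramp d (\<xi> n) z) \<longlonglongrightarrow> ramp d x z" by (rule isCont_tendsto_compose[OF _ tt(2)])
    qed
  qed measurable
qed

text \<open>The line \<open>c + q * t\<close> belongs to a car of the platoon, which has the mass \<open>\<rho> * (- \<beta> - q * \<tau> - c)\<close> ahead of it at all times. Minimise the difference between the true
  mass ahead and this number over all times and lines. If the minimum is negative, it is attained after time $0$. Minimality in \<open>c\<close> bounds the true mass in an interval of length $r$ ahead of the minimum
  point by $\rho r$, so the cars there drive faster than \<open>q\<close>. Then the true mass ahead increases along the line, against minimality in time. The term with \<open>\<gamma>\<close> makes
  this strict. The platoon stays at a distance \<open>\<beta>\<close> from the jam, so that the jam is only seen through \<open>level_tail k \<beta>\<close>.\<close>

lemma platoon_comparison_smooth: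
  assumes \<tau>: "0 < \<tau>" and a: "a < 0" "- a \<le> q * \<tau>" and q: "0 \<le> q" and \<rho>: "0 < \<rho>" and \<beta>: "0 < \<beta>"
    and d: "0 < d" "d \<le> \<beta>" and \<gamma>: "0 < \<gamma>"
    and slow: "\<rho> + level_tail k \<beta> + q + 3 * k 0 * d \<le> 1"
    and c: "\<rho> * (- \<beta> - q * \<tau> - c) \<le> - P 0 a" "c \<le> - \<beta> - q * \<tau>"
  shows "\<rho> * (- \<beta> - q * \<tau> - c) - \<gamma> * \<tau> \<le> smooth_mass d \<tau> (c + q * \<tau>)"
proof (rule ccontr)
  assume contr: "\<not> ?thesis"
  define cR where "cR = - \<beta> - q * \<tau>"
  define g where "g t c = smooth_mass d t (c + q * t) - \<rho> * (cR - c) + \<gamma> * t" for t c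
  have gc: "continuous_on ({0..} \<times> UNIV) (\<lambda>p. g (fst p) (snd p))"
  proof -
    have "continuous_on ({0..} \<times> UNIV) (\<lambda>p. (\<lambda>(t, x). smooth_mass d t x) (fst p, snd p + q * fst p))"
      by (rule continuous_on_compose2[OF smooth_mass_continuous[OF d(1)]]) (auto intro!: continuous_intros)
    then show ?thesis unfolding g_def by (auto intro!: continuous_intros)
  qed
  let ?S = "{0..\<tau>} \<times> {c..cR}"
  have "compact ?S" by (intro compact_Times) auto
  moreover have "?S \<noteq> {}" using \<tau> c by (auto simp: cR_def)
  moreover have "continuous_on ?S (\<lambda>p. g (fst p) (snd p))" by (rule continuous_on_subset[OF gc]) auto
  ultimately have "\<exists>p\<in>?S. \<forall>p'\<in>?S. g (fst p) (snd p) \<le> g (fst p') (snd p')"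
    by (rule continuous_attains_inf)
  then obtain p where p: "p \<in> ?S" "\<And>p'. p' \<in> ?S \<Longrightarrow> g (fst p) (snd p) \<le> g (fst p') (snd p')" by blast
  obtain t0 c0 where p0: "p = (t0, c0)" by (cases p)
  have t0: "0 \<le> t0" "t0 \<le> \<tau>" and c0: "c \<le> c0" "c0 \<le> cR" using p(1) p0 by auto
  have min: "g t0 c0 \<le> g t' c'" if "0 \<le> t'" "t' \<le> \<tau>" "c \<le> c'" "c' \<le> cR" for t' c'
    using p(2)[of "(t', c')"] that p0 by simp
  have gneg: "g t0 c0 < 0"
    using min[of \<tau> c] contr \<tau> c by (simp add: g_def cR_def)
  have le\<beta>: "c' + q * t' \<le> - \<beta>" if "t' \<le> \<tau>" "c' \<le> cR" for t' c'
  proof -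
    have "q * t' \<le> q * \<tau>" using q that by (intro mult_left_mono) auto
    then show ?thesis using that by (simp add: cR_def)
  qed
  define x0 where "x0 = c0 + q * t0"
  have x0: "x0 \<le> - \<beta>" "x0 \<le> - d" using le\<beta>[of t0 c0] t0 c0 d by (auto simp: x0_def)
  have P0: "P t 0 = 0" for t by (simp add: primitive_def)
  have Pneg: "P t x \<le> 0" if "x \<le> 0" for t x using potential_mono[OF P_potential that, of t] P0 by simp
  have lb: "- P t x - d \<le> smooth_mass d t x" if "0 \<le> t" "x \<le> - d" for t x
    using smooth_mass_bounds(1)[OF d(1) that] potential_lip[OF P_potential, of x "x + d" t] d by simp
  have ub: "smooth_mass d t x \<le> - P t x + d" if "0 \<le> t" "x \<le> - d" for t x
    by (rule smooth_mass_bounds(2)[OF d(1) that])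
  have A0: "0 \<le> smooth_mass d t x" if "0 \<le> t" "x \<le> - d" for t x
    using smooth_mass_bounds(1)[OF d(1) that] Pneg[of "x + d" t] that by simp
  have "t0 \<noteq> 0"
  proof
    assume z: "t0 = 0"
    have low: "- P 0 (c0 + d) \<le> smooth_mass d 0 c0"
      using smooth_mass_bounds(1)[OF d(1), of 0 c0] x0 z by (simp add: x0_def)
    have "\<rho> * (cR - c0) \<le> smooth_mass d 0 c0"
    proof (cases "c0 + d \<le> a")
      case True
      have "\<rho> * (cR - c0) \<le> \<rho> * (cR - c)" using \<rho> c0 by (intro mult_left_mono) auto
      also have "\<dots> \<le> - P 0 a" using c by (simp add: cR_def)
      also have "\<dots> \<le> - P 0 (c0 + d)" using potential_mono[OF P_potential True, of 0] by simp
      finally show ?thesis using low by simp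
    next
      case False
      then have "cR - c0 \<le> 0" using a d by (simp add: cR_def)
      then have "\<rho> * (cR - c0) \<le> 0" using \<rho> by (simp add: mult_le_0_iff)
      then show ?thesis using A0[of 0 c0] x0 z by (simp add: x0_def)
    qed
    then show False using gneg z by (simp add: g_def)
  qed
  then have t0': "0 < t0" using t0 by simp
  have A_small: "smooth_mass d t0 x0 < \<rho> * (cR - c0)"
    using gneg \<gamma> t0 by (simp add: g_def x0_def) (smt (verit) mult_nonneg_nonneg)
  \<comment> \<open>Within the platoon, minimality in the line bounds the mass; beyond its head, the negative minimum bounds all the mass up to the jam.\<close>
  have "lookahead k (P t0) x0 \<le> \<rho> + k 0 * (2 * d) + level_tail k \<beta>"
  proof (rule lookahead_sparse[OF k P_potential])
    fix r :: real assume r: "0 \<le> r" "r < \<beta>"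
    show "P t0 (x0 + r) - P t0 x0 \<le> \<rho> * r + 2 * d"
    proof (cases "c0 + r \<le> cR")
      case True
      have "g t0 c0 \<le> g t0 (c0 + r)" by (rule min) (use t0 c0 r True in auto)
      then have "smooth_mass d t0 x0 - smooth_mass d t0 (x0 + r) \<le> \<rho> * r"
        by (simp add: g_def x0_def algebra_simps)
      moreover have "x0 + r \<le> - d" using le\<beta>[of t0 "c0 + r"] t0 True d by (simp add: x0_def)
      then have "smooth_mass d t0 (x0 + r) \<le> - P t0 (x0 + r) + d" by (rule ub[OF t0(1)])
      ultimately show ?thesis using lb[OF t0(1) x0(2)] by simp
    next
      case False
      have "P t0 (x0 + r) \<le> 0" by (rule Pneg) (use x0 r in auto)
      moreover have "\<rho> * (cR - c0) \<le> \<rho> * r" using False \<rho> by (intro mult_left_mono) auto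
      ultimately show ?thesis using lb[OF t0(1) x0(2)] A_small d by simp
    qed
  qed (use \<rho> d in auto)
  then have v0: "q + k 0 * d \<le> v t0 x0" using slow by (simp add: v_def algebra_simps)
  \<comment> \<open>The third \<open>k 0 * d\<close> in \<open>slow\<close> pays for the width of the mollifier.\<close>
  have vq: "q \<le> v t0 z" if "x0 \<le> z" "z \<le> x0 + d" for z
  proof -
    have "k 0 * \<bar>x0 - z\<bar> \<le> k 0 * d" using that K by (intro mult_left_mono) auto
    then show ?thesis using v_lipschitz[of t0 x0 z] v0 by (simp add: abs_le_iff)
  qed
  define D where "D = (LBINT z. U t0 z * ((v t0 z - q) * mollifier d (c0 + q * t0) z))"
  have D: "0 \<le> D"
    unfolding D_def
  proof (rule integral_nonneg_AE, rule AE_I2)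
    fix z
    show "0 \<le> U t0 z * ((v t0 z - q) * mollifier d (c0 + q * t0) z)"
    proof (cases "x0 \<le> z \<and> z \<le> x0 + d")
      case True
      then show ?thesis using vq[of z] U_range mollifier_nonneg[OF d(1)] by (intro mult_nonneg_nonneg) auto
    next
      case False
      then show ?thesis using mollifier_zero[OF d(1), of z x0] by (auto simp: x0_def)
    qed
  qed
  have "((\<lambda>s. smooth_mass d s (c0 + q * s)) has_real_derivative D) (at t0 within {0..})"
    unfolding D_def
    by (rule smooth_mass_curve[where L="\<bar>q\<bar>" and \<xi>="\<lambda>s. c0 + q * s", OF d(1) t0(1)])
      (auto intro!: derivative_eq_intros simp: abs_mult[symmetric] right_diff_distrib)
  moreover have "at t0 within {0..} = at t0" by (rule at_within_interior) (use t0' in auto)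
  ultimately have "((\<lambda>s. smooth_mass d s (c0 + q * s)) has_real_derivative D) (at t0)" by simp
  then have "((\<lambda>s. g s c0) has_real_derivative D + \<gamma>) (at t0)"
    unfolding g_def by (auto intro!: derivative_eq_intros)
  moreover have "0 < D + \<gamma>" using D \<gamma> by simp
  ultimately obtain e where e: "0 < e" "\<And>h. 0 < h \<Longrightarrow> h < e \<Longrightarrow> g (t0 - h) c0 < g t0 c0"
    using DERIV_pos_inc_left by blast
  define h where "h = min (e/2) t0"
  have "0 < h" "h < e" "h \<le> t0" using e t0' by (auto simp: h_def)
  then have "g (t0 - h) c0 < g t0 c0" using e by simp
  moreover have "g t0 c0 \<le> g (t0 - h) c0" by (rule min) (use \<open>0 < h\<close> \<open>h \<le> t0\<close> t0 c0 in auto)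
  ultimately show False by simp
qed

text \<open>If the claim failed at \<open>x\<close>, choose a car of the platoon with more mass \<open>m\<close> ahead of it than there is ahead of \<open>x\<close>, but not more than there was initially
  ahead of \<open>a\<close>. It arrives at a point $y \ge x$, and the true mass ahead of \<open>y\<close> is smaller than \<open>m\<close> by at least \<open>gap\<close>. The errors of the smooth
  version are chosen to be at most half of that.\<close>

theorem platoon_comparison:
  assumes \<tau>: "0 < \<tau>" and a: "a < 0" "- a \<le> q * \<tau>" and q: "0 \<le> q" and \<rho>: "0 < \<rho>" and \<beta>: "0 < \<beta>"
    and slow: "\<rho> + level_tail k \<beta> + q < 1" and x: "x \<le> 0"
    and label: "- P \<tau> x < - P 0 a"
  shows "\<rho> * (- \<beta> - x) \<le> - P \<tau> x"
proof (rule ccontr)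
  assume contr: "\<not> ?thesis"
  have Pneg: "P \<tau> x \<le> 0" using potential_mono[OF P_potential x, of \<tau>] by (simp add: primitive_def)
  define m where "m = min (\<rho> * (- \<beta> - x)) (- P 0 a)"
  have m: "- P \<tau> x < m" using contr label by (simp add: m_def)
  \<comment> \<open>The place at time \<open>\<tau>\<close> of the car of the platoon with the mass \<open>m\<close> ahead of it.\<close>
  define y where "y = - \<beta> - m / \<rho>"
  have xy: "x \<le> y" using \<rho> by (simp add: y_def m_def field_simps min_def)
  have yb: "y \<le> - \<beta>" using m Pneg \<rho> by (simp add: y_def)
  have "- P \<tau> y \<le> - P \<tau> x" using potential_mono[OF P_potential xy, of \<tau>] by simp
  define gap where "gap = m + P \<tau> x"
  have gap: "0 < gap" using m by (simp add: gap_def)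
  define \<gamma> where "\<gamma> = gap / (4 * \<tau>)"
  define room where "room = 1 - (\<rho> + level_tail k \<beta> + q)"
  have room: "0 < room" using slow by (simp add: room_def)
  define d where "d = min (min \<beta> (gap / 4)) (room / (3 * k 0))"
  have d: "0 < d" "d \<le> \<beta>" "d \<le> gap / 4" using \<beta> gap room K by (auto simp: d_def)
  have "d * (3 * k 0) \<le> room / (3 * k 0) * (3 * k 0)" using K by (intro mult_right_mono) (auto simp: d_def)
  then have dr: "3 * k 0 * d \<le> room" using K by (simp add: field_simps)
  have eq: "\<rho> * (- \<beta> - q * \<tau> - (y - q * \<tau>)) = m" using \<rho> by (simp add: y_def)
  have "\<rho> * (- \<beta> - q * \<tau> - (y - q * \<tau>)) - \<gamma> * \<tau> \<le> smooth_mass d \<tau> ((y - q * \<tau>) + q * \<tau>)"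
  proof (rule platoon_comparison_smooth[OF \<tau> a q \<rho> \<beta> d(1,2)])
    show "0 < \<gamma>" using gap \<tau> by (simp add: \<gamma>_def)
    show "\<rho> + level_tail k \<beta> + q + 3 * k 0 * d \<le> 1" using dr by (simp add: room_def)
    show "\<rho> * (- \<beta> - q * \<tau> - (y - q * \<tau>)) \<le> - P 0 a" unfolding eq by (simp add: m_def)
    show "y - q * \<tau> \<le> - \<beta> - q * \<tau>" using yb by simp
  qed
  then have "m - gap / 4 \<le> smooth_mass d \<tau> y" unfolding eq using \<tau> by (simp add: \<gamma>_def)
  also have "\<dots> \<le> - P \<tau> y + d" by (rule smooth_mass_bounds(2)[OF d(1)]) (use \<tau> yb d in auto)
  finally show False using \<open>- P \<tau> y \<le> - P \<tau> x\<close> d gap gap_def by linarith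
qed

end

section \<open>The initial datum and its oscillations\<close>

text \<open>A solution is only given almost everywhere at each time. The representative has values in $[0,1]$ everywhere, and it satisfies the weak equation
  because it agrees with the given one almost everywhere in the plane.\<close>

lemma bounded_borel_representative:
  assumes k: "monotone_kernel k" and sol: "cauchy_solution (\<lambda>r. 1 - r) k u0 u"
  obtains U where "weak_solution k U" "\<And>t. 0 \<le> t \<Longrightarrow> AE x in lborel. U t x = u t x"
proof -
  \<comment> \<open>At negative times \<open>u\<close> need not be measurable.\<close>
  define uu where "uu p = indicator ({0..} \<times> UNIV) p *\<^sub>R (case p of (t, x) \<Rightarrow> u t x)" for p :: "real \<times> real"
  define U where "U t x = max 0 (min 1 (uu (t, x)))" for t x
  have uum[measurable]: "uu \<in> borel_measurable borel"
    using sol unfolding cauchy_solution_def set_borel_measurable_def uu_def[abs_def] by auto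
  have Um: "(\<lambda>(t, x). U t x) \<in> borel_measurable borel"
  proof -
    have "(\<lambda>(t, x). U t x) = (\<lambda>p. max 0 (min 1 (uu p)))" by (auto simp: U_def)
    then show ?thesis by simp
  qed
  have ut: "uu (t, x) = u t x" if "0 \<le> t" for t x using that by (simp add: uu_def)
  have sec: "u t \<in> borel_measurable borel" if "0 \<le> t" for t
  proof -
    have "(\<lambda>x. uu (t, x)) \<in> borel_measurable borel"
      by (rule measurable_compose[OF borel_measurable_continuous_onI uum]) (intro continuous_intros)
    then show ?thesis using ut[OF that] by simp
  qed
  have AEU: "AE x in lborel. U t x = u t x" if "0 \<le> t" for t
  proof -
    have "AE x in lborel. 0 \<le> u t x \<and> u t x \<le> 1" using sol that by (auto simp: cauchy_solution_def)
    then show ?thesis by eventually_elim (use ut[OF that] in \<open>auto simp: U_def\<close>)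
  qed
  have Usec[measurable]: "U t \<in> borel_measurable borel" for t
    using measurable_compose[OF borel_measurable_continuous_onI Um, of "\<lambda>x. (t, x)"]
    by (simp add: continuous_intros)
  have L1: "continuous_in_L1_loc U"
    unfolding continuous_in_L1_loc_def
  proof (intro allI impI)
    fix t R :: real assume t: "0 \<le> t" and R: "0 < R"
    have eq: "(LINT x:{-R..R}|lborel. \<bar>U s x - U t x\<bar>) = (LINT x:{-R..R}|lborel. \<bar>u s x - u t x\<bar>)" if s: "0 \<le> s" for s
      unfolding set_lebesgue_integral_def
    proof (rule integral_cong_AE)
      have [measurable]: "u s \<in> borel_measurable borel" "u t \<in> borel_measurable borel" using sec s t by auto
      show "(\<lambda>x. indicator {-R..R} x *\<^sub>R \<bar>u s x - u t x\<bar>) \<in> borel_measurable lborel" by measurable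
      show "AE x in lborel. indicator {-R..R} x *\<^sub>R \<bar>U s x - U t x\<bar> = indicator {-R..R} x *\<^sub>R \<bar>u s x - u t x\<bar>"
        using AEU[OF s] AEU[OF t] by eventually_elim simp
    qed measurable
    have "((\<lambda>s. LINT x:{-R..R}|lborel. \<bar>u s x - u t x\<bar>) \<longlongrightarrow> 0) (at t within {0..})"
      using sol t R by (auto simp: cauchy_solution_def continuous_in_L1_loc_def)
    then show "((\<lambda>s. LINT x:{-R..R}|lborel. \<bar>U s x - U t x\<bar>) \<longlongrightarrow> 0) (at t within {0..})"
      by (rule Lim_transform_eventually) (auto simp: eventually_at eq intro!: exI[of _ 1])
  qed
  interpret L1_curve k U
    by unfold_locales (use k Um L1 in \<open>auto simp: U_def\<close>)
  have conv: "space_convolution u k t x = 1 - v t x" if t: "0 \<le> t" for t x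
  proof -
    have [measurable]: "u t \<in> borel_measurable borel" "k \<in> borel_measurable borel" using sec[OF t] monotone_kernelD(6)[OF k] by auto
    have "AE y in lborel. U t (x - y) = u t (x - y)"
    proof -
      have 1: "(\<integral>\<^sup>+y. indicator {y. U t y \<noteq> u t y} y \<partial>lborel) = (0::ennreal)"
        by (subst nn_integral_0_iff_AE) (use AEU[OF t] in \<open>auto elim!: eventually_mono\<close>)
      have "(\<integral>\<^sup>+y. indicator {y. U t y \<noteq> u t y} y \<partial>lborel) = (\<integral>\<^sup>+y. indicator {y. U t y \<noteq> u t y} (x + (-1) * y) \<partial>lborel :: ennreal)"
        by (subst nn_integral_real_affine[where c="-1" and t=x]) auto
      then have 2: "(\<integral>\<^sup>+y. indicator {y. U t y \<noteq> u t y} (x - y) \<partial>lborel) = (0::ennreal)" using 1 by simp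
      have "AE y in lborel. indicator {y. U t y \<noteq> u t y} (x - y) = (0::ennreal)"
        by (rule nn_integral_0_iff_AE[THEN iffD1, OF _ 2]) measurable
      then show ?thesis by eventually_elim (auto simp: indicator_def split: if_splits)
    qed
    then have "space_convolution u k t x = space_convolution U k t x"
      unfolding space_convolution_def by (intro integral_cong_AE) auto
    also have "\<dots> = 1 - v t x" by (rule convolution_U)
    finally show ?thesis .
  qed
  have "distributional_solution (\<lambda>r. 1 - r) k U"
    unfolding distributional_solution_def
  proof (intro allI impI)
    fix \<phi> assume test: "test_function \<phi>"
    then obtain f1 f2 T0 T R where
      d: "\<And>p. (\<phi> has_derivative (\<lambda>h. fst h * f1 p + snd h * f2 p)) (at p)"
      and c1: "continuous_on UNIV f1" and c2: "continuous_on UNIV f2" and T0: "0 < T0"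
      and z: "\<And>t x. \<not> (T0 \<le> t \<and> t \<le> T \<and> \<bar>x\<bar> \<le> R) \<Longrightarrow> \<phi> (t, x) = 0 \<and> f1 (t, x) = 0 \<and> f2 (t, x) = 0"
      by (rule test_functionE) blast
    define g where "g p = f1 p + v (max 0 (fst p)) (snd p) * f2 p" for p
    have gc: "continuous_on UNIV g" unfolding g_def
      by (intro continuous_intros continuous_on_extend_halfplane[OF v_cont] c1 c2)
    have [measurable]: "g \<in> borel_measurable borel" by (rule borel_measurable_continuous_onI[OF gc])
    have g0: "f1 (t, x) = 0 \<and> f2 (t, x) = 0 \<and> g (t, x) = 0" if "t < 0" for t x
      using z[of t x] that T0 by (auto simp: g_def)
    have Iu: "u t x * deriv (\<lambda>s. \<phi> (s, x)) t + u t x * (\<lambda>r. 1 - r) (space_convolution u k t x) * deriv (\<lambda>y. \<phi> (t, y)) x = uu (t, x) * g (t, x)" for t x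
    proof (cases "0 \<le> t")
      case True
      then show ?thesis unfolding partial_deriv[OF d] conv[OF True] ut[OF True] by (simp add: g_def algebra_simps)
    next
      case False
      then show ?thesis unfolding partial_deriv[OF d] using g0[of t x] by simp
    qed
    have IU: "U t x * deriv (\<lambda>s. \<phi> (s, x)) t + U t x * (\<lambda>r. 1 - r) (space_convolution U k t x) * deriv (\<lambda>y. \<phi> (t, y)) x = U t x * g (t, x)" for t x
    proof (cases "0 \<le> t")
      case True
      then show ?thesis unfolding partial_deriv[OF d] convolution_U by (simp add: g_def algebra_simps)
    next
      case False
      then show ?thesis unfolding partial_deriv[OF d] using g0[of t x] by simp
    qed
    have Um': "(\<lambda>p. U (fst p) (snd p)) \<in> borel_measurable borel" using Um by (simp add: case_prod_beta')
    have "AE p in lborel \<Otimes>\<^sub>M lborel. U (fst p) (snd p) * g p = uu p * g p"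
    proof (rule lborel_pair.AE_pair_measure)
      show "{p \<in> space (lborel \<Otimes>\<^sub>M lborel). U (fst p) (snd p) * g p = uu p * g p} \<in> sets (lborel \<Otimes>\<^sub>M lborel)"
        unfolding lborel_prod using Um' by (intro borel_measurable_eq borel_measurable_times) auto
      show "AE t in lborel. AE x in lborel. U (fst (t, x)) (snd (t, x)) * g (t, x) = uu (t, x) * g (t, x)"
      proof (rule AE_I2)
        fix t :: real
        show "AE x in lborel. U (fst (t, x)) (snd (t, x)) * g (t, x) = uu (t, x) * g (t, x)"
        proof (cases "0 \<le> t")
          case True
          show ?thesis using AEU[OF True] by eventually_elim (simp add: ut[OF True])
        next
          case False
          then show ?thesis using g0 by simp
        qed
      qed
    qed
    then have "integral\<^sup>L lborel (\<lambda>p. U (fst p) (snd p) * g p) = integral\<^sup>L lborel (\<lambda>p. uu p * g p)"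
      unfolding lborel_prod by (intro integral_cong_AE) (use Um' in auto)
    also have "\<dots> = (\<integral>(t, x). u t x * deriv (\<lambda>s. \<phi> (s, x)) t + u t x * (\<lambda>r. 1 - r) (space_convolution u k t x) * deriv (\<lambda>y. \<phi> (t, y)) x \<partial>(lborel :: (real \<times> real) measure))"
      unfolding Iu by (rule Bochner_Integration.integral_cong) auto
    also have "\<dots> = 0" using sol test unfolding cauchy_solution_def distributional_solution_def by blast
    finally show "(\<integral>(t, x). U t x * deriv (\<lambda>s. \<phi> (s, x)) t + U t x * (\<lambda>r. 1 - r) (space_convolution U k t x) * deriv (\<lambda>y. \<phi> (t, y)) x \<partial>(lborel :: (real \<times> real) measure)) = 0"
      unfolding IU by (simp add: case_prod_beta')
  qed
  then have "weak_solution k U" by unfold_locales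
  then show thesis using AEU by (rule that)
qed

lemma AE_interval_witness:
  fixes a b :: real
  assumes ab: "a < b" and Q: "AE x in lborel. x \<in> {a<..<b} \<longrightarrow> Q x"
  obtains x where "a < x" "x < b" "Q x"
proof -
  have "\<exists>x\<in>{a<..<b}. Q x"
  proof (rule ccontr)
    assume "\<not> (\<exists>x\<in>{a<..<b}. Q x)"
    then have "AE x in lborel. x \<notin> {a<..<b}" using Q by (auto elim!: eventually_mono)
    then have "emeasure lborel {a<..<b} = 0" by (subst (asm) AE_iff_measurable[of "{a<..<b}"]) auto
    then show False using ab by simp
  qed
  then show thesis using that by auto
qed

lemma density_witness:
  assumes f: "density_fn f" and ab: "a < b" and gf: "AE x in lborel. g x = f x"
  shows "primitive f b - primitive f a = 0 \<Longrightarrow> \<exists>x. a < x \<and> x < b \<and> g x = 0"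
    "(b - a) / 2 \<le> primitive f b - primitive f a \<Longrightarrow> \<exists>x. a < x \<and> x < b \<and> 1/2 \<le> g x"
proof -
  have [measurable]: "f \<in> borel_measurable borel" using f by simp
  have int: "integrable lborel (\<lambda>x. indicator {a..b} x * f x)"
    using density_fn_integrable[OF f, of "{a..b}"] by (auto simp: set_integrable_def emeasure_lborel_Icc_eq)
  have eq: "(LBINT x. indicator {a..b} x * f x) = primitive f b - primitive f a"
    using primitive_diff[OF f less_imp_le[OF ab]] by (simp add: set_lebesgue_integral_def)
  show "\<exists>x. a < x \<and> x < b \<and> g x = 0" if "primitive f b - primitive f a = 0"
  proof -
    have "AE x in lborel. indicator {a..b} x * f x = 0"
      using integral_nonneg_eq_0_iff_AE[OF int] f that eq by (auto simp: indicator_def)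
    with gf have "AE x in lborel. x \<in> {a<..<b} \<longrightarrow> g x = 0"
      by eventually_elim auto
    then show ?thesis by (rule AE_interval_witness[OF ab]) blast
  qed
  show "\<exists>x. a < x \<and> x < b \<and> 1/2 \<le> g x" if half: "(b - a) / 2 \<le> primitive f b - primitive f a"
  proof (rule ccontr)
    assume "\<not> (\<exists>x. a < x \<and> x < b \<and> 1/2 \<le> g x)"
    then have *: "AE x in lborel. x \<in> {a<..<b} \<longrightarrow> f x < 1/2"
      using gf by (auto elim!: eventually_mono)
    have ends: "AE x in lborel. x \<noteq> a \<and> x \<noteq> b"
      using AE_lborel_singleton[of a] AE_lborel_singleton[of b] by eventually_elim auto
    have int2: "integrable lborel (\<lambda>x. indicator {a..b} x * (1/2 - f x))"
      using Bochner_Integration.integrable_diff[OF integrable_mult_right[OF indicator_Icc_integrable[of a b], of "1/2"] int]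
      by (simp add: algebra_simps)
    have nn: "AE x in lborel. 0 \<le> indicator {a..b} x * (1/2 - f x)"
      using * ends by eventually_elim (auto simp: indicator_def)
    have "(LBINT x. indicator {a..b} x * (1/2 - f x)) = (LBINT x. 1/2 * indicator {a..b} x - indicator {a..b} x * f x)"
      by (rule Bochner_Integration.integral_cong) (auto simp: algebra_simps)
    also have "\<dots> = (b - a) / 2 - (primitive f b - primitive f a)"
      using int eq ab by (subst Bochner_Integration.integral_diff) auto
    finally have "(LBINT x. indicator {a..b} x * (1/2 - f x)) \<le> 0" using half by simp
    moreover have "0 \<le> (LBINT x. indicator {a..b} x * (1/2 - f x))" by (rule integral_nonneg_AE[OF nn])
    ultimately have "AE x in lborel. indicator {a..b} x * (1/2 - f x) = 0"
      using integral_nonneg_eq_0_iff_AE[OF int2 nn] by simp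
    with * have "AE x in lborel. x \<in> {a<..<b} \<longrightarrow> False" by eventually_elim auto
    then show False by (rule AE_interval_witness[OF ab])
  qed
qed

text \<open>If intervals without mass alternate with intervals of average density at least $1/2$, any representative takes values $0$ and at least $1/2$ alternately.\<close>

lemma total_variation_oscillation:
  assumes f: "density_fn f" and y: "\<And>j. y j < y (Suc j)" and gf: "AE x in lborel. g x = f x"
    and even: "\<And>j. j < 2 * n \<Longrightarrow> even j \<Longrightarrow> primitive f (y (Suc j)) - primitive f (y j) = 0"
    and odd: "\<And>j. j < 2 * n \<Longrightarrow> odd j \<Longrightarrow> (y (Suc j) - y j) / 2 \<le> primitive f (y (Suc j)) - primitive f (y j)"
  shows "ennreal (real (2 * n - 1) / 2) \<le> total_variation g"
proof -
  have "\<exists>x. y j < x \<and> x < y (Suc j) \<and> (if even j then g x = 0 else 1/2 \<le> g x)" if "j < 2 * n" for j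
    using density_witness[OF f y gf, of j] even[OF that] odd[OF that] by auto
  then obtain p where p: "\<And>j. j < 2 * n \<Longrightarrow> y j < p j \<and> p j < y (Suc j) \<and> (if even j then g (p j) = 0 else 1/2 \<le> g (p j))"
    by metis
  have mono: "p i \<le> p (Suc i)" if "i < 2 * n - 1" for i
  proof -
    have "i < 2 * n" "Suc i < 2 * n" using that by auto
    then show ?thesis using p[of i] p[of "Suc i"] by force
  qed
  have jump: "1/2 \<le> \<bar>g (p (Suc i)) - g (p i)\<bar>" if "i < 2 * n - 1" for i
  proof -
    have "i < 2 * n" "Suc i < 2 * n" using that by auto
    then show ?thesis using p[of i] p[of "Suc i"] by (cases "even i") auto
  qed
  have "ennreal (real (2 * n - 1) / 2) = (\<Sum>i<2 * n - 1. ennreal (1/2))"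
    by (subst sum_ennreal) auto
  also have "\<dots> \<le> (\<Sum>i<2 * n - 1. ennreal \<bar>g (p (Suc i)) - g (p i)\<bar>)"
    by (intro sum_mono ennreal_leI jump) auto
  also have "\<dots> \<le> total_variation g"
    unfolding total_variation_def by (rule SUP_upper2[of "(2 * n - 1, p)"]) (use mono in auto)
  finally show ?thesis .
qed

text \<open>The gap at scale $4^{-n}$ is followed by a platoon between $-4^{-n}/2$ and $-4^{-n}/4$. All end points are thus of the form $-2^{-j}$, and gaps and platoons alternate.\<close>

definition vacuum :: "real set" where
  "vacuum = {..-1} \<union> {0..} \<union> (\<Union>n::nat. {- ((1/4)^n) .. - ((1/4)^n) / 2})"

definition datum :: "real \<Rightarrow> real" where
  "datum x = (if 0 \<le> x then 1 else infdist x vacuum)"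

lemma infdist_vacuum_lipschitz: "\<bar>infdist x vacuum - infdist y vacuum\<bar> \<le> \<bar>x - y\<bar>"
  using infdist_triangle[of x vacuum y] infdist_triangle[of y vacuum x]
  by (simp add: dist_real_def abs_le_iff abs_minus_commute)

lemma infdist_vacuum_le: "x \<le> 0 \<Longrightarrow> infdist x vacuum \<le> - x"
  using infdist_le[of 0 vacuum x] by (simp add: vacuum_def dist_real_def)

lemma infdist_vacuum_zero: "x \<in> vacuum \<Longrightarrow> infdist x vacuum = 0"
  by simp

lemma datum_range: "0 \<le> datum x" "datum x \<le> 1"
proof -
  show "0 \<le> datum x" by (simp add: datum_def infdist_nonneg)
  have "infdist x vacuum \<le> 1" if "x < 0"
  proof (cases "x \<le> -1")
    case True
    then show ?thesis using infdist_vacuum_zero[of x] by (simp add: vacuum_def)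
  next
    case False
    then show ?thesis using infdist_vacuum_le[of x] that by simp
  qed
  then show "datum x \<le> 1" by (simp add: datum_def)
qed

lemma datum_density: "density_fn datum"
proof -
  have m: "(\<lambda>x. infdist x vacuum) \<in> borel_measurable borel"
    by (rule borel_measurable_continuous_onI) (intro continuous_on_infdist continuous_on_id)
  have "datum \<in> borel_measurable borel" unfolding datum_def[abs_def]
    by (rule measurable_If[OF _ m]) simp_all
  then show ?thesis unfolding density_fn_def using datum_range by blast
qed

lemma datum_one_sided: "x < y \<Longrightarrow> - (y - x) \<le> datum y - datum x"
proof -
  assume xy: "x < y"
  show ?thesis
  proof (cases "0 \<le> y")
    case True
    then have "datum x \<le> datum y" using datum_range(2)[of x] by (simp add: datum_def)
    then show ?thesis using xy by simp
  next
    case False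
    then have "datum x = infdist x vacuum" "datum y = infdist y vacuum" using xy by (auto simp: datum_def)
    then show ?thesis using infdist_vacuum_lipschitz[of x y] xy by simp
  qed
qed

lemma datum_Lip_minus: "Lip_minus datum < \<infinity>"
proof -
  have "ereal (-1) \<le> (INF (x, y) \<in> {(x, y). x < y}. ereal ((datum y - datum x) / (y - x)))"
    by (rule INF_greatest) (use datum_one_sided in \<open>auto simp: field_simps\<close>)
  then have "Lip_minus datum \<le> - ereal (-1)"
    unfolding Lip_minus_def by (simp only: ereal_minus_le_minus)
  also have "\<dots> < \<infinity>" by simp
  finally show ?thesis .
qed

lemma datum_total_variation: "total_variation datum \<le> 2"
proof -
  define h where "h x = max (-1) (min x 0) + (if 0 \<le> x then 1 else 0)" for x :: real
  have step: "\<bar>datum y - datum x\<bar> \<le> h y - h x" if xy: "x \<le> y" for x y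
  proof -
    have c: "infdist z vacuum = infdist (max (-1) z) vacuum" for z
      by (cases "z \<le> -1") (auto simp: vacuum_def max_def)
    consider "y < 0" | "x < 0" "0 \<le> y" | "0 \<le> x" by linarith
    then show ?thesis
    proof cases
      case 1
      have "\<bar>infdist y vacuum - infdist x vacuum\<bar> \<le> \<bar>max (-1) y - max (-1) x\<bar>"
        unfolding c[of x] c[of y] by (rule infdist_vacuum_lipschitz)
      then show ?thesis using 1 xy by (auto simp: datum_def h_def)
    next
      case 2
      then show ?thesis using datum_range[of x] by (auto simp: datum_def h_def)
    next
      case 3
      then show ?thesis using xy by (auto simp: datum_def h_def)
    qed
  qed
  show ?thesis unfolding total_variation_def
  proof (rule SUP_least, clarify)
    fix n :: nat and x :: "nat \<Rightarrow> real" assume x: "\<forall>i<n. x i \<le> x (Suc i)"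
    have "(\<Sum>i<n. ennreal \<bar>datum (x (Suc i)) - datum (x i)\<bar>) = ennreal (\<Sum>i<n. \<bar>datum (x (Suc i)) - datum (x i)\<bar>)"
      by (rule sum_ennreal) auto
    also have "\<dots> \<le> ennreal (\<Sum>i<n. h (x (Suc i)) - h (x i))"
      by (intro ennreal_leI sum_mono step) (use x in auto)
    also have "(\<Sum>i<n. h (x (Suc i)) - h (x i)) = h (x n) - h (x 0)" by (rule sum_lessThan_telescope)
    also have "ennreal (h (x n) - h (x 0)) \<le> ennreal 2"
      by (rule ennreal_leI) (auto simp: h_def)
    finally show "(\<Sum>i<n. ennreal \<bar>datum (x (Suc i)) - datum (x i)\<bar>) \<le> 2" by simp
  qed
qed

lemma datum_gap: "primitive datum (- ((1/4)^n) / 2) - primitive datum (- ((1/4)^n)) = 0"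
proof -
  have "primitive datum (- ((1/4)^n) / 2) - primitive datum (- ((1/4)^n)) = (LBINT z:{- ((1/4)^n)..- ((1/4)^n) / 2}. datum z)"
    by (rule primitive_diff[OF datum_density]) simp
  also have "\<dots> = (LBINT z:{- ((1/4)^n)..- ((1/4)^n) / 2 :: real}. 0)"
  proof (rule set_lebesgue_integral_cong, simp, intro allI impI)
    fix z :: real assume z: "z \<in> {- ((1/4)^n)..- ((1/4)^n) / 2}"
    have "0 < (1/4::real)^n" by simp
    then have "z < 0" using z by (simp only: atLeastAtMost_iff) linarith
    moreover have "z \<in> vacuum" using z by (auto simp: vacuum_def)
    ultimately show "datum z = 0" by (simp add: datum_def)
  qed
  finally show ?thesis by simp
qed

lemma datum_bump:
  fixes n :: nat
  defines "s \<equiv> (1/4)^n :: real"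
  shows "s\<^sup>2 / 128 \<le> primitive datum (- s / 4) - primitive datum (- s / 2)"
proof -
  have s: "0 < s" by (simp add: s_def)
  have far: "z \<le> - s / 2 \<or> - s / 4 \<le> z" if zE: "z \<in> vacuum" for z
  proof -
    have s1: "s \<le> 1" by (simp add: s_def power_le_one)
    consider "z \<le> -1" | "0 \<le> z" | m where "- ((1/4)^m) \<le> z" "z \<le> - ((1/4)^m) / 2" using zE by (auto simp: vacuum_def)
    then show ?thesis
    proof cases
      case (3 m)
      show ?thesis
      proof (cases "m \<le> n")
        case True
        then have "s \<le> (1/4)^m" unfolding s_def by (intro power_decreasing) auto
        then show ?thesis using 3 by simp
      next
        case False
        then have "(1/4)^m \<le> (1/4::real)^Suc n" by (intro power_decreasing) auto
        then show ?thesis using 3 by (simp add: s_def)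
      qed
    qed (use s s1 in auto)
  qed
  \<comment> \<open>This is the middle half of the platoon, at the distance $s/16$ from its ends.\<close>
  have low: "s / 16 \<le> datum x" if x: "- 7 * s / 16 \<le> x" "x \<le> - 5 * s / 16" for x
  proof -
    have ne: "vacuum \<noteq> {}" by (auto simp: vacuum_def)
    have "s / 16 \<le> infdist x vacuum"
      unfolding infdist_notempty[OF ne]
    proof (rule cINF_greatest[OF ne])
      show "s / 16 \<le> dist x z" if "z \<in> vacuum" for z
        using far[OF that] x s by (auto simp: dist_real_def)
    qed
    then show ?thesis using x s by (simp add: datum_def)
  qed
  have "s\<^sup>2 / 128 = (LBINT z. indicator {- 7 * s / 16..- 5 * s / 16} z * (s / 16))"
    using s by (simp add: power2_eq_square)
  also have "\<dots> \<le> (LBINT z. indicator {- s / 2..- s / 4} z * datum z)"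
  proof (rule integral_mono)
    show "integrable lborel (\<lambda>z. indicator {- s / 2..- s / 4} z * datum z)"
      using density_fn_integrable[OF datum_density, of "{- s / 2..- s / 4}"] by (auto simp: set_integrable_def emeasure_lborel_Icc_eq)
    show "indicator {- 7 * s / 16..- 5 * s / 16} z * (s / 16) \<le> indicator {- s / 2..- s / 4} z * datum z" for z
      using low[of z] datum_range[of z] s by (auto simp: indicator_def)
  qed (intro integrable_mult_left indicator_Icc_integrable)
  also have "\<dots> = primitive datum (- s / 4) - primitive datum (- s / 2)"
    using primitive_diff[OF datum_density, of "- s / 2" "- s / 4"] s by (simp add: set_lebesgue_integral_def)
  finally show ?thesis .
qed

lemma datum_mass:
  assumes s: "0 < s" shows "- primitive datum (- s) \<le> s\<^sup>2"
proof -
  have "- primitive datum (- s) = (LBINT z. indicator {- s..0} z * datum z)"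
    using primitive_diff[OF datum_density, of "- s" 0] s by (simp add: set_lebesgue_integral_def primitive_def)
  also have "\<dots> \<le> (LBINT z. indicator {- s..0} z * s)"
  proof (rule integral_mono_AE)
    show "integrable lborel (\<lambda>z. indicator {- s..0} z * datum z)"
      using density_fn_integrable[OF datum_density, of "{- s..0}"] by (auto simp: set_integrable_def emeasure_lborel_Icc_eq)
    show "AE z in lborel. indicator {- s..0} z * datum z \<le> indicator {- s..0} z * s"
      using AE_lborel_singleton[of "0::real"]
    proof eventually_elim
      case (elim z)
      show ?case using elim infdist_vacuum_le[of z] by (auto simp: indicator_def datum_def)
    qed
  qed (intro integrable_mult_left indicator_Icc_integrable)
  also have "\<dots> = s\<^sup>2" using s by (simp add: power2_eq_square)
  finally show ?thesis .
qed

lemma primitive_cong_AE: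
  assumes "density_fn f" "density_fn g" "AE x in lborel. f x = g x"
  shows "primitive f = primitive g"
proof
  fix x
  have [measurable]: "f \<in> borel_measurable borel" "g \<in> borel_measurable borel" using assms by auto
  show "primitive f x = primitive g x"
    unfolding primitive_def set_lebesgue_integral_def
    by (intro arg_cong2[where f="(-)"] integral_cong_AE) (use assms(3) in auto)
qed

section \<open>Blow-up of the total variation\<close>

text \<open>The cars that start at $-2^{-j}$ mark the ends of gaps and platoons at all later times. The platoons \<open>n0 + 1\<close> to \<open>n0 + n\<close> are compressed at
  time \<open>\<tau>\<close> by \<open>platoon_comparison\<close> with $\rho = 64/65$ and $q = 1/130$: a platoon at scale $s$ has a mass of at least $s^2/128$, and the mass
  ahead of its rear is at most $s^2/4$. So the empty road $(1/\rho - 1)\,s^2/4 = s^2/256$ and the margin \<open>\<beta>\<close>, which is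
  $s^2/256$ for the smallest of these scales, together do not exceed its mass.\<close>

lemma (in jam_solution) oscillation_at_time:
  assumes init: "AE x in lborel. U 0 x = datum x" and \<tau>: "0 < \<tau>"
    and n0: "(1/4)^n0 \<le> \<tau> / 130"
    and tail: "level_tail k (((1/4)^(n0 + n))\<^sup>2 / 256) < 1 / 130"
    and gU: "AE x in lborel. g x = U \<tau> x"
  shows "ennreal (real (2 * n - 1) / 2) \<le> total_variation g"
proof -
  define c :: "nat \<Rightarrow> real" where "c j = - ((1/2)^j)" for j
  have c_neg: "c j < 0" and c_less: "c j < c (Suc j)" for j by (simp_all add: c_def)
  have c_even: "c (2 * i) = - ((1/4)^i)" and c_odd: "c (Suc (2 * i)) = - ((1/4)^i) / 2" for i
    by (simp_all add: c_def power_mult power2_eq_square)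
  have P0: "P 0 = primitive datum" by (rule primitive_cong_AE[OF U_density datum_density init])
  have "\<exists>X. X 0 = c j \<and> characteristic X" for j using characteristic_exists[of "c j"] by blast
  then obtain X where X0: "\<And>j. X j 0 = c j" and X: "\<And>j. characteristic (X j)" by metis
  define x where "x j = X j \<tau>" for j
  have x_less: "x j < x (Suc j)" for j
    unfolding x_def by (rule characteristic_separation[OF X X]) (use X0 c_less \<tau> in auto)
  have x_neg: "x j < 0" for j
    unfolding x_def by (rule characteristic_negative[OF X]) (use X0 c_neg \<tau> in auto)
  have label: "P \<tau> (x j) = primitive datum (c j)" for j
    using characteristic_label[OF X, of j \<tau>] X0 c_neg[of j] \<tau> P0 by (simp add: x_def)
  define \<beta> where "\<beta> = ((1/4)^(n0 + n))\<^sup>2 / (256::real)"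
  have \<beta>: "0 < \<beta>" by (simp add: \<beta>_def)
  have mono: "primitive datum y \<le> primitive datum z" if "y \<le> z" for y z
    by (rule potential_mono[OF primitive_potential[OF datum_density] that])
  have gap: "P \<tau> (x (Suc (2 * i))) - P \<tau> (x (2 * i)) = 0" for i
    unfolding label c_even c_odd using datum_gap[of i] by simp
  have bump: "(x (Suc (Suc (2 * i))) - x (Suc (2 * i))) / 2 \<le> P \<tau> (x (Suc (Suc (2 * i)))) - P \<tau> (x (Suc (2 * i)))"
    if i: "n0 < i" "i \<le> n0 + n" for i
  proof -
    define s :: real where "s = (1/4)^i"
    have s: "0 < s" by (simp add: s_def)
    have c1: "c (Suc (2 * i)) = - s / 2" by (simp add: c_odd s_def)
    have c2: "c (Suc (Suc (2 * i))) = - s / 4" using c_even[of "Suc i"] by (simp add: s_def)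
    define L where "L = x (Suc (2 * i))"
    define R where "R = x (Suc (Suc (2 * i)))"
    define m where "m = P \<tau> R - P \<tau> L"
    have m: "s\<^sup>2 / 128 \<le> m" using datum_bump[of i] by (simp add: m_def L_def R_def label c1 c2 s_def)
    have PL: "- P \<tau> L \<le> s\<^sup>2 / 4"
      using datum_mass[of "s/2"] s by (simp add: L_def label c1 power_divide)
    have "\<beta> \<le> s\<^sup>2 / 256"
      unfolding \<beta>_def s_def using i by (intro divide_right_mono power_mono power_decreasing) auto
    \<comment> \<open>The car from the rear end of the gap at scale \<open>n0\<close> reaches the jam in time at speed $1/130$, and there is a platoon between it and all cars considered here.\<close>
    have "(64/65) * (- \<beta> - L) \<le> - P \<tau> L"
    proof (rule platoon_comparison[where a="c (2 * n0)" and q="1/130"])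
      show "c (2 * n0) < 0" by (rule c_neg)
      show "- c (2 * n0) \<le> 1 / 130 * \<tau>" using n0 by (simp add: c_even)
      show "64/65 + level_tail k \<beta> + 1/130 < 1" using tail by (simp add: \<beta>_def)
      show "L \<le> 0" using x_neg[of "Suc (2 * i)"] by (simp add: L_def)
      have "primitive datum (c (2 * n0)) \<le> primitive datum (c (Suc (2 * n0)))" by (rule mono) (simp add: less_imp_le[OF c_less])
      also have "\<dots> < primitive datum (c (2 * Suc n0))"
      proof -
        have "0 < ((1/4::real)^n0)\<^sup>2 / 128" by simp
        moreover have c2: "c (2 * Suc n0) = - ((1/4)^n0) / 4" unfolding c_even by simp
        ultimately show ?thesis using datum_bump[of n0] unfolding c_odd c2 by linarith
      qed
      also have "\<dots> \<le> primitive datum (c (Suc (2 * i)))"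
      proof (rule mono)
        have "(1/2::real)^(Suc (2 * i)) \<le> (1/2)^(2 * Suc n0)" using i by (intro power_decreasing) auto
        then show "c (2 * Suc n0) \<le> c (Suc (2 * i))" by (simp add: c_def)
      qed
      finally show "- P \<tau> L < - P 0 (c (2 * n0))" by (simp add: L_def label P0)
    qed (use \<tau> \<beta> in auto)
    \<comment> \<open>The length $R - L$ is at most the mass \<open>m\<close> plus the empty road between \<open>L\<close> and the jam.\<close>
    then have "- 64 * L \<le> - 65 * P \<tau> L + 64 * \<beta>" by (simp add: field_simps)
    moreover have "- P \<tau> R \<le> - R"
      using potential_lip[OF P_potential, of R 0 \<tau>] x_neg[of "Suc (Suc (2 * i))"] by (simp add: R_def primitive_def)
    moreover have "s\<^sup>2 \<le> 128 * m" "- 4 * P \<tau> L \<le> s\<^sup>2" "256 * \<beta> \<le> s\<^sup>2"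
      using m PL \<open>\<beta> \<le> s\<^sup>2 / 256\<close> by simp_all
    ultimately have "R - L \<le> 2 * m" unfolding m_def by simp
    then show ?thesis by (simp add: L_def R_def m_def)
  qed
  show ?thesis
  \<comment> \<open>An even index belongs to the rear end of a gap, the next one to the rear end of the platoon ahead of it.\<close>
  proof (rule total_variation_oscillation[OF U_density[of \<tau>], where y="\<lambda>j. x (2 * Suc n0 + j)"])
    show "x (2 * Suc n0 + j) < x (2 * Suc n0 + Suc j)" for j using x_less by simp
    show "AE x in lborel. g x = U \<tau> x" by (rule gU)
    show "P \<tau> (x (2 * Suc n0 + Suc j)) - P \<tau> (x (2 * Suc n0 + j)) = 0" if "j < 2 * n" "even j" for j
      using that gap[of "Suc n0 + j div 2"] by (auto elim!: evenE)
    show "(x (2 * Suc n0 + Suc j) - x (2 * Suc n0 + j)) / 2 \<le> P \<tau> (x (2 * Suc n0 + Suc j)) - P \<tau> (x (2 * Suc n0 + j))"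
      if "j < 2 * n" "odd j" for j
      using that bump[of "Suc n0 + j div 2"] by (auto elim!: oddE)
  qed
qed

theorem theorem6:
  fixes V \<eta> :: "real \<Rightarrow> real"
  assumes V: "\<And>r. V r = 1 - r"
    and \<eta>: "\<eta> = indicat_real {-1..0} \<or>
      ((\<forall>x. 0 \<le> \<eta> x) \<and> (\<forall>x>0. \<eta> x = 0) \<and>
       integrable lborel \<eta> \<and> (LBINT x. \<eta> x) = 1 \<and>
       (\<exists>L. L-lipschitz_on {..0} \<eta>) \<and>
       (AE x in lborel. x \<le> 0 \<longrightarrow> (\<exists>d\<ge>0. (\<eta> has_real_derivative d) (at x))))"
  shows "\<exists>u0 :: real \<Rightarrow> real.
    u0 \<in> borel_measurable borel \<and>
    (AE x in lborel. 0 \<le> u0 x \<and> u0 x \<le> 1) \<and>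
    ess_total_variation u0 < \<infinity> \<and>
    (\<exists>v. (AE x in lborel. v x = u0 x) \<and> Lip_minus v < \<infinity>) \<and>
    (\<forall>\<epsilon>>0. \<exists>u. cauchy_solution V (rescaled_kernel \<eta> \<epsilon>) u0 u) \<and>
    (\<forall>u. (\<forall>\<epsilon>>0. cauchy_solution V (rescaled_kernel \<eta> \<epsilon>) u0 (u \<epsilon>)) \<longrightarrow>
      (\<forall>\<tau>>0. (SUP \<epsilon> \<in> {0<..}. ess_total_variation (u \<epsilon> \<tau>)) = \<infinity>))"
proof (rule exI[of _ datum], intro conjI allI impI)
  have k: "monotone_kernel \<eta>" by (rule admissible_kernel_monotone[OF \<eta>])
  show "datum \<in> borel_measurable borel" using datum_density by simp
  show "AE x in lborel. 0 \<le> datum x \<and> datum x \<le> 1" using datum_range by simp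
  have "ess_total_variation datum \<le> total_variation datum"
    unfolding ess_total_variation_def by (rule INF_lower) simp
  also have "\<dots> \<le> 2" by (rule datum_total_variation)
  also have "\<dots> < \<infinity>" by simp
  finally show "ess_total_variation datum < \<infinity>" .
  show "\<exists>v. (AE x in lborel. v x = datum x) \<and> Lip_minus v < \<infinity>"
    using datum_Lip_minus by (intro exI[of _ datum]) simp
  fix \<epsilon> :: real assume "0 < \<epsilon>"
  then show "\<exists>u. cauchy_solution V (rescaled_kernel \<eta> \<epsilon>) datum u"
    by (intro cauchy_solution_exists[OF rescaled_monotone[OF k] datum_density V])
next
  have k: "monotone_kernel \<eta>" by (rule admissible_kernel_monotone[OF \<eta>])
  have V_eq: "V = (\<lambda>r. 1 - r)" using V by auto
  fix u :: "real \<Rightarrow> real \<Rightarrow> real \<Rightarrow> real" and \<tau> :: real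
  assume sol: "\<forall>\<epsilon>>0. cauchy_solution V (rescaled_kernel \<eta> \<epsilon>) datum (u \<epsilon>)" and \<tau>: "0 < \<tau>"
  have large: "of_nat N \<le> (SUP \<epsilon> \<in> {0<..}. ess_total_variation (u \<epsilon> \<tau>))" for N :: nat
  proof -
    obtain n0 where n0: "(1/4::real)^n0 < \<tau> / 130" using real_arch_pow_inv[of "\<tau> / 130" "1/4"] \<tau> by auto
    define n where "n = Suc N"
    have "0 < ((1/4::real)^(n0 + n))\<^sup>2 / 256" by simp
    from level_tail_small[OF k this, of "1/130"] obtain \<epsilon> where \<epsilon>: "0 < \<epsilon>"
      and tail: "level_tail (rescaled_kernel \<eta> \<epsilon>) (((1/4)^(n0 + n))\<^sup>2 / 256) < 1 / 130" by auto
    have sol': "cauchy_solution (\<lambda>r. 1 - r) (rescaled_kernel \<eta> \<epsilon>) datum (u \<epsilon>)" using sol \<epsilon> V_eq by simp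
    obtain U where U: "weak_solution (rescaled_kernel \<eta> \<epsilon>) U"
      and Uu: "\<And>t. 0 \<le> t \<Longrightarrow> AE x in lborel. U t x = u \<epsilon> t x"
      using bounded_borel_representative[OF rescaled_monotone[OF k \<epsilon>] sol'] by blast
    have "AE x in lborel. u \<epsilon> 0 x = datum x" using sol' by (simp add: cauchy_solution_def)
    with Uu[of 0, simplified] have init: "AE x in lborel. U 0 x = datum x" by eventually_elim simp
    interpret weak_solution "rescaled_kernel \<eta> \<epsilon>" U by (rule U)
    interpret jam_solution "rescaled_kernel \<eta> \<epsilon>" U
      by unfold_locales (use init in \<open>eventually_elim, simp add: datum_def\<close>)
    have "of_nat N \<le> ennreal (real (2 * n - 1) / 2)"
      by (simp add: n_def ennreal_of_nat_eq_real_of_nat field_simps)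
    also have "\<dots> \<le> ess_total_variation (u \<epsilon> \<tau>)"
      unfolding ess_total_variation_def
    proof (rule INF_greatest)
      fix g assume "g \<in> {g. AE x in lborel. g x = u \<epsilon> \<tau> x}"
      then have "AE x in lborel. g x = u \<epsilon> \<tau> x" by simp
      with Uu[of \<tau>] \<tau> have "AE x in lborel. g x = U \<tau> x" by (auto elim: eventually_elim2)
      then show "ennreal (real (2 * n - 1) / 2) \<le> total_variation g"
        by (rule oscillation_at_time[OF init \<tau> less_imp_le[OF n0] tail])
    qed
    also have "\<dots> \<le> (SUP \<epsilon> \<in> {0<..}. ess_total_variation (u \<epsilon> \<tau>))" by (rule SUP_upper) (use \<epsilon> in auto)
    finally show ?thesis .
  qed
  show "(SUP \<epsilon> \<in> {0<..}. ess_total_variation (u \<epsilon> \<tau>)) = \<infinity>"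
  proof (rule ccontr)
    assume "(SUP \<epsilon> \<in> {0<..}. ess_total_variation (u \<epsilon> \<tau>)) \<noteq> \<infinity>"
    then have "(SUP \<epsilon> \<in> {0<..}. ess_total_variation (u \<epsilon> \<tau>)) < top"
      unfolding infinity_ennreal_def less_top .
    then obtain N where "(SUP \<epsilon> \<in> {0<..}. ess_total_variation (u \<epsilon> \<tau>)) < of_nat N"
      using ennreal_Ex_less_of_nat by auto
    then show False using large[of N] by simp
  qed
qed

end
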